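(* Let $V$ be a finite-dimensional vector space over an algebraically closed field $\Bbbk$ of characteristic $0$, let $K\subseteq\bigwedge^2V$ be a linear subspace, and suppose that $W(V,K)$ is a separable Koszul module. Let $\overline V_1^\vee,\dots,\overline V_k^\vee\subseteq V^\vee$ be the (linear) irreducible components of $\mathcal{R}(V,K)$, let $\pi_t\colon V\twoheadrightarrow\overline V_t$ be the projection dual to the inclusion $\overline V_t^\vee\subseteq V^\vee$, and let $\overline K_t=(\bigwedge^2\pi_t)(K)\subseteq\bigwedge^2\overline V_t$. Then \[ \dim W_q(V,K)=\sum_{t=1}^k\dim W_q(\overline V_t,\overline K_t)\qquad\text{for all } q\gg0 . \]
   Context: $S=\mathrm{Sym}(V)$; $K^\perp\subseteq\bigwedge^2V^\vee$ is the space of functionals vanishing on $K$. For any pair $(V,K)$, the Koszul module $W(V,K)$ is the graded $S$-module given by the middle homology of $K\otimes S\xrightarrow{\delta_2|_{K\otimes S}}V\otimes S(1)\xrightarrow{\delta_1}S(2)$, where $\delta_2(v_1\wedge v_2\otimes f)=v_2\otimes v_1f-v_1\otimes v_2f$ and $\delta_1(v\otimes f)=vf$; its degree $q$ piece $W_q(V,K)$ is the homology of $K\otimes\mathrm{Sym}^qV\to V\otimes\mathrm{Sym}^{q+1}V\to\mathrm{Sym}^{q+2}V$. The resonance variety is $\mathcal{R}(V,K)=\{a\in V^\vee:\exists\, b\in V^\vee,\ a\wedge b\in K^\perp\setminus\{0\}\}\cup\{0\}$. Let $E=\bigwedge V^\vee$ and let $\langle U\rangle_E$ denote the ideal of $E$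 generated by $U$. A linear subspace $\overline V^\vee\subseteq V^\vee$ is separable (with respect to $K$) if $K^\perp\cap\langle\overline V^\vee\rangle_E\subseteq\bigwedge^2\overline V^\vee$. The Koszul module $W(V,K)$ is separable if all irreducible components of $\mathcal{R}(V,K)$ are linear subspaces of $V^\vee$ and each of them is separable. *)

theory Defs
  imports "HOL-Library.Function_Algebras" "HOL-Computational_Algebra.Polynomial"
begin

text \<open>
  A vector space is given by a scalar multiplication \<open>s\<close> with \<^term>\<open>vector_space s\<close> and a
  carrier \<open>V\<close>, a subspace for \<open>s\<close>.  Spaces of \<open>'k\<close>-valued functions carry the pointwise structure:
  addition comes from \<^theory>\<open>HOL-Library.Function_Algebras\<close>, scalar multiplication is \<open>fscale\<close>.
\<close>

definition fscale :: "'k::field \<Rightarrow> ('x \<Rightarrow> 'k) \<Rightarrow> 'x \<Rightarrow> 'k" where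
  "fscale c f = (\<lambda>x. c * f x)"

interpretation fscale: vector_space fscale
  by standard (auto simp: fscale_def fun_eq_iff algebra_simps)

abbreviation fspan :: "('x \<Rightarrow> 'k::field) set \<Rightarrow> ('x \<Rightarrow> 'k) set" where
  "fspan \<equiv> module.span fscale"

abbreviation fsubspace :: "('x \<Rightarrow> 'k::field) set \<Rightarrow> bool" where
  "fsubspace \<equiv> module.subspace fscale"

abbreviation fdim :: "('x \<Rightarrow> 'k::field) set \<Rightarrow> nat" where
  "fdim \<equiv> vector_space.dim fscale"

text \<open>Functionals are extended by \<open>0\<close> outside the carrier, so that equality of functions is
  equality of functionals.\<close>

definition dual :: "('k::field \<Rightarrow> 'v::ab_group_add \<Rightarrow> 'v) \<Rightarrow> 'v set \<Rightarrow> ('v \<Rightarrow> 'k) set" where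
  "dual s V = {a. (\<forall>u\<in>V. \<forall>v\<in>V. a (u + v) = a u + a v) \<and> (\<forall>c. \<forall>v\<in>V. a (s c v) = c * a v) \<and>
                  (\<forall>v. v \<notin> V \<longrightarrow> a v = 0)}"

text \<open>
  \<open>eval_at D v\<close> is evaluation at \<open>v\<close> on a set \<open>D\<close> of functionals.  For \<open>D = dual s V\<close> it is the
  canonical isomorphism from \<open>V\<close> to its bidual; for a subspace \<open>D\<close> of \<open>dual s V\<close> it is the
  surjection \<open>V \<rightarrow> dual fscale D\<close> dual to the inclusion of \<open>D\<close> in \<open>dual s V\<close>.
\<close>

definition eval_at :: "('v \<Rightarrow> 'k::field) set \<Rightarrow> 'v \<Rightarrow> ('v \<Rightarrow> 'k) \<Rightarrow> 'k" where
  "eval_at D v = (\<lambda>a. if a \<in> D then a v else 0)"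

definition fun_copy :: "('k::field \<Rightarrow> 'v::ab_group_add \<Rightarrow> 'v) \<Rightarrow> 'v set \<Rightarrow> (('v \<Rightarrow> 'k) \<Rightarrow> 'k) set" where
  "fun_copy s V = eval_at (dual s V) ` V"


section \<open>Exterior algebra\<close>

text \<open>
  For a space \<open>U\<close> of functions on \<open>'x\<close>, the exterior power of degree \<open>p\<close> is realised by alternating
  functions of \<open>p\<close> arguments: elements of the exterior algebra of \<open>U\<close> are functions on lists, the
  part of degree \<open>p\<close> being supported on lists of length \<open>p\<close>.  The product is the shuffle product of
  forms, normalised such that \<open>(a\<^sub>1 \<and> \<dots> \<and> a\<^sub>p) [x\<^sub>1, \<dots>, x\<^sub>p] = det (a\<^sub>i x\<^sub>j)\<close>; the exponent
  counts the inversions of the shuffle.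
\<close>

definition wedge :: "('x list \<Rightarrow> 'k::field) \<Rightarrow> ('x list \<Rightarrow> 'k) \<Rightarrow> 'x list \<Rightarrow> 'k" where
  "wedge f g = (\<lambda>xs. \<Sum>I\<in>Pow {..<length xs}.
     (- 1) ^ card {(i, j). i \<in> I \<and> j \<in> {..<length xs} - I \<and> j < i}
     * f (nths xs I) * g (nths xs ({..<length xs} - I)))"

definition one_form :: "('x \<Rightarrow> 'k::field) \<Rightarrow> 'x list \<Rightarrow> 'k" where
  "one_form a = (\<lambda>xs. if length xs = 1 then a (hd xs) else 0)"

definition ext_one :: "'x list \<Rightarrow> 'k::field" where
  "ext_one = (\<lambda>xs. if xs = [] then 1 else 0)"

definition wedge_list :: "('x \<Rightarrow> 'k::field) list \<Rightarrow> 'x list \<Rightarrow> 'k" where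
  "wedge_list as = foldr wedge (map one_form as) ext_one"

definition ext_power :: "('x \<Rightarrow> 'k::field) set \<Rightarrow> nat \<Rightarrow> ('x list \<Rightarrow> 'k) set" where
  "ext_power U p = fspan {wedge_list as | as. set as \<subseteq> U \<and> length as = p}"

definition ext_algebra :: "('x \<Rightarrow> 'k::field) set \<Rightarrow> ('x list \<Rightarrow> 'k) set" where
  "ext_algebra U = fspan (\<Union>p. ext_power U p)"

definition ext_ideal :: "('x list \<Rightarrow> 'k::field) set \<Rightarrow> ('x list \<Rightarrow> 'k) set \<Rightarrow> bool" where
  "ext_ideal E I \<longleftrightarrow> I \<subseteq> E \<and> fsubspace I \<and> (\<forall>x\<in>E. \<forall>y\<in>I. wedge x y \<in> I \<and> wedge y x \<in> I)"

text \<open>The map that a linear \<open>f : V \<rightarrow> V'\<close> induces on exterior powers, with \<open>D'\<close> the dual of \<open>V'\<close>: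
  precompose with the transpose of \<open>f\<close>.\<close>

definition ext_map ::
    "'v set \<Rightarrow> ('w \<Rightarrow> 'k::field) set \<Rightarrow> ('v \<Rightarrow> 'w) \<Rightarrow> (('v \<Rightarrow> 'k) list \<Rightarrow> 'k) \<Rightarrow> ('w \<Rightarrow> 'k) list \<Rightarrow> 'k" where
  "ext_map V D' f \<omega> = (\<lambda>bs. if set bs \<subseteq> D'
     then \<omega> (map (\<lambda>b v. if v \<in> V then b (f v) else 0) bs) else 0)"


section \<open>Symmetric algebra, tensor products and Koszul modules\<close>

text \<open>\<open>Sym V\<close> is the algebra of polynomial functions on the dual of \<open>V\<close>; this agrees with the
  abstract symmetric algebra because the ground field is infinite.\<close>

definition sym_power :: "('k::field \<Rightarrow> 'v::ab_group_add \<Rightarrow> 'v) \<Rightarrow> 'v set \<Rightarrow> nat \<Rightarrow> (('v \<Rightarrow> 'k) \<Rightarrow> 'k) set" where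
  "sym_power s V q =
     fspan {\<lambda>a. if a \<in> dual s V then (\<Prod>v\<leftarrow>vs. a v) else 0 | vs. set vs \<subseteq> V \<and> length vs = q}"

definition sym_algebra :: "('k::field \<Rightarrow> 'v::ab_group_add \<Rightarrow> 'v) \<Rightarrow> 'v set \<Rightarrow> (('v \<Rightarrow> 'k) \<Rightarrow> 'k) set" where
  "sym_algebra s V = fspan (\<Union>q. sym_power s V q)"

definition tensor :: "('x \<Rightarrow> 'k::field) \<Rightarrow> ('y \<Rightarrow> 'k) \<Rightarrow> 'x \<times> 'y \<Rightarrow> 'k" where
  "tensor f g = (\<lambda>(x, y). f x * g y)"

definition tensor_space :: "('x \<Rightarrow> 'k::field) set \<Rightarrow> ('y \<Rightarrow> 'k) set \<Rightarrow> ('x \<times> 'y \<Rightarrow> 'k) set" where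
  "tensor_space M N = fspan {tensor f g | f g. f \<in> M \<and> g \<in> N}"

text \<open>In terms of functions the Koszul differentials are substitutions; see the lemmas
  \<open>delta1_tensor\<close> and \<open>delta2_tensor\<close> below for the usual formulas.\<close>

definition delta1 :: "('d \<times> 'd \<Rightarrow> 'k::field) \<Rightarrow> 'd \<Rightarrow> 'k" where
  "delta1 h = (\<lambda>a. h (a, a))"

definition delta2 :: "('d list \<times> 'd \<Rightarrow> 'k::field) \<Rightarrow> 'd \<times> 'd \<Rightarrow> 'k" where
  "delta2 h = (\<lambda>(b, a). h ([a, b], a))"

definition koszul_cycles ::
    "('k::field \<Rightarrow> 'v::ab_group_add \<Rightarrow> 'v) \<Rightarrow> 'v set \<Rightarrow> nat \<Rightarrow> (('v \<Rightarrow> 'k) \<times> ('v \<Rightarrow> 'k) \<Rightarrow> 'k) set" where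
  "koszul_cycles s V q = {h \<in> tensor_space (fun_copy s V) (sym_power s V (q + 1)). delta1 h = 0}"

definition koszul_boundaries ::
    "('k::field \<Rightarrow> 'v::ab_group_add \<Rightarrow> 'v) \<Rightarrow> 'v set \<Rightarrow> (('v \<Rightarrow> 'k) list \<Rightarrow> 'k) set \<Rightarrow> nat \<Rightarrow>
     (('v \<Rightarrow> 'k) \<times> ('v \<Rightarrow> 'k) \<Rightarrow> 'k) set" where
  "koszul_boundaries s V K q = delta2 ` tensor_space K (sym_power s V q)"

text \<open>The dimension of \<open>W\<^sub>q(V, K)\<close>, the quotient of the cycles by the boundaries, for
  finite-dimensional \<open>V\<close> and a subspace \<open>K\<close> of the exterior square; the subtraction does not truncate
  by \<open>koszul_boundaries_subset_cycles\<close> below.\<close>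

definition koszul_dim ::
    "('k::field \<Rightarrow> 'v::ab_group_add \<Rightarrow> 'v) \<Rightarrow> 'v set \<Rightarrow> (('v \<Rightarrow> 'k) list \<Rightarrow> 'k) set \<Rightarrow> nat \<Rightarrow> nat" where
  "koszul_dim s V K q = fdim (koszul_cycles s V q) - fdim (koszul_boundaries s V K q)"


section \<open>Resonance and separability\<close>

text \<open>An element \<open>\<eta>\<close> of the exterior square of \<open>dual s V\<close> is identified with the functional \<open>\<phi>\<close> on
  the exterior square of \<open>V\<close> that takes the value \<open>\<eta> [u, v]\<close> at \<open>u \<and> v\<close>.\<close>

definition perp ::
    "('k::field \<Rightarrow> 'v::ab_group_add \<Rightarrow> 'v) \<Rightarrow> 'v set \<Rightarrow> (('v \<Rightarrow> 'k) list \<Rightarrow> 'k) set \<Rightarrow> ('v list \<Rightarrow> 'k) set" where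
  "perp s V K = {\<eta> \<in> ext_power (dual s V) 2. \<exists>\<phi>\<in>dual fscale (ext_power (fun_copy s V) 2).
     (\<forall>u\<in>V. \<forall>v\<in>V. \<phi> (wedge_list [eval_at (dual s V) u, eval_at (dual s V) v]) = \<eta> [u, v]) \<and>
     (\<forall>\<omega>\<in>K. \<phi> \<omega> = 0)}"

definition resonance ::
    "('k::field \<Rightarrow> 'v::ab_group_add \<Rightarrow> 'v) \<Rightarrow> 'v set \<Rightarrow> (('v \<Rightarrow> 'k) list \<Rightarrow> 'k) set \<Rightarrow> ('v \<Rightarrow> 'k) set" where
  "resonance s V K = {a \<in> dual s V. \<exists>b\<in>dual s V. wedge_list [a, b] \<in> perp s V K - {0}} \<union> {0}"

definition zariski_closed ::
    "('k::field \<Rightarrow> 'v::ab_group_add \<Rightarrow> 'v) \<Rightarrow> 'v set \<Rightarrow> ('v \<Rightarrow> 'k) set \<Rightarrow> bool" where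
  "zariski_closed s V Z \<longleftrightarrow> (\<exists>F\<subseteq>sym_algebra s V. Z = {a \<in> dual s V. \<forall>f\<in>F. f a = 0})"

definition zariski_irreducible ::
    "('k::field \<Rightarrow> 'v::ab_group_add \<Rightarrow> 'v) \<Rightarrow> 'v set \<Rightarrow> ('v \<Rightarrow> 'k) set \<Rightarrow> bool" where
  "zariski_irreducible s V Z \<longleftrightarrow> Z \<noteq> {} \<and>
     (\<forall>A B. zariski_closed s V A \<and> zariski_closed s V B \<and> Z \<subseteq> A \<union> B \<longrightarrow> Z \<subseteq> A \<or> Z \<subseteq> B)"

definition irreducible_components ::
    "('k::field \<Rightarrow> 'v::ab_group_add \<Rightarrow> 'v) \<Rightarrow> 'v set \<Rightarrow> ('v \<Rightarrow> 'k) set \<Rightarrow> ('v \<Rightarrow> 'k) set set" where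
  "irreducible_components s V R = {Z. Z \<subseteq> R \<and> zariski_irreducible s V Z \<and>
     (\<forall>Y. Z \<subseteq> Y \<and> Y \<subseteq> R \<and> zariski_irreducible s V Y \<longrightarrow> Y = Z)}"

definition separable_subspace ::
    "('k::field \<Rightarrow> 'v::ab_group_add \<Rightarrow> 'v) \<Rightarrow> 'v set \<Rightarrow> (('v \<Rightarrow> 'k) list \<Rightarrow> 'k) set \<Rightarrow> ('v \<Rightarrow> 'k) set \<Rightarrow> bool" where
  "separable_subspace s V K U \<longleftrightarrow>
     perp s V K \<inter> (ext_ideal (ext_algebra (dual s V)) hull (one_form ` U)) \<subseteq> ext_power U 2"

definition separable_koszul_module ::
    "('k::field \<Rightarrow> 'v::ab_group_add \<Rightarrow> 'v) \<Rightarrow> 'v set \<Rightarrow> (('v \<Rightarrow> 'k) list \<Rightarrow> 'k) set \<Rightarrow> bool" where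
  "separable_koszul_module s V K \<longleftrightarrow>
     (\<forall>U\<in>irreducible_components s V (resonance s V K). fsubspace U \<and> separable_subspace s V K U)"


section \<open>The definitions on decomposable elements\<close>

lemma Pow_2: "Pow {..<Suc (Suc 0)} = {{}, {0}, {1}, {0, 1}}"
  by (simp add: lessThan_Suc Pow_insert insert_commute)

lemma wedge_ext_one: "wedge (one_form b) ext_one = one_form b"
proof
  fix xs :: "'a list"
  let ?N = "{..<length xs}"
  let ?F = "\<lambda>I. (- 1) ^ card {(i, j). i \<in> I \<and> j \<in> ?N - I \<and> j < i}
     * one_form b (nths xs I) * (ext_one (nths xs (?N - I)) :: 'b)"
  have z: "?F I = 0" if "I \<in> Pow ?N - {?N}" for I
  proof -
    have "I \<subset> ?N" using that by auto
    then obtain j where "j < length xs" "j \<notin> I" by auto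
    then have "nths xs (?N - I) \<noteq> []"
      by (auto simp: set_nths simp flip: set_empty)
    then show ?thesis by (simp add: ext_one_def)
  qed
  have "wedge (one_form b) ext_one xs = sum ?F (Pow ?N)" by (simp add: wedge_def)
  also have "\<dots> = sum ?F {?N}"
    by (rule sum.mono_neutral_right) (use z in auto)
  also have "\<dots> = one_form b xs"
    by (simp add: ext_one_def nths_all)
  finally show "wedge (one_form b) ext_one xs = one_form b xs" .
qed

lemma wedge_list_2_eq: "wedge_list [a, b] = wedge (one_form a) (one_form b)"
  by (simp add: wedge_list_def wedge_ext_one)

lemma wedge_list_2: "wedge_list [a, b] [x, y] = a x * b y - a y * b x"
proof -
  let ?F = "\<lambda>I. (- 1) ^ card {(i, j). i \<in> I \<and> j \<in> {..<Suc (Suc 0)} - I \<and> j < i}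
     * one_form a (nths [x, y] I) * one_form b (nths [x, y] ({..<Suc (Suc 0)} - I))"
  have 0: "{(i, j). i = (0::nat) \<and> j \<in> {..<Suc (Suc 0)} - {0} \<and> j < i} = {}" by auto
  have 1: "{(i, j). i = Suc 0 \<and> j \<in> {..<Suc (Suc 0)} - {Suc 0} \<and> j < i} = {(1, 0)}" by auto
  have F: "?F {} = 0" "?F {0} = a x * b y" "?F {1} = - a y * b x" "?F {0, 1} = 0"
    unfolding One_nat_def singleton_iff 0 1
    by (simp_all add: one_form_def nths_Cons)
  have "wedge_list [a, b] [x, y] = sum ?F {{}, {0}, {1}, {0, 1}}"
    unfolding wedge_list_2_eq wedge_def by (simp only: list.size Pow_2 add_0 add_Suc_right add_0_right)
  also have "\<dots> = ?F {} + (?F {0} + (?F {1} + ?F {0, 1}))"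
    by (subst sum.insert; simp)+
  finally show ?thesis unfolding F by simp
qed

lemma wedge_list_2_eq_0:
  assumes "length xs \<noteq> 2"
  shows "wedge_list [a, b] xs = 0"
proof -
  let ?N = "{..<length xs}"
  have "one_form a (nths xs I) * one_form b (nths xs (?N - I)) = 0" if "I \<subseteq> ?N" for I
  proof (rule ccontr)
    assume "\<not> ?thesis"
    then have "length (nths xs I) = 1" "length (nths xs (?N - I)) = 1"
      by (auto simp: one_form_def split: if_splits)
    then have *: "card {i. i < length xs \<and> i \<in> I} = 1"
        "card {i. i < length xs \<and> i \<in> ?N - I} = 1"
      by (simp_all add: length_nths)
    have "{i. i < length xs \<and> i \<in> I} = I" "{i. i < length xs \<and> i \<in> ?N - I} = ?N - I"
      using that by auto
    with * have "card I = 1" "card (?N - I) = 1" by simp_all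
    moreover have "card ?N = card I + card (?N - I)"
      using that by (metis card_Diff_subset card_mono finite_lessThan finite_subset
          le_add_diff_inverse)
    ultimately show False using assms by simp
  qed
  then show ?thesis
    unfolding wedge_list_2_eq wedge_def mult.assoc by (intro sum.neutral) simp
qed

lemma delta1_tensor: "delta1 (tensor v f) = v * f"
  by (simp add: delta1_def tensor_def fun_eq_iff)

lemma delta2_tensor: "delta2 (tensor (wedge_list [u, v]) f) = tensor v (u * f) - tensor u (v * f)"
  by (auto simp: delta2_def tensor_def wedge_list_2 fun_eq_iff algebra_simps)

lemma ext_map_wedge:
  assumes "vector_space s" "module.subspace s V"
    and f: "\<forall>u\<in>V. \<forall>v\<in>V. f (u + v) = f u + f v" "\<forall>c. \<forall>v\<in>V. f (s c v) = s' c (f v)" "f ` V \<subseteq> V'"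
    and uv: "u \<in> V" "v \<in> V"
  shows "ext_map V (dual s' V') f (wedge_list [eval_at (dual s V) u, eval_at (dual s V) v])
     = wedge_list [eval_at (dual s' V') (f u), eval_at (dual s' V') (f v)]" (is "?l = ?r")
proof
  fix bs
  interpret vector_space s by fact
  have V: "x + y \<in> V" "s c x \<in> V" if "x \<in> V" "y \<in> V" for x y c
    using assms(2) that by (auto simp: subspace_def)
  have pull: "(\<lambda>v. if v \<in> V then b (f v) else 0) \<in> dual s V" if "b \<in> dual s' V'" for b
    using that f V by (auto simp: dual_def image_subset_iff)
  show "?l bs = ?r bs"
  proof (cases "length bs = 2")
    case False
    then show ?thesis by (simp add: ext_map_def wedge_list_2_eq_0)
  next
    case True
    then obtain x y where "bs = [x, y]" by (auto simp: numeral_2_eq_2 length_Suc_conv)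
    then show ?thesis
      using uv pull by (auto simp: ext_map_def wedge_list_2 eval_at_def)
  qed
qed

lemma fun_copy_mult_sym_power:
  assumes "u \<in> fun_copy s V" "f \<in> sym_power s V q"
  shows "u * f \<in> sym_power s V (q + 1)"
proof -
  from assms(1) obtain w where w: "w \<in> V" "u = eval_at (dual s V) w" by (auto simp: fun_copy_def)
  let ?G = "\<lambda>q. {\<lambda>a. if a \<in> dual s V then (\<Prod>v\<leftarrow>vs. a v) else 0 | vs. set vs \<subseteq> V \<and> length vs = q}"
  show ?thesis using assms(2) unfolding sym_power_def
  proof (induction rule: fscale.span_induct_alt)
    case base
    show ?case unfolding mult_zero_right by (rule fscale.span_zero)
  next
    case (step c x y)
    then obtain vs where vs: "x = (\<lambda>a. if a \<in> dual s V then (\<Prod>v\<leftarrow>vs. a v) else 0)"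
      "set vs \<subseteq> V" "length vs = q" by auto
    have "u * x = (\<lambda>a. if a \<in> dual s V then (\<Prod>v\<leftarrow>w # vs. a v) else 0)"
      by (auto simp: w vs eval_at_def fun_eq_iff)
    moreover have "set (w # vs) \<subseteq> V" "length (w # vs) = q + 1" using w vs by auto
    ultimately have "u * x \<in> ?G (q + 1)" by blast
    then have "fscale c (u * x) + u * y \<in> fspan (?G (q + 1))"
      by (rule fscale.span_add[OF fscale.span_scale[OF fscale.span_base] step(2)])
    also have "fscale c (u * x) + u * y = u * (fscale c x + y)"
      by (auto simp: fscale_def fun_eq_iff algebra_simps)
    finally show ?case .
  qed
qed

lemma koszul_boundaries_subset_cycles:
  fixes s :: "'k::field \<Rightarrow> 'v::ab_group_add \<Rightarrow> 'v"
  assumes K: "K \<subseteq> ext_power (fun_copy s V) 2"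
  shows "koszul_boundaries s V K q \<subseteq> koszul_cycles s V q"
proof -
  let ?T = "tensor_space (fun_copy s V) (sym_power s V (q + 1))"
  have add: "delta2 (x + y) = delta2 x + delta2 y" for x y :: "('v \<Rightarrow> 'k) list \<times> ('v \<Rightarrow> 'k) \<Rightarrow> 'k"
    by (simp add: delta2_def fun_eq_iff)
  have scale: "delta2 (fscale c x) = fscale c (delta2 x)" for c and x :: "('v \<Rightarrow> 'k) list \<times> ('v \<Rightarrow> 'k) \<Rightarrow> 'k"
    by (simp add: delta2_def fscale_def fun_eq_iff)
  have d1: "delta1 (x + y) = delta1 x + delta1 y" "delta1 (fscale c x) = fscale c (delta1 x)"
    for c and x y :: "('v \<Rightarrow> 'k) \<times> ('v \<Rightarrow> 'k) \<Rightarrow> 'k"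
    by (simp_all add: delta1_def fscale_def fun_eq_iff)
  have C: "koszul_cycles s V q = {h \<in> ?T. delta1 h = 0}" by (simp add: koszul_cycles_def)
  have C0: "0 \<in> koszul_cycles s V q"
    by (simp add: C tensor_space_def fscale.span_zero) (simp add: delta1_def fun_eq_iff)
  have Clin: "fscale c x + y \<in> koszul_cycles s V q"
    if "x \<in> koszul_cycles s V q" "y \<in> koszul_cycles s V q" for c x y
    using that by (auto simp: C tensor_space_def d1 fscale.span_add fscale.span_scale)
  have pure: "delta2 (tensor (wedge_list [u, v]) f) \<in> koszul_cycles s V q"
    if "u \<in> fun_copy s V" "v \<in> fun_copy s V" "f \<in> sym_power s V q" for u v f
  proof -
    have "tensor v (u * f) - tensor u (v * f) \<in> ?T"
      unfolding tensor_space_def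
      using that(1,2) fun_copy_mult_sym_power[OF that(1,3)] fun_copy_mult_sym_power[OF that(2,3)]
      by (intro fscale.span_diff fscale.span_base) blast+
    moreover have "delta1 (tensor v (u * f) - tensor u (v * f)) = 0"
      by (auto simp: delta1_def tensor_def fun_eq_iff)
    ultimately show ?thesis by (simp add: C delta2_tensor)
  qed
  have gen: "delta2 (tensor \<omega> f) \<in> koszul_cycles s V q"
    if "\<omega> \<in> ext_power (fun_copy s V) 2" "f \<in> sym_power s V q" for \<omega> f
    using that(1) unfolding ext_power_def
  proof (induction rule: fscale.span_induct_alt)
    case base
    have "delta2 (tensor 0 f) = 0" by (auto simp: delta2_def tensor_def fun_eq_iff)
    with C0 show ?case by (simp only:)
  next
    case (step c x y)
    then obtain as where "x = wedge_list as" "set as \<subseteq> fun_copy s V" "length as = 2" by auto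
    then obtain u v where "x = wedge_list [u, v]" "u \<in> fun_copy s V" "v \<in> fun_copy s V"
      by (auto simp: numeral_2_eq_2 length_Suc_conv)
    then have "fscale c (delta2 (tensor x f)) + delta2 (tensor y f) \<in> koszul_cycles s V q"
      using pure that(2) step by (intro Clin) auto
    also have "fscale c (delta2 (tensor x f)) + delta2 (tensor y f) = delta2 (tensor (fscale c x + y) f)"
      by (auto simp: delta2_def tensor_def fscale_def fun_eq_iff algebra_simps)
    finally show ?case .
  qed
  have "delta2 h \<in> koszul_cycles s V q" if "h \<in> tensor_space K (sym_power s V q)" for h
    using that unfolding tensor_space_def
  proof (induction rule: fscale.span_induct_alt)
    case base
    have "delta2 0 = (0 :: ('v \<Rightarrow> 'k) \<times> ('v \<Rightarrow> 'k) \<Rightarrow> 'k)" by (simp add: delta2_def fun_eq_iff)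
    with C0 show ?case by (simp only:)
  next
    case (step c x y)
    then have "delta2 x \<in> koszul_cycles s V q" using gen K by auto
    then have "fscale c (delta2 x) + delta2 y \<in> koszul_cycles s V q" using step(2) by (rule Clin)
    then show ?case by (simp only: add scale)
  qed
  then show ?thesis by (auto simp: koszul_boundaries_def)
qed

end

theory Submission
  imports Defs "HOL-Library.Set_Algebras"
begin

text \<open>
  Write the cycles in \<open>V \<otimes> Sym\<close> as functions \<open>h (b, a)\<close> on pairs of points of the dual of \<open>V\<close>. By
  Euler's formula they are generated over \<open>Sym V\<close> by the minors \<open>a u * b v - a v * b u\<close>, and the
  boundaries by the elements of \<open>K\<close>. Let \<open>U\<close> be a component of the resonance variety and \<open>N\<close> its
  annihilator in \<open>V\<close>. Separability says dually that a minor with one argument in \<open>N\<close> lies in \<open>K\<close>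
  plus the minors of \<open>N\<close>. Hence the kernel \<open>M\<close> of the surjection from \<open>W(V, K)\<close> to the Koszul module
  of \<open>U\<close> is generated by the minors of \<open>N\<close>, and the Koszul relations give \<open>V M \<subseteq> N M\<close>. By Nakayama's
  lemma \<open>M\<close> vanishes near the nonzero points of \<open>U\<close>, so at a nonzero common point of two
  components the support of \<open>W(V, K)\<close> would be smaller than either; hence components meet only in \<open>0\<close>.
  The Chinese remainder theorem then makes \<open>W(V, K)\<close> surject onto the sum of the modules of the
  components in high degrees. The kernel, the intersection of the \<open>M\<close>, is finitely generated and
  vanishes at every nonzero point, so it has finite length.
\<close>

section \<open>Finite-dimensional spaces of functions\<close>

text \<open>Quotient modules are never formed. A pair of families \<open>B q \<subseteq> P q\<close>
  inside one function space stands for P / B, linear forms act by pointwise multiplication, and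
  dimensions of quotients are compared through equations between sums. Finite length then means
  \<open>P q = B q\<close> for all large \<open>q\<close>. The obstacle is that the kernel is given
  only as an intersection: its finite generation needs Hilbert's basis theorem, and the passage from
  vanishing at each nonzero point to vanishing in high degrees needs a homogeneous Nullstellensatz.
  Both are proved for such pairs by induction on the number of variables, dividing by one variable
  at a time. Localisation is replaced by forms: "near a point" means after multiplication by a form
  \<open>g\<close> that is nonzero at the point and works in all degrees at once. Algebraic
  closedness enters through an eigenvalue of a pencil of two variables; characteristic 0 enters
  through the factor q + 2 in Euler's formula and through a factor 1/2 in the dual form of
  separability.\<close>

definition fin_dim :: "('x \<Rightarrow> 'k::field) set \<Rightarrow> bool" where
  "fin_dim X \<longleftrightarrow> (\<exists>B. finite B \<and> X \<subseteq> fspan B)"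

lemma fin_dim_mono: "X \<subseteq> Y \<Longrightarrow> fin_dim Y \<Longrightarrow> fin_dim X"
  unfolding fin_dim_def by blast

lemma fin_dim_span: "fin_dim X \<Longrightarrow> fin_dim (fspan X)"
  unfolding fin_dim_def by (meson fscale.span_minimal fscale.subspace_span)

lemma fin_dim_insert: "fin_dim X \<Longrightarrow> fin_dim (insert x X)"
  unfolding fin_dim_def
proof (elim exE conjE)
  fix B assume "finite B" "X \<subseteq> fspan B"
  then show "\<exists>B. finite B \<and> insert x X \<subseteq> fspan B"
    using fscale.span_mono[of B "insert x B"]
    by (intro exI[of _ "insert x B"]) (auto intro: fscale.span_base)
qed

lemma fsubspace_plus: "fsubspace A \<Longrightarrow> fsubspace B \<Longrightarrow> fsubspace (A + B)"
proof -
  assume "fsubspace A" "fsubspace B"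
  moreover have "A + B = {x + y |x y. x \<in> A \<and> y \<in> B}" by (auto simp: set_plus_def)
  ultimately show ?thesis using fscale.subspace_sums[of A B] by simp
qed

lemma fin_dim_Un: "fin_dim X \<Longrightarrow> fin_dim Y \<Longrightarrow> fin_dim (X \<union> Y)"
  unfolding fin_dim_def
proof (elim exE conjE)
  fix B C assume "finite B" "X \<subseteq> fspan B" "finite C" "Y \<subseteq> fspan C"
  then show "\<exists>B. finite B \<and> X \<union> Y \<subseteq> fspan B"
    using fscale.span_mono[of B "B \<union> C"] fscale.span_mono[of C "B \<union> C"]
    by (intro exI[of _ "B \<union> C"]) auto
qed

lemma plus_subset: "fsubspace Z \<Longrightarrow> A \<subseteq> Z \<Longrightarrow> B \<subseteq> Z \<Longrightarrow> A + B \<subseteq> Z"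
  by (auto simp: set_plus_def intro: fscale.subspace_add)

lemma plus_superset1: "fsubspace B \<Longrightarrow> A \<subseteq> A + B"
  using set_zero_plus2[of B A] fscale.subspace_0[of B] by (simp add: add.commute)

lemma plus_superset2: "fsubspace A \<Longrightarrow> B \<subseteq> A + B"
  using set_zero_plus2[of A B] fscale.subspace_0[of A] by simp

lemma fin_dim_plus: "fin_dim X \<Longrightarrow> fin_dim Y \<Longrightarrow> fin_dim (X + Y)"
proof -
  assume XY: "fin_dim X" "fin_dim Y"
  have "X + Y \<subseteq> fspan (X \<union> Y)"
    by (intro plus_subset) (auto intro: fscale.span_base)
  then show ?thesis using fin_dim_mono fin_dim_span fin_dim_Un XY by blast
qed

lemma fin_dim_basis:
  assumes "fin_dim X"
  obtains B where "finite B" "B \<subseteq> X" "fscale.independent B" "X \<subseteq> fspan B" "card B = fdim X"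
proof -
  obtain B where B: "B \<subseteq> X" "fscale.independent B" "X \<subseteq> fspan B" "card B = fdim X"
    using fscale.basis_exists by blast
  moreover have "finite B"
    using assms B fscale.independent_span_bound unfolding fin_dim_def by (meson order_trans)
  ultimately show ?thesis using that by blast
qed

lemma fdim_mono: "X \<subseteq> fspan Y \<Longrightarrow> fin_dim Y \<Longrightarrow> fdim X \<le> fdim Y"
proof -
  assume X: "X \<subseteq> fspan Y" and Y: "fin_dim Y"
  obtain B where "finite B" "B \<subseteq> Y" "Y \<subseteq> fspan B" "card B = fdim Y"
    using fin_dim_basis[OF Y] by metis
  then show ?thesis
    using fscale.dim_le_card[of X B] X fscale.span_minimal[of Y "fspan B"] by auto
qed

lemma fdim_insert:
  assumes "fin_dim X" "x \<notin> fspan X"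
  shows "fdim (insert x X) = Suc (fdim X)"
proof -
  obtain B where B: "finite B" "B \<subseteq> X" "fscale.independent B" "X \<subseteq> fspan B" "card B = fdim X"
    using fin_dim_basis[OF assms(1)] .
  have x: "x \<notin> fspan B" using assms(2) B fscale.span_mono by blast
  show ?thesis
  proof (rule fscale.dim_unique[of "insert x B"])
    show "insert x X \<subseteq> fspan (insert x B)"
      using B fscale.span_mono[of B "insert x B"] by (auto intro: fscale.span_base)
    show "card (insert x B) = Suc (fdim X)"
      using B x fscale.span_base[of x B] by (subst card_insert_disjoint) auto
  qed (use B x fscale.independent_insertI in auto)
qed

lemma fdim_subspace_eq:
  assumes "fsubspace X" "X \<subseteq> Y" "fin_dim Y" "fdim Y \<le> fdim X"
  shows "X = Y"
proof (rule ccontr)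
  assume "X \<noteq> Y"
  then obtain y where y: "y \<in> Y" "y \<notin> X" using assms by blast
  have "y \<notin> fspan X" using y assms(1) by (simp add: fscale.span_eq_iff[THEN iffD2])
  then have "fdim (insert y X) = Suc (fdim X)"
    using fdim_insert fin_dim_mono[OF assms(2,3)] by blast
  moreover have "fdim (insert y X) \<le> fdim Y"
    using assms y by (intro fdim_mono) (auto intro: fscale.span_base)
  ultimately show False using assms by simp
qed

lemma mult_fscale: "u * fscale c x = fscale c (u * x)" "fscale c u * x = fscale c (u * x)"
  by (simp_all add: fscale_def fun_eq_iff mult.left_commute mult.assoc)

lemma image_fspan:
  assumes add: "\<And>x y. f (x + y) = f x + f y" and scale: "\<And>c x. f (fscale c x) = fscale c (f x)"
  shows "f ` fspan S = fspan (f ` S)"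
proof
  have f0: "f 0 = 0" using add[of 0 0] by simp
  show "f ` fspan S \<subseteq> fspan (f ` S)"
  proof clarify
    fix x assume "x \<in> fspan S"
    then show "f x \<in> fspan (f ` S)"
    proof (induction rule: fscale.span_induct_alt)
      case base
      show ?case unfolding f0 by (rule fscale.span_zero)
    next
      case (step c x y)
      have "f x \<in> fspan (f ` S)" by (intro fscale.span_base imageI step(1))
      then show ?case unfolding add scale by (intro fscale.span_add fscale.span_scale step(2))
    qed
  qed
  have "fsubspace (f ` fspan S)"
    unfolding fscale.subspace_def
  proof (intro conjI ballI allI)
    show "0 \<in> f ` fspan S" using f0 by (metis imageI fscale.span_zero)
    fix x y assume "x \<in> f ` fspan S" "y \<in> f ` fspan S"
    then show "x + y \<in> f ` fspan S" by (elim imageE) (simp only: add[symmetric] fscale.span_add imageI)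
  next
    fix c x assume "x \<in> f ` fspan S"
    then show "fscale c x \<in> f ` fspan S" by (elim imageE) (simp only: scale[symmetric] fscale.span_scale imageI)
  qed
  then show "fspan (f ` S) \<subseteq> f ` fspan S"
    by (rule fscale.span_minimal[rotated]) (auto intro: fscale.span_base)
qed

lemma fin_dim_linear_image:
  assumes add: "\<And>x y. f (x + y) = f x + f y" and scale: "\<And>c x. f (fscale c x) = fscale c (f x)"
    and "fin_dim P"
  shows "fin_dim (f ` P)"
proof -
  obtain S where S: "finite S" "P \<subseteq> fspan S" using assms(3) unfolding fin_dim_def by blast
  have "f ` P \<subseteq> fspan (f ` S)" using S(2) image_fspan[of f S, OF add scale] by blast
  then show ?thesis using S(1) unfolding fin_dim_def by blast
qed

lemma image_subspace:
  assumes "\<And>x y. f (x + y) = f x + f y" "\<And>c x. f (fscale c x) = fscale c (f x)" "fsubspace S"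
  shows "fsubspace (f ` S)"
proof -
  have "fspan S = S" using assms(3) by simp
  then show ?thesis using image_fspan[of f S, OF assms(1,2)] by (metis fscale.subspace_span)
qed

text \<open>The induction enlarges \<open>B\<close> one dimension at a time.\<close>

lemma relative_fdim_eq:
  fixes f :: "('x \<Rightarrow> 'k::field) \<Rightarrow> ('y \<Rightarrow> 'k)"
  assumes add: "\<And>x y. f (x + y) = f x + f y" and scale: "\<And>c x. f (fscale c x) = fscale c (f x)"
    and "fsubspace B" "fsubspace P" "B \<subseteq> P" "fin_dim P" "fsubspace B'" "fin_dim B'"
    and "f ` B \<subseteq> B'" "f ` P + B' = P'" "\<And>x. x \<in> P \<Longrightarrow> f x \<in> B' \<Longrightarrow> x \<in> B"
  shows "fdim P + fdim B' = fdim P' + fdim B"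
  using assms(3-)
proof (induction "fdim P - fdim B" arbitrary: B B')
  case 0
  then have "B = P" by (intro fdim_subspace_eq) auto
  have "f ` P + B' \<subseteq> B'" using 0 \<open>B = P\<close> by (intro plus_subset) auto
  moreover have "f 0 = 0" using add[of 0 0] by simp
  then have "0 \<in> f ` P" using fscale.subspace_0[OF 0(3)] by (metis imageI)
  then have "B' \<subseteq> f ` P + B'" by (rule set_zero_plus2)
  ultimately have "P' = B'" using 0 by simp
  with \<open>B = P\<close> show ?case by simp
next
  case (Suc n)
  have lin: "f (x - y) = f x - f y" for x y
    using add[of "x - y" y] by simp
  from Suc.hyps(2) obtain x where x: "x \<in> P" "x \<notin> B"
  proof -
    have "B \<noteq> P" using Suc.hyps(2) by auto
    then show thesis using that Suc.prems(3) by blast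
  qed
  have fx: "f x \<notin> B'" using x Suc.prems by blast
  let ?B = "fspan (insert x B)" and ?B' = "fspan (insert (f x) B')"
  have B: "fspan B = B" "fspan B' = B'" using Suc.prems by auto
  have fdB: "fin_dim B" using Suc.prems fin_dim_mono by blast
  have d: "fdim ?B = Suc (fdim B)" "fdim ?B' = Suc (fdim B')"
    using fdim_insert[OF fdB] fdim_insert[OF Suc.prems(6)] x fx B by auto
  have "fdim P + fdim ?B' = fdim P' + fdim ?B"
  proof (rule Suc.hyps)
    show "n = fdim P - fdim ?B" using d Suc.hyps(2) by simp
    show sub: "?B \<subseteq> P" using Suc.prems x by (intro fscale.span_minimal) auto
    show "f ` ?B \<subseteq> ?B'"
    proof clarify
      fix y assume "y \<in> ?B"
      then obtain c where "y - fscale c x \<in> B" using B fscale.span_breakdown_eq by metis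
      then have "f (y - fscale c x) \<in> B'" using Suc.prems(7) by blast
      then have "f y - fscale c (f x) \<in> B'" by (simp add: lin scale)
      then show "f y \<in> ?B'" using B fscale.span_breakdown_eq by metis
    qed
    show "f ` P + ?B' = P'"
    proof
      have "fsubspace (f ` P + B')"
        by (intro fsubspace_plus image_subspace Suc.prems(2,5) add scale)
      then have "fsubspace P'" by (simp only: Suc.prems(8))
      moreover have "f ` P \<subseteq> P'"
        using plus_superset1[OF Suc.prems(5), of "f ` P"] by (simp only: Suc.prems(8))
      moreover have "B' \<subseteq> P'"
      proof -
        have "f 0 = 0" using lin[of 0 0] by simp
        then have "0 \<in> f ` P" using fscale.subspace_0[OF Suc.prems(2)] by (metis imageI)
        then show ?thesis using set_zero_plus2[of "f ` P" B'] by (simp only: Suc.prems(8))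
      qed
      ultimately show "f ` P + ?B' \<subseteq> P'"
        using x by (intro plus_subset fscale.span_minimal) auto
      show "P' \<subseteq> f ` P + ?B'"
      proof -
        have "B' \<subseteq> ?B'" by (auto intro: fscale.span_base)
        then have "f ` P + B' \<subseteq> f ` P + ?B'" by (intro set_plus_mono2) auto
        then show ?thesis by (simp only: Suc.prems(8))
      qed
    qed
    show "y \<in> ?B" if y: "y \<in> P" "f y \<in> ?B'" for y
    proof -
      obtain c where "f y - fscale c (f x) \<in> B'" using y B fscale.span_breakdown_eq by metis
      then have "f (y - fscale c x) \<in> B'" by (simp add: lin scale)
      moreover have "y - fscale c x \<in> P"
        using y x Suc.prems by (intro fscale.subspace_diff fscale.subspace_scale)
      ultimately have "y - fscale c x \<in> B" using Suc.prems by blast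
      then show ?thesis using B fscale.span_breakdown_eq by metis
    qed
  qed (use Suc.prems in \<open>auto intro!: fin_dim_span fin_dim_insert\<close>)
  then show ?case using d by simp
qed

text \<open>Apply \<open>relative_fdim_eq\<close> to the identity map: X / (X \<inter> Y) is
  isomorphic to (X + Y) / Y.\<close>

lemma fdim_plus_Int:
  assumes "fsubspace X" "fsubspace Y" "fin_dim X" "fin_dim Y"
  shows "fdim (X + Y) + fdim (X \<inter> Y) = fdim X + fdim Y"
  using relative_fdim_eq[of "\<lambda>x. x" "X \<inter> Y" X Y "X + Y"] assms
  by (simp add: fscale.subspace_inter)

text \<open>Multiplication by \<open>u\<close> maps P / B onto (u P + B') / B', which is at least as
  large as the image of \<open>P'\<close>. The set \<open>C\<close>, the full preimage of
  \<open>B'\<close>, contains \<open>B\<close> and makes the induced map injective.\<close>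

lemma relative_fdim_le:
  fixes u :: "'x \<Rightarrow> 'k::field"
  assumes "fsubspace B" "fsubspace P" "B \<subseteq> P" "fin_dim P" "fsubspace B'" "fin_dim B'"
    and uB: "\<And>x. x \<in> B \<Longrightarrow> u * x \<in> B'" and P': "P' \<subseteq> (*) u ` P + B'"
  shows "fdim P' + fdim B \<le> fdim P + fdim B'"
proof -
  define C where "C = {x \<in> P. u * x \<in> B'}"
  note sc = mult_fscale(1)[of u]
  have add: "u * (x + y) = u * x + u * y" for x y by (simp add: distrib_left)
  have C: "fsubspace C" using assms
    by (auto simp: C_def fscale.subspace_def sc add)
  have eq: "fdim P + fdim B' = fdim ((*) u ` P + B') + fdim C"
    by (rule relative_fdim_eq[of "(*) u"]) (use assms C sc add in \<open>auto simp: C_def\<close>)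
  have img: "fin_dim ((*) u ` P)" using assms(4) by (rule fin_dim_linear_image[OF add mult_fscale(1)])
  have "fdim P' \<le> fdim ((*) u ` P + B')"
    using P' img assms by (intro fdim_mono fin_dim_plus) (auto intro: fscale.span_base)
  moreover have "fdim B \<le> fdim C"
    using assms fin_dim_mono[of C P] by (intro fdim_mono) (auto simp: C_def intro: fscale.span_base)
  ultimately show ?thesis using eq by simp
qed

text \<open>A nonzero element of the kernel of the induced map on P / B makes the inequality strict:
  \<open>B\<close> may be enlarged by \<open>x\<close> before \<open>relative_fdim_le\<close> is
  applied.\<close>

lemma relative_fdim_less:
  fixes u :: "'x \<Rightarrow> 'k::field"
  assumes "fsubspace B" "fsubspace P" "B \<subseteq> P" "fin_dim P" "fsubspace B'" "fin_dim B'"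
    and uB: "\<And>x. x \<in> B \<Longrightarrow> u * x \<in> B'" and P': "P' \<subseteq> (*) u ` P + B'"
    and x: "x \<in> P" "x \<notin> B" "u * x \<in> B'"
  shows "fdim P' + fdim B < fdim P + fdim B'"
proof -
  have B: "fspan B = B" using assms by simp
  have "fdim P' + fdim (fspan (insert x B)) \<le> fdim P + fdim B'"
  proof (rule relative_fdim_le)
    show "fspan (insert x B) \<subseteq> P" using assms by (intro fscale.span_minimal) auto
    fix y assume "y \<in> fspan (insert x B)"
    then obtain c where "y - fscale c x \<in> B" using B fscale.span_breakdown_eq by metis
    then have "u * (y - fscale c x) + fscale c (u * x) \<in> B'"
      by (intro fscale.subspace_add[OF assms(5)] fscale.subspace_scale[OF assms(5)] uB x(3))
    also have "u * (y - fscale c x) + fscale c (u * x) = u * y"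
      by (simp add: fscale_def fun_eq_iff algebra_simps)
    finally show "u * y \<in> B'" .
  qed (use assms in auto)
  moreover have "fdim (fspan (insert x B)) = Suc (fdim B)"
    using fdim_insert[of B x] x B fin_dim_mono[OF assms(3,4)] by simp
  ultimately show ?thesis by simp
qed

section \<open>Graded modules of functions\<close>

definition span_times :: "('x \<Rightarrow> 'k::field) set \<Rightarrow> ('x \<Rightarrow> 'k) set \<Rightarrow> ('x \<Rightarrow> 'k) set"
    (infixl "\<odot>" 70) where
  "X \<odot> Y = fspan (X * Y)"

text \<open>All degrees live in the same function space and may overlap there; only the index
  \<open>q\<close> records the degree. \<open>V\<close> is any set of multipliers of degree 1, a
  finite set of variables as well as a whole space of linear forms, which makes induction on the
  number of variables possible.\<close>

definition graded_module :: "('x \<Rightarrow> 'k::field) set \<Rightarrow> (nat \<Rightarrow> ('x \<Rightarrow> 'k) set) \<Rightarrow> bool" where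
  "graded_module V M \<longleftrightarrow> (\<forall>q. fsubspace (M q)) \<and> (\<forall>q. \<forall>v\<in>V. \<forall>x\<in>M q. v * x \<in> M (Suc q))"

lemma span_times_subspace [simp]: "fsubspace (X \<odot> Y)"
  by (simp add: span_times_def)

lemma span_timesI: "x \<in> X \<Longrightarrow> y \<in> Y \<Longrightarrow> x * y \<in> X \<odot> Y"
  by (auto simp: span_times_def intro!: fscale.span_base)

lemma span_times_subset:
  assumes "fsubspace Z" "\<And>x y. x \<in> X \<Longrightarrow> y \<in> Y \<Longrightarrow> x * y \<in> Z"
  shows "X \<odot> Y \<subseteq> Z"
  unfolding span_times_def using assms by (intro fscale.span_minimal) (auto simp: set_times_def)

lemma span_times_mono: "X \<subseteq> X' \<Longrightarrow> Y \<subseteq> Y' \<Longrightarrow> X \<odot> Y \<subseteq> X' \<odot> Y'"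
  by (intro span_times_subset) (auto intro: span_timesI)

lemma mult_span_left:
  assumes "fsubspace Z" "\<And>x. x \<in> X \<Longrightarrow> x * y \<in> Z" "x \<in> fspan X"
  shows "x * y \<in> Z"
  using assms(3)
proof (induction rule: fscale.span_induct_alt)
  case base
  show ?case unfolding mult_zero_left by (rule fscale.subspace_0[OF assms(1)])
next
  case (step c a b)
  then show ?case unfolding distrib_right mult_fscale
    by (intro fscale.subspace_add[OF assms(1)] fscale.subspace_scale[OF assms(1)] assms(2)[of a])
qed

lemma mult_span_right:
  assumes "fsubspace Z" "\<And>y. y \<in> Y \<Longrightarrow> x * y \<in> Z" "y \<in> fspan Y"
  shows "x * y \<in> Z"
  using mult_span_left[of Z Y x y] assms by (simp add: mult.commute)

lemma span_times_fspan_left: "fspan X \<odot> Y = X \<odot> Y"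
proof
  show "fspan X \<odot> Y \<subseteq> X \<odot> Y"
  proof (rule span_times_subset)
    fix x y assume "x \<in> fspan X" "y \<in> Y"
    then show "x * y \<in> X \<odot> Y" by (intro mult_span_left[OF _ span_timesI]) simp_all
  qed simp
qed (intro span_times_mono fscale.span_superset order_refl)

lemma span_times_fspan_right: "X \<odot> fspan Y = X \<odot> Y"
proof
  show "X \<odot> fspan Y \<subseteq> X \<odot> Y"
  proof (rule span_times_subset)
    fix x y assume "x \<in> X" "y \<in> fspan Y"
    then show "x * y \<in> X \<odot> Y" by (intro mult_span_right[OF _ span_timesI]) simp_all
  qed simp
qed (intro span_times_mono fscale.span_superset order_refl)

lemma mult_span_times:
  assumes "\<And>z. z \<in> Z \<Longrightarrow> w * z \<in> Z'" "c \<in> Y \<odot> Z"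
  shows "w * c \<in> Y \<odot> Z'"
  using assms(2) unfolding span_times_def[of Y Z]
proof (rule mult_span_right[rotated 2])
  fix c assume "c \<in> Y * Z"
  then obtain y z where "y \<in> Y" "z \<in> Z" "c = y * z" by (auto simp: set_times_def)
  then have "w * c = y * (w * z)" by (simp add: ac_simps)
  moreover have "w * z \<in> Z'" using assms(1) \<open>z \<in> Z\<close> .
  ultimately show "w * c \<in> Y \<odot> Z'" using \<open>y \<in> Y\<close> by (simp only: span_timesI)
qed simp

lemma fsubspace_times_image: "fsubspace Y \<Longrightarrow> fsubspace ((*) u ` Y)"
  by (rule image_subspace[OF distrib_left mult_fscale(1)])

lemma insert_span_times_subset:
  assumes "fsubspace Z"
  shows "insert u X \<odot> Z \<subseteq> X \<odot> Z + (*) u ` Z"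
proof (rule span_times_subset)
  show "fsubspace (X \<odot> Z + (*) u ` Z)"
    using assms by (intro fsubspace_plus fsubspace_times_image) auto
  fix x y assume "x \<in> insert u X" "y \<in> Z"
  then consider "x * y \<in> X \<odot> Z" | "x * y \<in> (*) u ` Z" by (auto intro: span_timesI)
  then show "x * y \<in> X \<odot> Z + (*) u ` Z"
    using plus_superset1[OF fsubspace_times_image[OF assms], of "X \<odot> Z" u]
      plus_superset2[of "X \<odot> Z" "(*) u ` Z"] by cases (blast, simp, blast)
qed

lemma graded_moduleD:
  assumes "graded_module V M"
  shows "fsubspace (M q)" "v \<in> V \<Longrightarrow> x \<in> M q \<Longrightarrow> v * x \<in> M (Suc q)"
  using assms by (auto simp: graded_module_def)

lemma graded_module_mono: "graded_module V M \<Longrightarrow> U \<subseteq> V \<Longrightarrow> graded_module U M"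
  by (auto simp: graded_module_def)

lemma graded_module_span: "graded_module V M \<Longrightarrow> graded_module (fspan V) M"
  unfolding graded_module_def using mult_span_left by blast

lemma graded_module_power: "graded_module V M \<Longrightarrow> v \<in> V \<Longrightarrow> x \<in> M q \<Longrightarrow> v ^ i * x \<in> M (q + i)"
  by (induction i) (auto simp: mult.assoc graded_moduleD)

lemma graded_module_plus:
  assumes "graded_module V M" "graded_module V N"
  shows "graded_module V (\<lambda>q. M q + N q)"
  unfolding graded_module_def
proof (intro conjI allI ballI)
  show "fsubspace (M q + N q)" for q using assms by (intro fsubspace_plus graded_moduleD)
  fix q v x assume v: "v \<in> V" and "x \<in> M q + N q"
  then obtain y z where "x = y + z" "y \<in> M q" "z \<in> N q" by (auto elim: set_plus_elim)
  then show "v * x \<in> M (Suc q) + N (Suc q)"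
    using v assms by (auto simp: distrib_left intro!: set_plus_intro graded_moduleD(2))
qed

text \<open>Dividing by it trivialises the action of \<open>u\<close> on \<open>A\<close>.\<close>

definition adjoin :: "('x \<Rightarrow> 'k::field) \<Rightarrow> (nat \<Rightarrow> ('x \<Rightarrow> 'k) set) \<Rightarrow> (nat \<Rightarrow> ('x \<Rightarrow> 'k) set) \<Rightarrow>
    nat \<Rightarrow> ('x \<Rightarrow> 'k) set" where
  "adjoin u A B q = (case q of 0 \<Rightarrow> B 0 | Suc p \<Rightarrow> (*) u ` A p + B (Suc p))"

lemma graded_module_adjoin:
  assumes A: "graded_module V A" and B: "graded_module V B"
  shows "graded_module V (adjoin u A B)"
  unfolding graded_module_def
proof (intro conjI allI ballI)
  show sub: "fsubspace (adjoin u A B q)" for q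
    using graded_moduleD(1)[OF A] graded_moduleD(1)[OF B]
    by (cases q) (auto simp: adjoin_def intro!: fsubspace_plus fsubspace_times_image)
  fix q v x assume v: "v \<in> V" and x: "x \<in> adjoin u A B q"
  show "v * x \<in> adjoin u A B (Suc q)"
  proof (cases q)
    case 0
    then have "v * x \<in> B (Suc q)" using v x B by (auto simp: adjoin_def graded_moduleD)
    then show ?thesis
      using plus_superset2[OF fsubspace_times_image[OF graded_moduleD(1)[OF A]], of "B (Suc q)" u q]
      unfolding adjoin_def by simp blast
  next
    case (Suc p)
    then obtain a b where ab: "x = u * a + b" "a \<in> A p" "b \<in> B q"
      using x by (auto simp: adjoin_def elim!: set_plus_elim)
    then have "v * x = u * (v * a) + v * b" by (simp add: algebra_simps)
    moreover have "u * (v * a) \<in> (*) u ` A q" "v * b \<in> B (Suc q)"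
      using ab v A B Suc by (auto intro: graded_moduleD)
    ultimately show ?thesis by (simp only: adjoin_def nat.case set_plus_intro)
  qed
qed

lemma adjoin_superset: "fsubspace (A (q - 1)) \<Longrightarrow> B q \<subseteq> adjoin u A B q"
  by (cases q) (simp_all add: adjoin_def plus_superset2 fsubspace_times_image)

lemma adjoin_subset:
  assumes "graded_module V A" "u \<in> V" "B q \<subseteq> A q"
  shows "adjoin u A B q \<subseteq> A q"
proof (cases q)
  case (Suc p)
  have "(*) u ` A p + B q \<subseteq> A q"
    using assms Suc by (intro plus_subset) (auto intro: graded_moduleD)
  then show ?thesis by (simp add: adjoin_def Suc)
qed (use assms in \<open>simp add: adjoin_def\<close>)

section \<open>Hilbert's basis theorem\<close>

text \<open>The union has a finite basis, each element of which already lies in some member; the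
  largest index that occurs serves.\<close>

lemma ascending_chain_stabilizes:
  assumes sub: "\<And>i. fsubspace (L i)" and mono: "\<And>i::nat. L i \<subseteq> L (Suc i)"
    and fd: "\<And>i. L i \<subseteq> A" "fin_dim A"
  shows "\<exists>i. (\<Union>i. L i) = L i"
proof -
  have mono': "i \<le> j \<Longrightarrow> L i \<subseteq> L j" for i j using lift_Suc_mono_le[of L] mono by blast
  have "fin_dim (\<Union>i. L i)" using fd by (intro fin_dim_mono[OF _ fd(2)]) auto
  then obtain B where B: "finite B" "B \<subseteq> (\<Union>i. L i)" "(\<Union>i. L i) \<subseteq> fspan B"
    using fin_dim_basis by metis
  obtain s where s: "\<And>b. b \<in> B \<Longrightarrow> b \<in> L (s b)" using B(2) by (metis UN_E subsetD)
  have "B \<subseteq> L (Max (insert 0 (s ` B)))"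
  proof
    fix b assume b: "b \<in> B"
    then have "s b \<le> Max (insert 0 (s ` B))" using B(1) by (intro Max_ge) auto
    then show "b \<in> L (Max (insert 0 (s ` B)))" using s[OF b] mono' by blast
  qed
  then have "fspan B \<subseteq> L (Max (insert 0 (s ` B)))" using sub by (intro fscale.span_minimal)
  then show ?thesis using B by blast
qed

text \<open>Hilbert's basis theorem: the colon modules \<open>P : v^i\<close>, taken modulo \<open>v A\<close>, increase with \<open>i\<close>
  and are finitely generated over one variable less.\<close>

lemma noetherian:
  fixes X :: "('x \<Rightarrow> 'k::field) set"
  assumes "finite X" "graded_module X A" "graded_module X B" "graded_module X P"
    and "\<And>q. B q \<subseteq> P q" "\<And>q. P q \<subseteq> A q" "\<And>q. fin_dim (A q)"
    and "\<And>q. A (Suc q) \<subseteq> X \<odot> A q + B (Suc q)"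
  shows "\<exists>q0. \<forall>q\<ge>q0. P (Suc q) \<subseteq> X \<odot> P q + B (Suc q)"
  using assms
proof (induction X arbitrary: B P rule: finite_induct)
  case empty
  have "A (Suc q) \<subseteq> B (Suc q)" for q
  proof -
    have "{} \<odot> A q = {0}" by (simp add: span_times_def set_times_def)
    then show ?thesis using empty.prems(7)[of q] by simp
  qed
  then have "P (Suc q) \<subseteq> {} \<odot> P q + B (Suc q)" for q
    using empty.prems(5) plus_superset2[of "{} \<odot> P q" "B (Suc q)"] by (meson order_trans span_times_subspace)
  then show ?case by blast
next
  case (insert v Y)
  note A = insert.prems(1) and B = insert.prems(2) and P = insert.prems(3)
  note BP = insert.prems(4) and PA = insert.prems(5)
  have Y: "graded_module Y A" "graded_module Y B" "graded_module Y P"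
    using A B P by (auto intro: graded_module_mono)
  \<comment> \<open>Modulo \<open>B'\<close> the variable \<open>v\<close> acts on \<open>A\<close>
    as zero, so A / B' is generated over \<open>Y\<close> alone and the induction hypothesis applies
    to its submodules.\<close>
  define B' where "B' = adjoin v A B"
  have B': "graded_module Y B'" unfolding B'_def using Y by (intro graded_module_adjoin)
  have BB': "B q \<subseteq> B' q" for q
    unfolding B'_def using A by (intro adjoin_superset graded_moduleD)
  have B'A: "B' q \<subseteq> A q" for q
    unfolding B'_def using BP PA by (intro adjoin_subset[OF A]) blast+
  define C where "C i q = {x \<in> A q. v ^ i * x \<in> P (q + i)}" for i q
  define L where "L i q = C i q + B' q" for i q
  have C: "graded_module Y (C i)" for i
    unfolding graded_module_def
  proof (intro conjI allI ballI)
    show "fsubspace (C i q)" for q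
      using graded_moduleD(1)[OF A, of q] graded_moduleD(1)[OF P, of "q + i"]
      unfolding C_def fscale.subspace_def by (auto simp: distrib_left mult_fscale)
    show "y * x \<in> C i (Suc q)" if "y \<in> Y" "x \<in> C i q" for q x y
      using that graded_moduleD(2)[OF Y(1)] graded_moduleD(2)[OF Y(3), of y "v ^ i * x" "q + i"]
      by (auto simp: C_def mult.left_commute)
  qed
  have L: "graded_module Y (L i)" for i
    unfolding L_def using C B' by (rule graded_module_plus)
  have CS: "C i q \<subseteq> C (Suc i) q" for i q
    using graded_moduleD(2)[OF P, of v] by (auto simp: C_def mult.assoc)
  have LS: "L i q \<subseteq> L (Suc i) q" for i q
    unfolding L_def using CS by (intro set_plus_mono2) auto
  have Lmono: "i \<le> j \<Longrightarrow> L i q \<subseteq> L j q" for i j q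
    using lift_Suc_mono_le[of "\<lambda>i. L i q"] LS by blast
  have LA: "L i q \<subseteq> A q" for i q
    unfolding L_def using B'A A by (intro plus_subset graded_moduleD) (auto simp: C_def)
  have B'L: "B' q \<subseteq> L i q" for i q
    unfolding L_def using C by (intro plus_superset2 graded_moduleD)
  have gen: "A (Suc q) \<subseteq> Y \<odot> A q + B' (Suc q)" for q
  proof -
    have "insert v Y \<odot> A q \<subseteq> Y \<odot> A q + (*) v ` A q"
      using A by (intro insert_span_times_subset graded_moduleD)
    then have "A (Suc q) \<subseteq> (Y \<odot> A q + (*) v ` A q) + B (Suc q)"
      using insert.prems(7)[of q] by (meson order_trans set_plus_mono2 order_refl)
    then show ?thesis by (simp add: B'_def adjoin_def add.assoc)
  qed
  define Li where "Li q = (\<Union>i. L i q)" for q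
  have Li: "graded_module Y Li"
    unfolding graded_module_def
  proof (intro conjI allI ballI)
    show "fsubspace (Li q)" for q
      unfolding fscale.subspace_def
    proof (intro conjI ballI allI)
      show "0 \<in> Li q" using fscale.subspace_0[OF graded_moduleD(1)[OF L]] by (auto simp: Li_def)
      show "fscale c x \<in> Li q" if "x \<in> Li q" for c x
        using that fscale.subspace_scale[OF graded_moduleD(1)[OF L]] unfolding Li_def by blast
      fix x y assume "x \<in> Li q" "y \<in> Li q"
      then obtain i j where "x \<in> L i q" "y \<in> L j q" by (auto simp: Li_def)
      then have "x \<in> L (max i j) q" "y \<in> L (max i j) q"
        using Lmono[of i "max i j" q] Lmono[of j "max i j" q] by auto
      then have "x + y \<in> L (max i j) q" using fscale.subspace_add[OF graded_moduleD(1)[OF L]] by blast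
      then show "x + y \<in> Li q" unfolding Li_def by blast
    qed
    show "y * x \<in> Li (Suc q)" if "y \<in> Y" "x \<in> Li q" for q x y
      using that graded_moduleD(2)[OF L, of y x] unfolding Li_def by blast
  qed
  have "\<exists>q0. \<forall>q\<ge>q0. Li (Suc q) \<subseteq> Y \<odot> Li q + B' (Suc q)"
  proof (rule insert.IH[OF Y(1) B' Li _ _ insert.prems(6) gen])
    show "B' q \<subseteq> Li q" "Li q \<subseteq> A q" for q using B'L LA unfolding Li_def by blast+
  qed
  then obtain q1 where q1: "\<And>q. q \<ge> q1 \<Longrightarrow> Li (Suc q) \<subseteq> Y \<odot> Li q + B' (Suc q)" by blast
  have "\<exists>q0. \<forall>q\<ge>q0. L i (Suc q) \<subseteq> Y \<odot> L i q + B' (Suc q)" for i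
    by (rule insert.IH[OF Y(1) B' L B'L LA insert.prems(6) gen])
  then obtain Q where Q: "\<And>i q. q \<ge> Q i \<Longrightarrow> L i (Suc q) \<subseteq> Y \<odot> L i q + B' (Suc q)" by metis
  have "\<exists>i. Li q = L i q" for q
    unfolding Li_def
    by (rule ascending_chain_stabilizes[of "\<lambda>i. L i q", OF graded_moduleD(1)[OF L] LS LA insert.prems(6)])
  then obtain s where s: "\<And>q. Li q = L (s q) q" by metis
  \<comment> \<open>The union \<open>Li\<close> is generated in degrees at most \<open>q1\<close>,
    so an index at which the finitely many chains up to degree \<open>q1\<close> have stabilised
    works in every degree.\<close>
  define i0 where "i0 = Max (s ` {..q1})"
  have stable: "Li q = L i q" if "i \<ge> i0" for i q
  proof (induction q)
    case 0
    have "s 0 \<le> i0" unfolding i0_def by (intro Max_ge) auto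
    then show ?case using s[of 0] Lmono[of "s 0" i 0] that unfolding Li_def by fastforce
  next
    case (Suc q)
    show ?case
    proof (cases "Suc q \<le> q1")
      case True
      then have "s (Suc q) \<le> i0" unfolding i0_def by (intro Max_ge) auto
      then show ?thesis
        using s[of "Suc q"] Lmono[of "s (Suc q)" i "Suc q"] that unfolding Li_def by fastforce
    next
      case False
      then have "Li (Suc q) \<subseteq> Y \<odot> L i q + B' (Suc q)" using q1[of q] Suc by simp
      also have "\<dots> \<subseteq> L i (Suc q)"
        using L B'L by (intro plus_subset span_times_subset) (auto intro: graded_moduleD)
      finally show ?thesis unfolding Li_def by blast
    qed
  qed
  \<comment> \<open>In the descent below, \<open>m = q - i\<close> has to reach the generation bound
    \<open>Q i\<close> whenever \<open>i \<le> i0\<close>, and the exponent has to pass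
    \<open>i0\<close> before the degree drops to 0; this \<open>q0\<close> guarantees both.\<close>
  define q0 where "q0 = Max (Q ` {..i0}) + i0 + 1"
  have "P (Suc q) \<subseteq> insert v Y \<odot> P q + B (Suc q)" if q: "q \<ge> q0" for q
  proof
    fix x assume x: "x \<in> P (Suc q)"
    let ?G = "insert v Y \<odot> P q + B (Suc q)"
    have G: "fsubspace ?G" by (intro fsubspace_plus graded_moduleD(1)[OF B]) simp
    have GP: "?G \<subseteq> P (Suc q)"
      by (intro plus_subset span_times_subset graded_moduleD[OF P] BP)
    have G1: "insert v Y \<odot> P q \<subseteq> ?G" by (intro plus_superset1 graded_moduleD(1)[OF B])
    have G2: "B (Suc q) \<subseteq> ?G" by (intro plus_superset2) simp
    have vP: "v * z \<in> ?G" if "z \<in> P q" for z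
      using that G1 span_timesI[of v "insert v Y" z "P q"] by blast
    have YP: "Y \<odot> P q \<subseteq> ?G"
      using G1 span_times_mono[of Y "insert v Y" "P q" "P q"] by blast
    have vB: "v ^ i * b \<in> ?G" if "b \<in> B m" "m + i = Suc q" for i m b
      using graded_module_power[OF B, of v b m i] that G2 by auto
    \<comment> \<open>For \<open>i > i0\<close> the chain is already constant from i - 1 on, so
      modulo \<open>B'\<close> one power of \<open>v\<close> can be saved.\<close>
    have big: "\<exists>y0 b. v ^ (i - 1) * y0 \<in> P (m + i - 1) \<and> b \<in> B' m \<and> y = y0 + b"
      if "y \<in> C i m" "i > i0" for i m y
    proof -
      have "C i m \<subseteq> L i m" unfolding L_def by (intro plus_superset1 graded_moduleD(1)[OF B'])
      then have "y \<in> L i m" using that by blast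
      also have "L i m = L (i - 1) m" using stable[of i m] stable[of "i - 1" m] that by simp
      finally obtain y0 b where "y0 \<in> C (i - 1) m" "b \<in> B' m" "y = y0 + b"
        unfolding L_def by (auto elim: set_plus_elim)
      then show ?thesis using that by (auto simp: C_def)
    qed
    \<comment> \<open>Descent: modulo \<open>?G\<close>, the element \<open>x\<close> is a multiple
      of v^i with a cofactor of degree Suc q - i. Raising \<open>i\<close> to Suc q brings the
      cofactor down to degree 0.\<close>
    have "\<exists>y\<in>C i (Suc q - i). x - v ^ i * y \<in> ?G" if "i \<le> Suc q" for i
      using that
    proof (induction i)
      case 0
      have "x - v ^ 0 * x \<in> ?G"
        unfolding power_0 mult_1_left diff_self by (rule fscale.subspace_0[OF G])
      moreover have "x \<in> C 0 (Suc q - 0)" using x PA by (auto simp: C_def)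
      ultimately show ?case by blast
    next
      case (Suc i)
      from Suc.IH[OF Suc_leD[OF Suc.prems]]
      obtain y where y: "y \<in> C i (Suc q - i)" "x - v ^ i * y \<in> ?G" by blast
      define m where "m = q - i"
      have m: "Suc q - i = Suc m" "m + i = q" "Suc q - Suc i = m" using Suc.prems by (auto simp: m_def)
      note y = y[unfolded m(1)]
      \<comment> \<open>Split off from \<open>y\<close> a part that v^i carries into
        \<open>?G\<close>: for \<open>i \<le> i0\<close> because \<open>L i\<close> is generated
        over \<open>Y\<close> from degree \<open>m\<close>, otherwise because one factor
        \<open>v\<close> of v^i is left over. The remainder lies in \<open>B'\<close>, that is in v
        A + B, and supplies the next power of \<open>v\<close>.\<close>
      have "\<exists>c b. v ^ i * c \<in> ?G \<and> b \<in> B' (Suc m) \<and> y = c + b"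
      proof (cases "i \<le> i0")
        case True
        then have "Q i \<le> Max (Q ` {..i0})" by (intro Max_ge) auto
        with q m(2) True have "Q i \<le> m" unfolding q0_def by linarith
        let ?Z = "Y \<odot> C i m + B' (Suc m)"
        have Z: "fsubspace ?Z" by (intro fsubspace_plus graded_moduleD(1)[OF B']) simp
        have "u * z \<in> ?Z" if u: "u \<in> Y" and z: "z \<in> L i m" for u z
        proof -
          obtain c b where cb: "c \<in> C i m" "b \<in> B' m" "z = c + b"
            using z unfolding L_def by (rule set_plus_elim)
          show ?thesis
            unfolding cb(3) distrib_left
            by (intro set_plus_intro span_timesI graded_moduleD(2)[OF B'] u cb)
        qed
        then have "Y \<odot> L i m \<subseteq> ?Z" by (intro span_times_subset Z)
        then have "Y \<odot> L i m + B' (Suc m) \<subseteq> ?Z"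
          by (intro plus_subset Z plus_superset2) simp_all
        moreover have "C i (Suc m) \<subseteq> L i (Suc m)"
          unfolding L_def by (intro plus_superset1 graded_moduleD(1)[OF B'])
        ultimately have "y \<in> ?Z" using Q[OF \<open>Q i \<le> m\<close>] y(1) by blast
        then obtain c b where cb: "c \<in> Y \<odot> C i m" "b \<in> B' (Suc m)" "y = c + b"
          by (rule set_plus_elim)
        have "v ^ i * z \<in> P q" if "z \<in> C i m" for z
          using that m(2) unfolding C_def by simp
        then have "v ^ i * c \<in> Y \<odot> P q" using cb(1) by (rule mult_span_times)
        then show ?thesis using cb YP by blast
      next
        case False
        then have "i > i0" by simp
        obtain y0 b where *: "v ^ (i - 1) * y0 \<in> P (Suc m + i - 1)" "b \<in> B' (Suc m)" "y = y0 + b"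
          using big[OF y(1) \<open>i > i0\<close>] by blast
        have "Suc m + i - 1 = q" using m by simp
        with *(1) have "v * (v ^ (i - 1) * y0) \<in> ?G" by (intro vP) simp
        moreover have "v ^ i = v * v ^ (i - 1)"
          using \<open>i > i0\<close> by (cases i) simp_all
        ultimately have "v ^ i * y0 \<in> ?G" by (simp only: mult.assoc)
        with * show ?thesis by blast
      qed
      then obtain c b where cb: "v ^ i * c \<in> ?G" "b \<in> B' (Suc m)" "y = c + b" by blast
      from cb(2) obtain a b' where ab: "a \<in> A m" "b' \<in> B (Suc m)" "b = v * a + b'"
        unfolding B'_def adjoin_def nat.case by (elim set_plus_elim imageE) blast
      have 1: "v ^ i * b' \<in> ?G" using vB[OF ab(2)] m(2) by simp
      have "v ^ i * y - v ^ Suc i * a = v ^ i * c + v ^ i * b'"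
        by (simp add: cb(3) ab(3) algebra_simps)
      then have 2: "v ^ i * y - v ^ Suc i * a \<in> ?G"
        using fscale.subspace_add[OF G cb(1) 1] by (simp only:)
      have "v ^ i * y \<in> P (Suc q)" using y(1) m(2) unfolding C_def by simp
      from fscale.subspace_diff[OF graded_moduleD(1)[OF P] this subsetD[OF GP 2]]
      have "v ^ Suc i * a \<in> P (Suc q)" by (simp only: diff_diff_eq2 add_diff_cancel_left')
      then have "a \<in> C (Suc i) m" using ab m(2) unfolding C_def by simp
      moreover have "x - v ^ Suc i * a \<in> ?G"
        using fscale.subspace_add[OF G y(2) 2] by (simp only: diff_add_cancel add_diff_eq)
      ultimately show ?case unfolding m(3) by blast
    qed
    from this[of "Suc q"] obtain y where y: "y \<in> C (Suc q) 0" "x - v ^ Suc q * y \<in> ?G"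
      unfolding diff_self_eq_0 by blast
    have "Suc q > i0" using q by (simp add: q0_def)
    \<comment> \<open>In degree 0 the module \<open>B'\<close> is just \<open>B\<close>, so the
      remainder is absorbed by \<open>?G\<close> and the descent ends.\<close>
    from big[OF y(1) this] obtain y0 b where *: "v ^ q * y0 \<in> P q" "b \<in> B' 0" "y = y0 + b"
      unfolding add_0 diff_Suc_1 by blast
    have "v ^ Suc q * y0 \<in> ?G" using vP[OF *(1)] by (simp only: power_Suc mult.assoc)
    moreover have "v ^ Suc q * b \<in> ?G" using vB[of b 0 "Suc q"] *(2)
      unfolding B'_def adjoin_def by simp
    ultimately have "v ^ Suc q * y \<in> ?G"
      unfolding *(3) distrib_left by (rule fscale.subspace_add[OF G])
    from fscale.subspace_add[OF G y(2) this] show "x \<in> ?G" by (simp only: diff_add_cancel)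
  qed
  then show ?case by blast
qed

section \<open>A homogeneous Nullstellensatz\<close>

lemma power_fun_apply [simp]: "(f ^ n) x = (f x :: 'a::monoid_mult) ^ n"
  by (induction n) simp_all

lemma sum_fun_apply: "(\<Sum>i\<in>I. f i) x = (\<Sum>i\<in>I. f i x :: 'a::comm_monoid_add)"
  by (induction I rule: infinite_finite_induct) simp_all

lemma fspan_insert_fspan: "fspan (insert a (fspan S)) = fspan (insert a S)"
proof
  show "fspan (insert a (fspan S)) \<subseteq> fspan (insert a S)"
    using fscale.span_mono[of S "insert a S"]
    by (intro fscale.span_minimal) (auto intro: fscale.span_base)
  show "fspan (insert a S) \<subseteq> fspan (insert a (fspan S))"
    using fscale.span_superset[of S] by (intro fscale.span_mono) blast
qed

lemma eventually_constant_if_nonincreasing: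
  fixes r :: "nat \<Rightarrow> nat"
  assumes "eventually (\<lambda>q. r (Suc q) \<le> r q) sequentially"
  shows "eventually (\<lambda>q. r (Suc q) = r q) sequentially"
proof -
  obtain q0 where q0: "\<And>q. q \<ge> q0 \<Longrightarrow> r (Suc q) \<le> r q"
    using assms by (auto simp: eventually_sequentially)
  obtain m where m: "m \<ge> q0" "\<And>q. q \<ge> q0 \<Longrightarrow> r m \<le> r q"
    using ex_has_least_nat[of "\<lambda>q. q \<ge> q0" q0 r] by blast
  have le: "r q \<le> r m" if "q \<ge> m" for q
    using that
  proof (induction rule: dec_induct)
    case (step n)
    then show ?case using q0[of n] m(1) by linarith
  qed simp
  have eq: "r q = r m" if "q \<ge> m" for q
    using le[OF that] m(2)[OF order_trans[OF m(1) that]] by (rule antisym)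
  show ?thesis
    unfolding eventually_sequentially
  proof (intro exI allI impI)
    fix q assume "m \<le> q"
    then show "r (Suc q) = r q" using eq[of q] eq[OF le_SucI[of m q]] by simp
  qed
qed

lemma span_Un_image_lessThan:
  assumes "fsubspace B" "x \<in> fspan (B \<union> y ` {..<n::nat})"
  shows "\<exists>c. x - (\<Sum>i<n. fscale (c i) (y i)) \<in> B"
  using assms(2)
proof (induction n arbitrary: x)
  case 0
  then have "x \<in> B" using fscale.span_eq_iff[THEN iffD2, OF assms(1)] by simp
  then show ?case by simp
next
  case (Suc n)
  then have "x \<in> fspan (insert (y n) (B \<union> y ` {..<n}))" by (simp add: lessThan_Suc)
  then obtain d where "x - fscale d (y n) \<in> fspan (B \<union> y ` {..<n})"
    unfolding fscale.span_breakdown_eq by blast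
  from Suc.IH[OF this] obtain c where c: "x - fscale d (y n) - (\<Sum>i<n. fscale (c i) (y i)) \<in> B" by blast
  have "(\<Sum>i<Suc n. fscale ((c(n := d)) i) (y i)) = (\<Sum>i<n. fscale (c i) (y i)) + fscale d (y n)"
    by (simp add: sum.lessThan_Suc)
  then have "x - (\<Sum>i<Suc n. fscale ((c(n := d)) i) (y i)) \<in> B"
    using c by (simp only: diff_diff_eq add.commute)
  then show ?case by blast
qed

text \<open>Join the vectors to \<open>B\<close> one by one: each one outside the span reached so
  far raises the dimension, which \<open>P\<close> bounds. So some \<open>y m\<close> lies in the
  span of \<open>B\<close> and its predecessors, and it receives the coefficient 1.\<close>

lemma dependent_modulo:
  fixes y :: "nat \<Rightarrow> ('x \<Rightarrow> 'k::field)"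
  assumes "fsubspace B" "fsubspace P" "B \<subseteq> P" "fin_dim P" "\<And>i. i < n \<Longrightarrow> y i \<in> P"
    and "fdim P < fdim B + n"
  shows "\<exists>c. (\<exists>i<n. c i \<noteq> 0) \<and> (\<Sum>i<n. fscale (c i) (y i)) \<in> B"
proof -
  let ?S = "\<lambda>m. B \<union> y ` {..<m}"
  have SP: "?S m \<subseteq> P" if "m \<le> n" for m using assms(3,5) that by auto
  have "\<exists>m<n. y m \<in> fspan (?S m)"
  proof (rule ccontr)
    assume indep: "\<not> ?thesis"
    have "fdim B + m \<le> fdim (?S m)" if "m \<le> n" for m
      using that
    proof (induction m)
      case (Suc m)
      have "y m \<notin> fspan (?S m)" using indep Suc.prems by auto
      moreover have "fin_dim (?S m)" using Suc.prems by (intro fin_dim_mono[OF SP assms(4)]) simp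
      ultimately have "fdim (insert (y m) (?S m)) = Suc (fdim (?S m))" by (intro fdim_insert)
      moreover have "insert (y m) (?S m) = ?S (Suc m)" by (simp add: lessThan_Suc)
      ultimately show ?case using Suc by simp
    qed simp
    then have "fdim B + n \<le> fdim (?S n)" by simp
    also have "\<dots> \<le> fdim P"
      using SP[of n] assms(4) fscale.span_superset[of P] by (intro fdim_mono) auto
    finally show False using assms(6) by simp
  qed
  then obtain m where m: "m < n" "y m \<in> fspan (?S m)" by blast
  from span_Un_image_lessThan[OF assms(1) m(2)] obtain c
    where c: "y m - (\<Sum>i<m. fscale (c i) (y i)) \<in> B" by blast
  let ?c = "\<lambda>i. if i < m then - c i else if i = m then 1 else 0"
  have "(\<Sum>i<n. fscale (?c i) (y i)) = (\<Sum>i<Suc m. fscale (?c i) (y i))"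
    using m(1) by (intro sum.mono_neutral_right) auto
  also have "\<dots> = y m - (\<Sum>i<m. fscale (c i) (y i))" by (simp add: sum_negf)
  finally have "(\<Sum>i<n. fscale (?c i) (y i)) \<in> B" using c by (simp only:)
  moreover have "\<exists>i<n. ?c i \<noteq> 0" using m(1) by (intro exI[of _ m]) simp
  ultimately show ?thesis by (intro exI[of _ ?c] conjI)
qed

text \<open>This is v^d p(w / v) without the division: roots of \<open>p\<close> become linear
  factors w - l v, and if \<open>d\<close> exceeds the degree of \<open>p\<close>, powers of
  \<open>v\<close> split off.\<close>

definition homogenize :: "nat \<Rightarrow> 'k::field poly \<Rightarrow> ('x \<Rightarrow> 'k) \<Rightarrow> ('x \<Rightarrow> 'k) \<Rightarrow> 'x \<Rightarrow> 'k" where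
  "homogenize d p w v = (\<Sum>i\<le>d. fscale (coeff p i) (w ^ i * v ^ (d - i)))"

lemma homogenize_linear_factor:
  assumes "degree p \<le> d"
  shows "homogenize (Suc d) ([:- l, 1:] * p) w v = (w - fscale l v) * homogenize d p w v"
proof
  fix z
  have 1: "(\<Sum>i\<le>Suc d. coeff (pCons 0 p) i * (w z ^ i * v z ^ (Suc d - i)))
      = w z * (\<Sum>i\<le>d. coeff p i * (w z ^ i * v z ^ (d - i)))"
    by (subst sum.atMost_Suc_shift) (simp add: sum_distrib_left ac_simps)
  have "coeff p (Suc d) = 0" using assms by (intro coeff_eq_0) simp
  then have "(\<Sum>i\<le>Suc d. coeff p i * (w z ^ i * v z ^ (Suc d - i)))
      = (\<Sum>i\<le>d. coeff p i * (w z ^ i * v z ^ (Suc d - i)))"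
    by simp
  also have "\<dots> = v z * (\<Sum>i\<le>d. coeff p i * (w z ^ i * v z ^ (d - i)))"
    unfolding sum_distrib_left by (intro sum.cong) (auto simp: Suc_diff_le)
  finally have 2: "(\<Sum>i\<le>Suc d. coeff p i * (w z ^ i * v z ^ (Suc d - i)))
      = v z * (\<Sum>i\<le>d. coeff p i * (w z ^ i * v z ^ (d - i)))" .
  have "[:- l, 1:] * p = pCons 0 p - smult l p" by simp
  then have "homogenize (Suc d) ([:- l, 1:] * p) w v z =
      (\<Sum>i\<le>Suc d. coeff (pCons 0 p) i * (w z ^ i * v z ^ (Suc d - i)))
      - l * (\<Sum>i\<le>Suc d. coeff p i * (w z ^ i * v z ^ (Suc d - i)))"
    unfolding homogenize_def sum_fun_apply fscale_def times_fun_apply power_fun_apply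
    by (simp only: coeff_diff coeff_smult left_diff_distrib sum_subtractf sum_distrib_left mult.assoc)
  also have "\<dots> = (w z - l * v z) * (\<Sum>i\<le>d. coeff p i * (w z ^ i * v z ^ (d - i)))"
    unfolding 1 2 by (simp only: algebra_simps)
  finally show "homogenize (Suc d) ([:- l, 1:] * p) w v z
      = ((w - fscale l v) * homogenize d p w v) z"
    by (simp add: homogenize_def sum_fun_apply fscale_def)
qed

text \<open>Multiplication by \<open>v\<close> is injective on \<open>P / B\<close> in high degrees, so \<open>v\<inverse> w\<close> has
  an eigenvalue there.\<close>

lemma eigenvector_modulo:
  fixes v w :: "'x \<Rightarrow> 'k::alg_closed_field"
  assumes P: "graded_module {v, w} P" and B: "graded_module {v, w} B"
    and inj: "\<And>q x. q \<ge> q0 \<Longrightarrow> x \<in> P q \<Longrightarrow> v * x \<in> B (Suc q) \<Longrightarrow> x \<in> B q"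
    and "p \<noteq> 0" "degree p \<le> d" "q \<ge> q0" "x \<in> P q" "x \<notin> B q" "homogenize d p w v * x \<in> B (q + d)"
  shows "\<exists>l q' y. q' \<ge> q0 \<and> y \<in> P q' \<and> y \<notin> B q' \<and> (w - fscale l v) * y \<in> B (Suc q')"
  using assms(4-)
proof (induction "degree p" arbitrary: p d)
  case 0
  then obtain c where c: "p = [:c:]" "c \<noteq> 0" by (metis degree_eq_zeroE pCons_0_0)
  \<comment> \<open>A constant \<open>p\<close> leaves only a nonzero multiple of v^d x in
    \<open>B\<close>; cancelling \<open>v\<close> repeatedly, which the injectivity above
    \<open>q0\<close> permits, contradicts the choice of \<open>x\<close>.\<close>
  have pw: "x \<in> B q" if "v ^ n * x \<in> B (q + n)" for n
    using that
  proof (induction n)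
    case (Suc n)
    have n: "v ^ n * x \<in> P (q + n)" by (rule graded_module_power[OF P _ \<open>x \<in> P q\<close>]) simp
    have "v * (v ^ n * x) \<in> B (Suc (q + n))"
      using Suc.prems by (simp only: power_Suc mult.assoc add_Suc_right)
    from inj[OF trans_le_add1[OF \<open>q0 \<le> q\<close>] n this] show ?case by (rule Suc.IH)
  next
    case 0
    then show ?case by simp
  qed
  have "homogenize d p w v = fscale c (v ^ d)"
  proof -
    have "homogenize d p w v = (\<Sum>i\<in>{0}. fscale (coeff p i) (w ^ i * v ^ (d - i)))"
      unfolding homogenize_def c by (intro sum.mono_neutral_right) (auto simp: coeff_pCons split: nat.splits)
    then show ?thesis by (simp add: c)
  qed
  then have "fscale c (v ^ d * x) \<in> B (q + d)" using 0 by (simp only: mult_fscale)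
  from fscale.subspace_scale[OF graded_moduleD(1)[OF B] this, of "inverse c"]
  have "v ^ d * x \<in> B (q + d)" using c by (simp add: fscale.scale_scale)
  then show ?case using pw 0 by blast
next
  case (Suc n)
  then obtain l where "poly p l = 0" using alg_closed_imp_poly_has_root[of p] by auto
  then obtain p1 where p1: "p = [:- l, 1:] * p1" by (auto simp: poly_eq_0_iff_dvd elim: dvdE)
  then have "p1 \<noteq> 0" using Suc by auto
  then have deg: "degree p = Suc (degree p1)" unfolding p1 by (subst degree_mult_eq) auto
  obtain d1 where d: "d = Suc d1" "degree p1 \<le> d1"
    using Suc deg by (cases d) auto
  \<comment> \<open>Either \<open>y\<close> lies in \<open>B\<close>, and \<open>p1\<close> is a
    relation of smaller degree for the same \<open>x\<close>, or \<open>y\<close> is the eigenvector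
    for the root \<open>l\<close>.\<close>
  define y where "y = homogenize d1 p1 w v * x"
  have *: "(w - fscale l v) * y \<in> B (Suc (q + d1))"
    using Suc.prems(6) unfolding y_def p1 d(1) homogenize_linear_factor[OF d(2)]
    by (simp only: mult.assoc add_Suc_right)
  have "y \<in> P (q + d1)"
    unfolding y_def homogenize_def sum_distrib_right mult_fscale mult.assoc
  proof (intro fscale.subspace_sum fscale.subspace_scale graded_moduleD(1)[OF P])
    fix i assume "i \<in> {..d1}"
    then have i: "q + (d1 - i) + i = q + d1" by simp
    have "v ^ (d1 - i) * x \<in> P (q + (d1 - i))"
      by (rule graded_module_power[OF P _ Suc.prems(4)]) simp
    from graded_module_power[OF P insertI2[OF insertI1] this]
    have "w ^ i * (v ^ (d1 - i) * x) \<in> P (q + (d1 - i) + i)" .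
    then show "w ^ i * (v ^ (d1 - i) * x) \<in> P (q + d1)" unfolding i .
  qed
  show ?case
  proof (cases "y \<in> B (q + d1)")
    case True
    show ?thesis
      by (rule Suc.hyps(1)[of p1 d1])
         (use Suc.hyps(2) deg \<open>p1 \<noteq> 0\<close> d True Suc.prems in \<open>simp_all add: y_def\<close>)
  next
    case False
    have "q + d1 \<ge> q0" using Suc.prems by simp
    with False * \<open>y \<in> P (q + d1)\<close> show ?thesis by blast
  qed
qed

text \<open>A homogeneous Nullstellensatz: dividing by \<open>u\<close> leaves one variable less, so by induction
  every nonzero \<open>u\<close> acts surjectively, hence bijectively, on \<open>P / B\<close> in high degrees; the pencil
  spanned by two variables contradicts this.\<close>

lemma fibres_vanish:
  fixes X :: "('x \<Rightarrow> 'k::alg_closed_field) set"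
  assumes "finite X" "graded_module X P" "graded_module X B"
    and "\<And>q. B q \<subseteq> P q" "\<And>q. fin_dim (P q)"
    and "\<And>H v. fsubspace H \<Longrightarrow> fspan (insert v H) = fspan X \<Longrightarrow>
      eventually (\<lambda>q. P (Suc q) \<subseteq> H \<odot> P q + B (Suc q)) sequentially"
  shows "eventually (\<lambda>q. P q = B q) sequentially"
  using assms
proof (induction "card X" arbitrary: X B rule: less_induct)
  case less
  note P = less.prems(2) and B = less.prems(3) and BP = less.prems(4) and fd = less.prems(5)
    and hyp = less.prems(6)
  have span: "graded_module (fspan X) P" "graded_module (fspan X) B"
    using P B by (simp_all add: graded_module_span)
  \<comment> \<open>With \<open>{0}\<close> in the place of \<open>H\<close>, the hypothesis says P
    (Suc q) \<subseteq> B (Suc q). This settles the case of at most one variable.\<close>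
  have zero: ?case if "fspan (insert v {0}) = fspan X" for v
  proof -
    have "{0} \<odot> P q \<subseteq> {0}" for q by (intro span_times_subset) auto
    then have "{0} \<odot> P q + B (Suc q) \<subseteq> B (Suc q)" for q
      using set_plus_mono2[of "{0} \<odot> P q" "{0}" "B (Suc q)" "B (Suc q)"] by simp
    with hyp[OF _ that] have "eventually (\<lambda>q. P (Suc q) \<subseteq> B (Suc q)) sequentially"
      by (auto elim!: eventually_mono)
    then have "eventually (\<lambda>q. P (Suc q) = B (Suc q)) sequentially"
      using BP by (auto elim!: eventually_mono)
    then show ?thesis by (simp only: eventually_sequentially_Suc[of "\<lambda>q. P q = B q"])
  qed
  have surj: "eventually (\<lambda>q. P (Suc q) \<subseteq> (*) u ` P q + B (Suc q)) sequentially"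
    if Z: "finite Z" "card Z < card X" "fspan (insert u Z) = fspan X" for u Z
  proof -
    have u: "u \<in> fspan X" "Z \<subseteq> fspan X" using Z(3) fscale.span_superset[of "insert u Z"] by auto
    \<comment> \<open>Induction for P / (B + u P) over the variables \<open>Z\<close>: the condition
      for a subspace \<open>H\<close> there follows from the condition for the span of
      \<open>u\<close> and \<open>H\<close> over \<open>X\<close>.\<close>
    have "eventually (\<lambda>q. P q = adjoin u P B q) sequentially"
    proof (rule less.hyps[OF Z(2,1)])
      show P': "graded_module Z P" using span(1) u(2) by (rule graded_module_mono)
      have "graded_module Z B" using span(2) u(2) by (rule graded_module_mono)
      then show "graded_module Z (adjoin u P B)" by (intro graded_module_adjoin P')
      show "adjoin u P B q \<subseteq> P q" for q by (rule adjoin_subset[OF span(1) u(1) BP])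
      show "fin_dim (P q)" for q by (rule fd)
      fix H v assume H: "fsubspace H" "fspan (insert v H) = fspan Z"
      have "fspan (insert v (fspan (insert u H))) = fspan (insert u (fspan (insert v H)))"
        by (simp only: fspan_insert_fspan insert_commute)
      also have "\<dots> = fspan X" unfolding H(2) fspan_insert_fspan by (rule Z(3))
      finally have "eventually (\<lambda>q. P (Suc q) \<subseteq> fspan (insert u H) \<odot> P q + B (Suc q)) sequentially"
        by (intro hyp) simp_all
      then show "eventually (\<lambda>q. P (Suc q) \<subseteq> H \<odot> P q + adjoin u P B (Suc q)) sequentially"
      proof (rule eventually_mono)
        fix q assume "P (Suc q) \<subseteq> fspan (insert u H) \<odot> P q + B (Suc q)"
        also have "\<dots> \<subseteq> (H \<odot> P q + (*) u ` P q) + B (Suc q)"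
          unfolding span_times_fspan_left
          by (intro set_plus_mono2 insert_span_times_subset graded_moduleD(1)[OF P] order_refl)
        finally show "P (Suc q) \<subseteq> H \<odot> P q + adjoin u P B (Suc q)"
          by (simp add: adjoin_def add.assoc)
      qed
    qed
    then have "eventually (\<lambda>q. P (Suc q) = adjoin u P B (Suc q)) sequentially"
      by (simp only: eventually_sequentially_Suc[of "\<lambda>q. P q = adjoin u P B q"])
    then show ?thesis by (rule eventually_mono) (simp add: adjoin_def)
  qed
  have inj: "eventually (\<lambda>q. \<forall>x\<in>P q. u * x \<in> B (Suc q) \<longrightarrow> x \<in> B q) sequentially"
    if Z: "finite Z" "card Z < card X" "fspan (insert u Z) = fspan X" for u Z
  proof -
    have u: "u \<in> fspan X" using Z(3) fscale.span_superset[of "insert u Z"] by auto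
    \<comment> \<open>The dimension of P / B in degree \<open>q\<close>. As \<open>u\<close> acts
      surjectively it eventually does not increase, so it becomes constant, and a surjection between
      spaces of equal finite dimension is injective.\<close>
    define r where "r q = fdim (P q) - fdim (B q)" for q
    have BPd: "fdim (B q) \<le> fdim (P q)" for q
      using BP[of q] fscale.span_superset[of "P q"] by (intro fdim_mono fd) blast
    have fdB: "fin_dim (B q)" for q using BP fd by (rule fin_dim_mono)
    note dim = graded_moduleD(1)[OF B] graded_moduleD(1)[OF P] BP fd graded_moduleD(1)[OF B] fdB
      graded_moduleD(2)[OF span(2) u]
    have "eventually (\<lambda>q. r (Suc q) \<le> r q) sequentially"
      using surj[OF Z]
    proof (rule eventually_mono)
      fix q assume "P (Suc q) \<subseteq> (*) u ` P q + B (Suc q)"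
      then have "fdim (P (Suc q)) + fdim (B q) \<le> fdim (P q) + fdim (B (Suc q))"
        by (intro relative_fdim_le[OF dim])
      then show "r (Suc q) \<le> r q" using BPd[of q] BPd[of "Suc q"] unfolding r_def by linarith
    qed
    then have "eventually (\<lambda>q. r (Suc q) = r q) sequentially"
      by (rule eventually_constant_if_nonincreasing)
    then show ?thesis using surj[OF Z]
    proof eventually_elim
      case (elim q)
      show ?case
      proof (intro ballI impI, rule ccontr)
        fix x assume "x \<in> P q" "u * x \<in> B (Suc q)" "x \<notin> B q"
        then have "fdim (P (Suc q)) + fdim (B q) < fdim (P q) + fdim (B (Suc q))"
          by (intro relative_fdim_less[OF dim elim(2)])
        then show False using BPd[of q] BPd[of "Suc q"] elim(1) unfolding r_def by linarith
      qed
    qed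
  qed
  consider "X = {}" | v where "X = {v}" | v w Y where "X = insert v (insert w Y)" "v \<noteq> w" "v \<notin> Y" "w \<notin> Y"
  proof (cases "X = {}")
    case False
    then obtain v Y where "X = insert v Y" "v \<notin> Y" by (meson all_not_in_conv mk_disjoint_insert)
    then show thesis using that by (cases "Y = {}") (auto, metis insertCI mk_disjoint_insert all_not_in_conv)
  qed (use that in blast)
  then show ?case
  proof cases
    case 1
    then show ?thesis by (intro zero[of 0]) simp
  next
    case (2 v)
    then show ?thesis by (intro zero[of v]) (simp add: insert_commute)
  next
    case (3 v w Y)
    have Y: "finite Y" using 3 less.prems(1) by simp
    then have card: "finite (insert w Y)" "card (insert w Y) < card X"
      "finite (insert v Y)" "card (insert v Y) < card X" using 3 by auto
    have vw: "graded_module {v, w} P" "graded_module {v, w} B"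
      using 3 by (auto intro: graded_module_mono[OF P] graded_module_mono[OF B])
    have "eventually (\<lambda>q. (\<forall>x\<in>P q. v * x \<in> B (Suc q) \<longrightarrow> x \<in> B q) \<and>
        P (Suc q) \<subseteq> (*) v ` P q + B (Suc q)) sequentially"
      using card 3 by (intro eventually_conj inj[of "insert w Y"] surj[of "insert w Y"]) simp_all
    then obtain q0 where q0: "\<And>q x. q \<ge> q0 \<Longrightarrow> x \<in> P q \<Longrightarrow> v * x \<in> B (Suc q) \<Longrightarrow> x \<in> B q"
      "\<And>q. q \<ge> q0 \<Longrightarrow> P (Suc q) \<subseteq> (*) v ` P q + B (Suc q)"
      unfolding eventually_sequentially by blast
    have "P q \<subseteq> B q" if q: "q \<ge> q0" for q
    proof (rule ccontr)
      assume "\<not> P q \<subseteq> B q"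
      then obtain x where x: "x \<in> P q" "x \<notin> B q" by blast
      \<comment> \<open>Surjectivity of \<open>v\<close> bounds the dimension of P / B in all
        degrees from \<open>q\<close> on by \<open>d\<close>. Therefore the d + 1 products w^i v^(d
        - i) x, all of degree q + d, are dependent modulo \<open>B\<close>, and their relation is a
        binary form in \<open>v\<close> and \<open>w\<close> that annihilates
        \<open>x\<close>.\<close>
      define d where "d = fdim (P q)"
      have BPd: "fdim (B q) \<le> fdim (P q)" for q
        using BP[of q] fscale.span_superset[of "P q"] by (intro fdim_mono fd) blast
      have fdB: "fin_dim (B q)" for q using BP fd by (rule fin_dim_mono)
      have vB: "v * x \<in> B (Suc q)" if "x \<in> B q" for q x
        using graded_moduleD(2)[OF vw(2) _ that] by simp
      note dim = graded_moduleD(1)[OF B] graded_moduleD(1)[OF P] BP fd graded_moduleD(1)[OF B] fdB vB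
      have "fdim (P (q + i)) \<le> d + fdim (B (q + i))" for i
      proof (induction i)
        case 0
        then show ?case by (simp add: d_def)
      next
        case (Suc i)
        have "fdim (P (Suc (q + i))) + fdim (B (q + i)) \<le> fdim (P (q + i)) + fdim (B (Suc (q + i)))"
          using q by (intro relative_fdim_le[OF dim] q0(2)) simp_all
        with Suc show ?case by simp
      qed
      from this[of d] have "fdim (P (q + d)) < fdim (B (q + d)) + Suc d" by simp
      moreover have "w ^ i * (v ^ (d - i) * x) \<in> P (q + d)" if "i < Suc d" for i
      proof -
        have i: "q + (d - i) + i = q + d" using that by simp
        have "v ^ (d - i) * x \<in> P (q + (d - i))"
          by (rule graded_module_power[OF vw(1) _ x(1)]) simp
        from graded_module_power[OF vw(1) insertI2[OF insertI1] this]
        have "w ^ i * (v ^ (d - i) * x) \<in> P (q + (d - i) + i)" .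
        then show ?thesis unfolding i .
      qed
      ultimately have "\<exists>c. (\<exists>i<Suc d. c i \<noteq> 0) \<and>
          (\<Sum>i<Suc d. fscale (c i) (w ^ i * (v ^ (d - i) * x))) \<in> B (q + d)"
        by (intro dependent_modulo[OF graded_moduleD(1)[OF B] graded_moduleD(1)[OF P] BP fd])
      then obtain c where c: "\<exists>i<Suc d. c i \<noteq> 0"
        "(\<Sum>i<Suc d. fscale (c i) (w ^ i * (v ^ (d - i) * x))) \<in> B (q + d)"
        by blast
      define p where "p = Poly (map c [0..<Suc d])"
      have coeff: "coeff p i = (if i < Suc d then c i else 0)" for i
        by (simp add: p_def coeff_Poly_eq nth_default_def del: upt_Suc)
      have "p \<noteq> 0" using c(1) coeff by (metis coeff_0)
      have "degree p \<le> d" by (intro degree_le) (simp add: coeff)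
      have "homogenize d p w v * x = (\<Sum>i<Suc d. fscale (c i) (w ^ i * (v ^ (d - i) * x)))"
        unfolding homogenize_def sum_distrib_right mult_fscale mult.assoc lessThan_Suc_atMost
        by (intro sum.cong) (auto simp: coeff)
      then have "homogenize d p w v * x \<in> B (q + d)" using c(2) by (simp only:)
      from eigenvector_modulo[OF vw q0(1) \<open>p \<noteq> 0\<close> \<open>degree p \<le> d\<close> q x this]
      obtain l q' y where y: "q' \<ge> q0" "y \<in> P q'" "y \<notin> B q'" "(w - fscale l v) * y \<in> B (Suc q')"
        by blast
      \<comment> \<open>\<open>?u\<close>, \<open>v\<close> and \<open>Y\<close> together span the
        same space as \<open>X\<close>, so \<open>?u\<close> too acts injectively in high degrees,
        whereas it kills the class of \<open>y\<close>. Powers of \<open>v\<close> carry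
        \<open>y\<close> into these degrees without making its class zero.\<close>
      let ?u = "w - fscale l v"
      have "fspan (insert ?u (insert v Y)) = fspan X"
      proof -
        have "?u \<in> fspan X" "insert v Y \<subseteq> fspan X" unfolding 3(1)
          by (auto intro!: fscale.span_diff fscale.span_scale intro: fscale.span_base)
        moreover have "?u + fscale l v \<in> fspan (insert ?u (insert v Y))"
          by (intro fscale.span_add fscale.span_scale) (auto intro: fscale.span_base)
        then have "w \<in> fspan (insert ?u (insert v Y))" by (simp only: diff_add_cancel)
        then have "X \<subseteq> fspan (insert ?u (insert v Y))" unfolding 3(1)
          by (auto intro: fscale.span_base)
        ultimately show ?thesis
          by (intro subset_antisym fscale.span_minimal insert_subsetI) auto
      qed
      from inj[OF card(3,4) this] obtain q1
        where q1: "\<And>q x. q \<ge> q1 \<Longrightarrow> x \<in> P q \<Longrightarrow> ?u * x \<in> B (Suc q) \<Longrightarrow> x \<in> B q"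
        unfolding eventually_sequentially by blast
      have "v ^ j * y \<in> P (q' + j) \<and> v ^ j * y \<notin> B (q' + j)" for j
      proof (induction j)
        case 0
        then show ?case using y by simp
      next
        case (Suc j)
        then have "v * (v ^ j * y) \<notin> B (Suc (q' + j))" using q0(1)[of "q' + j" "v ^ j * y"] y(1) trans_le_add1 by blast
        moreover have "v * (v ^ j * y) \<in> P (Suc (q' + j))"
          by (rule graded_moduleD(2)[OF vw(1) insertI1 conjunct1[OF Suc]])
        ultimately show ?case by (simp only: power_Suc mult.assoc add_Suc_right simp_thms)
      qed
      from this[of q1] have "v ^ q1 * y \<in> P (q' + q1)" "v ^ q1 * y \<notin> B (q' + q1)" by simp_all
      moreover have "v ^ q1 * (?u * y) \<in> B (Suc q' + q1)"
        by (rule graded_module_power[OF vw(2) _ y(4)]) simp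
      then have "?u * (v ^ q1 * y) \<in> B (Suc (q' + q1))" by (simp only: mult.left_commute add_Suc)
      ultimately show False using q1[of "q' + q1"] by simp
    qed
    then show ?thesis using BP unfolding eventually_sequentially by blast
  qed
qed

section \<open>Forms that annihilate a module near a point\<close>

primrec forms :: "('x \<Rightarrow> 'k::field) set \<Rightarrow> nat \<Rightarrow> ('x \<Rightarrow> 'k) set" where
  "forms V 0 = fspan {1}"
| "forms V (Suc q) = V \<odot> forms V q"

lemma fsubspace_forms [simp]: "fsubspace (forms V q)"
  by (cases q) simp_all

lemma graded_module_forms: "graded_module V (forms V)"
  unfolding graded_module_def by (auto intro: span_timesI)

lemma forms_mult_graded_module:
  assumes "graded_module V M" "g \<in> forms V j" "x \<in> M q"
  shows "g * x \<in> M (q + j)"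
  using assms(2)
proof (induction j arbitrary: g)
  case 0
  have "f * x \<in> M (q + 0)" if "f \<in> {1}" for f
    using assms(3) that by (simp only: singleton_iff mult_1_left add_0_right)
  then show ?case
    using 0 unfolding forms.simps
    by (rule mult_span_left[OF graded_moduleD(1)[OF assms(1)]])
next
  case (Suc j)
  have "(v * f) * x \<in> M (q + Suc j)" if "v \<in> V" "f \<in> forms V j" for v f
    unfolding mult.assoc add_Suc_right
    by (rule graded_moduleD(2)[OF assms(1) that(1) Suc.IH[OF that(2)]])
  then have "y * x \<in> M (q + Suc j)" if "y \<in> V * forms V j" for y
    using that by (auto simp only: set_times_def)
  then show ?case
    using Suc.prems unfolding forms.simps span_times_def
    by (rule mult_span_left[OF graded_moduleD(1)[OF assms(1)]])
qed

lemma forms_mult: "f \<in> forms V i \<Longrightarrow> g \<in> forms V j \<Longrightarrow> g * f \<in> forms V (i + j)"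
  by (rule forms_mult_graded_module[OF graded_module_forms])

lemma forms_one: "v \<in> V \<Longrightarrow> v \<in> forms V 1"
  using span_timesI[of v V 1 "fspan {1}"] by (simp add: fscale.span_base)

lemma span_times_vanishing:
  assumes "g \<in> N \<odot> C" "\<And>n. n \<in> N \<Longrightarrow> n z = 0"
  shows "g z = (0::'k::field)"
proof -
  have "N \<odot> C \<subseteq> {g. g z = 0}"
    using assms(2) by (intro span_times_subset fscale.subspaceI) (auto simp: fscale_def)
  with assms(1) show ?thesis by blast
qed

text \<open>Nakayama's lemma at the point \<open>z\<close>: the annihilating form \<open>g\<close> is built by adjoining
  the generators one at a time.\<close>

lemma nakayama:
  fixes V :: "('x \<Rightarrow> 'k::field) set"
  assumes "finite Y" "graded_module V B" "v \<in> V" "v z = 1" "N \<subseteq> V" "\<And>n. n \<in> N \<Longrightarrow> n z = 0"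
    and "\<And>c. c \<in> Y \<Longrightarrow> v * c \<in> N \<odot> Y + B 1"
  shows "\<exists>j. \<exists>g\<in>forms V j. g z \<noteq> 0 \<and> (\<forall>c\<in>Y. g * c \<in> B j)"
  using assms
proof (induction Y arbitrary: B rule: finite_induct)
  case empty
  then show ?case by (intro exI[of _ 1] bexI[of _ v] forms_one) auto
next
  case (insert x Y)
  note B = insert.prems(1) and v = insert.prems(2,3) and N = insert.prems(4,5) and hyp = insert.prems(6)
  \<comment> \<open>Divide by the submodule generated by \<open>x\<close>; the relations of the
    other generators persist modulo it, and induction yields a form \<open>g\<close> for
    them.\<close>
  define B' where "B' q = (*) x ` forms V q + B q" for q
  have xf: "fsubspace ((*) x ` forms V q)" for q by (intro fsubspace_times_image) simp
  have "graded_module V (\<lambda>q. (*) x ` forms V q)"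
    unfolding graded_module_def
  proof (intro conjI allI ballI xf)
    fix q u y assume u: "u \<in> V" and "y \<in> (*) x ` forms V q"
    then obtain f where f: "f \<in> forms V q" "y = x * f" by blast
    have "u * y = x * (u * f)" unfolding f(2) by (rule mult.left_commute)
    moreover have "u * f \<in> forms V (Suc q)" by (rule graded_moduleD(2)[OF graded_module_forms u f(1)])
    ultimately show "u * y \<in> (*) x ` forms V (Suc q)" by blast
  qed
  then have B': "graded_module V B'" unfolding B'_def using B by (rule graded_module_plus)
  have "insert x Y \<odot> N \<subseteq> Y \<odot> N + (*) x ` forms V 1" if Nf: "N \<subseteq> forms V 1" for N
  proof (rule span_times_subset)
    show Z: "fsubspace (Y \<odot> N + (*) x ` forms V 1)"
      by (rule fsubspace_plus[OF span_times_subspace xf])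
    fix y n assume y: "y \<in> insert x Y" and n: "n \<in> N"
    show "y * n \<in> Y \<odot> N + (*) x ` forms V 1"
    proof (cases "y = x")
      case True
      then have "y * n \<in> (*) x ` forms V 1" using n Nf by blast
      then show ?thesis by (rule subsetD[OF plus_superset2[OF span_times_subspace]])
    next
      case False
      then have "y * n \<in> Y \<odot> N" using y n by (intro span_timesI) blast+
      then show ?thesis by (rule subsetD[OF plus_superset1[OF xf]])
    qed
  qed
  moreover have Nf: "N \<subseteq> forms V 1" using N(1) forms_one by blast
  ultimately have NY: "N \<odot> insert x Y \<subseteq> N \<odot> Y + (*) x ` forms V 1"
    by (simp only: span_times_def mult.commute[of N])
  have "v * c \<in> N \<odot> Y + B' 1" if "c \<in> Y" for c
  proof -
    have "v * c \<in> N \<odot> insert x Y + B 1" using hyp that by blast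
    also have "\<dots> \<subseteq> (N \<odot> Y + (*) x ` forms V 1) + B 1"
      using NY by (intro set_plus_mono2) auto
    finally show ?thesis unfolding B'_def by (simp only: add.assoc)
  qed
  with B' v N have "\<exists>j. \<exists>g\<in>forms V j. g z \<noteq> 0 \<and> (\<forall>c\<in>Y. g * c \<in> B' j)" by (rule insert.IH)
  then obtain j g where g: "g \<in> forms V j" "g z \<noteq> 0" "\<And>c. c \<in> Y \<Longrightarrow> g * c \<in> B' j" by blast
  have gY: "g * c \<in> (*) x ` forms V j + B j" if "c \<in> insert x Y" for c
  proof (cases "c = x")
    case True
    then have "g * c = x * g" by (simp only: mult.commute)
    then have "g * c \<in> (*) x ` forms V j" using g(1) by blast
    then show ?thesis by (rule subsetD[OF plus_superset1[OF graded_moduleD(1)[OF B]]])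
  next
    case False
    then have "g * c \<in> B' j" using that by (intro g(3)) blast
    then show ?thesis unfolding B'_def .
  qed
  have gN: "g * y \<in> (*) x ` (N \<odot> forms V j) + B (Suc j)" if y: "y \<in> N \<odot> insert x Y + B 1" for y
  proof -
    let ?Z = "(*) x ` (N \<odot> forms V j) + B (Suc j)"
    have Z: "fsubspace ?Z" by (intro fsubspace_plus fsubspace_times_image graded_moduleD(1)[OF B]) simp
    obtain a b where ab: "a \<in> N \<odot> insert x Y" "b \<in> B 1" "y = a + b" using y by (rule set_plus_elim)
    have "g * a \<in> N \<odot> ((*) x ` forms V j + B j)" using gY ab(1) by (rule mult_span_times)
    also have "\<dots> \<subseteq> ?Z"
    proof (rule span_times_subset[OF Z])
      fix n y assume n: "n \<in> N" and "y \<in> (*) x ` forms V j + B j"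
      then obtain f b where f: "f \<in> forms V j" "b \<in> B j" "y = x * f + b"
        by (elim set_plus_elim imageE) blast
      have "n * y = x * (n * f) + n * b" unfolding f(3) by (simp only: distrib_left mult.left_commute)
      moreover have "x * (n * f) \<in> (*) x ` (N \<odot> forms V j)" using n f(1) by (intro imageI span_timesI)
      moreover have "n * b \<in> B (Suc j)" using n N(1) f(2) by (intro graded_moduleD(2)[OF B]) blast+
      ultimately show "n * y \<in> ?Z" by (simp only: set_plus_intro)
    qed
    finally have "g * a \<in> ?Z" .
    moreover have "g * b \<in> B (1 + j)" by (rule forms_mult_graded_module[OF B g(1) ab(2)])
    then have "g * b \<in> ?Z" unfolding plus_1_eq_Suc
      by (rule subsetD[OF plus_superset2[OF fsubspace_times_image[OF span_times_subspace]]])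
    ultimately show ?thesis unfolding ab(3) distrib_left by (rule fscale.subspace_add[OF Z])
  qed
  \<comment> \<open>After multiplication by \<open>g\<close> every generator is a multiple of
    \<open>x\<close> modulo \<open>B\<close>, so the relation for v x involves \<open>x\<close>
    alone.\<close>
  from gN[OF hyp[OF insertI1]] obtain h b
    where h: "h \<in> N \<odot> forms V j" "b \<in> B (Suc j)" "g * (v * x) = x * h + b"
    by (elim set_plus_elim imageE) blast
  \<comment> \<open>Collecting the multiples of \<open>x\<close> gives g' x in \<open>B\<close>. At
    \<open>z\<close> the factor \<open>v\<close> is 1 and \<open>h\<close>, whose terms all contain
    an element of \<open>N\<close>, is 0; so \<open>g'\<close> and \<open>g\<close> have the same
    value there.\<close>
  define g' where "g' = v * g - h"
  have "v * g \<in> forms V (Suc j)" by (rule graded_moduleD(2)[OF graded_module_forms v(1) g(1)])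
  moreover have "h \<in> forms V (Suc j)"
    unfolding forms.simps by (rule subsetD[OF span_times_mono[OF N(1) order_refl] h(1)])
  ultimately have g': "g' \<in> forms V (Suc j)" unfolding g'_def
    by (intro fscale.subspace_diff[OF fsubspace_forms])
  have "h z = 0" using h(1) N(2) by (rule span_times_vanishing)
  then have "g' z \<noteq> 0" using v(2) g(2) by (simp add: g'_def)
  have "g' * x = g * (v * x) - x * h" unfolding g'_def by (simp only: algebra_simps)
  then have g'x: "g' * x \<in> B (Suc j)" using h(2,3) by (simp only: add_diff_cancel_left')
  \<comment> \<open>\<open>g\<close> sends each generator to a multiple of \<open>x\<close> modulo
    \<open>B\<close>, and \<open>g'\<close> annihilates \<open>x\<close>, so the product annihilates
    every generator.\<close>
  have "(g' * g) * c \<in> B (j + Suc j)" if c: "c \<in> insert x Y" for c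
  proof -
    obtain f b where f: "f \<in> forms V j" "b \<in> B j" "g * c = x * f + b"
      using gY[OF c] by (elim set_plus_elim imageE) blast
    have "(g' * g) * c = f * (g' * x) + g' * b"
      unfolding mult.assoc f(3) by (simp only: distrib_left ac_simps)
    moreover have "f * (g' * x) \<in> B (Suc j + j)" by (rule forms_mult_graded_module[OF B f(1) g'x])
    moreover have "g' * b \<in> B (j + Suc j)" by (rule forms_mult_graded_module[OF B g' f(2)])
    ultimately show ?thesis
      using fscale.subspace_add[OF graded_moduleD(1)[OF B]] by (simp only: add.commute[of j])
  qed
  moreover have "g' * g \<in> forms V (j + Suc j)" by (rule forms_mult[OF g(1) g'])
  moreover have "(g' * g) z \<noteq> 0" using \<open>g' z \<noteq> 0\<close> g(2) by simp
  ultimately show ?case by blast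
qed

text \<open>The generating sets of minors are not finite, but they span finite-dimensional spaces; a
  basis chosen inside \<open>Y\<close> satisfies the same relations.\<close>

lemma nakayama_fin_dim:
  fixes V :: "('x \<Rightarrow> 'k::field) set"
  assumes "fin_dim Y" "graded_module V B" "v \<in> V" "v z = 1" "N \<subseteq> V" "\<And>n. n \<in> N \<Longrightarrow> n z = 0"
    and "\<And>c. c \<in> Y \<Longrightarrow> v * c \<in> N \<odot> Y + B 1"
  shows "\<exists>j. \<exists>g\<in>forms V j. g z \<noteq> 0 \<and> (\<forall>c\<in>Y. g * c \<in> B j)"
proof -
  obtain S where S: "finite S" "S \<subseteq> Y" "Y \<subseteq> fspan S"
    using assms(1) by (rule fin_dim_basis)
  have "N \<odot> Y \<subseteq> N \<odot> S"
    using span_times_mono[OF order_refl S(3), of N] by (simp only: span_times_fspan_right)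
  then have "N \<odot> Y + B 1 \<subseteq> N \<odot> S + B 1" by (intro set_plus_mono2 order_refl)
  then have "v * c \<in> N \<odot> S + B 1" if "c \<in> S" for c
    using assms(7)[OF subsetD[OF S(2) that]] by blast
  with S(1) assms(2-6) have "\<exists>j. \<exists>g\<in>forms V j. g z \<noteq> 0 \<and> (\<forall>c\<in>S. g * c \<in> B j)" by (rule nakayama)
  then obtain j g where g: "g \<in> forms V j" "g z \<noteq> 0" "\<And>c. c \<in> S \<Longrightarrow> g * c \<in> B j" by blast
  have "g * c \<in> B j" if "c \<in> Y" for c
    using g(3) subsetD[OF S(3) that] by (rule mult_span_right[OF graded_moduleD(1)[OF assms(2)]])
  with g(1,2) show ?thesis by blast
qed

text \<open>Modulo H P + B a linear form \<open>u\<close> acts as u(z) v, hence a form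
  \<open>f\<close> of degree i acts as f(z) v^i. For the annihilator \<open>g\<close> this makes v^j
  act as zero, while in high degrees everything is a multiple of v^j. The conclusion is the
  condition that \<open>fibres_vanish\<close> asks of a hyperplane of linear forms.\<close>

lemma fibre_zero:
  fixes V :: "('x \<Rightarrow> 'k::field) set"
  assumes P: "graded_module V P" and B: "graded_module V B" and BP: "\<And>q. B q \<subseteq> P q"
    and gen: "\<And>q. q \<ge> q0 \<Longrightarrow> P (Suc q) \<subseteq> V \<odot> P q + B (Suc q)"
    and v: "v \<in> V" "v z = 1" and H: "fsubspace H" "H \<subseteq> V" "\<And>u. u \<in> V \<Longrightarrow> u z = 0 \<Longrightarrow> u \<in> H"
    and V: "fsubspace V"
    and g: "g \<in> forms V j" "g z \<noteq> 0" "\<And>q x. x \<in> P q \<Longrightarrow> g * x \<in> B (q + j)"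
  shows "eventually (\<lambda>q. P (Suc q) \<subseteq> H \<odot> P q + B (Suc q)) sequentially"
proof -
  have dec: "\<exists>h\<in>H. u = fscale (u z) v + h" if "u \<in> V" for u
  proof (intro bexI[of _ "u - fscale (u z) v"] H(3))
    show "u - fscale (u z) v \<in> V" using that v(1)
      by (intro fscale.subspace_diff[OF V] fscale.subspace_scale[OF V])
    show "(u - fscale (u z) v) z = 0" using v(2) by (simp add: fscale_def)
  qed simp
  define T where "T q = (case q of 0 \<Rightarrow> B 0 | Suc p \<Rightarrow> H \<odot> P p + B (Suc p))" for q
  have TS: "T (Suc q) = H \<odot> P q + B (Suc q)" for q by (simp add: T_def)
  have HT: "h * y \<in> T (Suc q)" if "h \<in> H" "y \<in> P q" for h y q
    unfolding TS using span_timesI[OF that] plus_superset1[OF graded_moduleD(1)[OF B]] by blast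
  have BT: "B q \<subseteq> T q" for q
    by (cases q) (simp_all add: T_def plus_superset2)
  have T: "graded_module V T"
    unfolding graded_module_def
  proof (intro conjI allI ballI)
    show "fsubspace (T q)" for q
      by (cases q) (simp_all add: T_def graded_moduleD(1)[OF B] fsubspace_plus)
    fix q u y assume u: "u \<in> V" and y: "y \<in> T q"
    show "u * y \<in> T (Suc q)"
    proof (cases q)
      case 0
      then have "u * y \<in> B (Suc q)" using y by (intro graded_moduleD(2)[OF B u]) (simp add: T_def)
      then show ?thesis using BT by blast
    next
      case (Suc p)
      then obtain a b where ab: "a \<in> H \<odot> P p" "b \<in> B q" "y = a + b"
        using y unfolding Suc TS by (elim set_plus_elim)
      have "u * a \<in> H \<odot> P q"
        unfolding Suc using graded_moduleD(2)[OF P u] ab(1) by (rule mult_span_times)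
      then show ?thesis
        unfolding ab(3) distrib_left TS by (intro set_plus_intro graded_moduleD(2)[OF B u] ab(2))
    qed
  qed
  note Tsub = graded_moduleD(1)[OF T]
  have 1: "P (q + i) \<subseteq> (*) (v ^ i) ` P q + T (q + i)" if q: "q \<ge> q0" for q i
  proof (induction i)
    case 0
    show ?case using plus_superset1[OF Tsub, of "P q" "q + 0"] by simp
  next
    case (Suc i)
    let ?Z = "(*) (v ^ Suc i) ` P q + T (q + Suc i)"
    have Z: "fsubspace ?Z" by (intro fsubspace_plus fsubspace_times_image Tsub graded_moduleD(1)[OF P])
    have TZ: "T (q + Suc i) \<subseteq> ?Z" by (intro plus_superset2 fsubspace_times_image graded_moduleD(1)[OF P])
    have "V \<odot> P (q + i) \<subseteq> ?Z"
    proof (rule span_times_subset[OF Z])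
      fix u y assume u: "u \<in> V" and y: "y \<in> P (q + i)"
      obtain h where h: "h \<in> H" "u = fscale (u z) v + h" using dec[OF u] by blast
      obtain p t where pt: "p \<in> P q" "t \<in> T (q + i)" "y = v ^ i * p + t"
        using subsetD[OF Suc y] by (elim set_plus_elim imageE) blast
      have "v * y = v ^ Suc i * p + v * t" unfolding pt(3) by (simp only: power_Suc distrib_left mult.assoc)
      moreover have "v * t \<in> T (q + Suc i)"
        unfolding add_Suc_right by (rule graded_moduleD(2)[OF T v(1) pt(2)])
      ultimately have "v * y \<in> ?Z" using pt(1) by (simp only: set_plus_intro imageI)
      moreover have "h * y \<in> ?Z" using HT[OF h(1) y] TZ by (auto simp only: add_Suc_right)
      ultimately have "fscale (u z) (v * y) + h * y \<in> ?Z"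
        by (intro fscale.subspace_add[OF Z] fscale.subspace_scale[OF Z])
      also have "fscale (u z) (v * y) + h * y = u * y"
        by (subst h(2)) (simp only: distrib_right mult_fscale)
      finally show "u * y \<in> ?Z" .
    qed
    moreover have "B (q + Suc i) \<subseteq> ?Z" using BT TZ by blast
    ultimately have "V \<odot> P (q + i) + B (q + Suc i) \<subseteq> ?Z" by (rule plus_subset[OF Z])
    with gen[OF trans_le_add1[OF q], of i] show ?case unfolding add_Suc_right by (rule order_trans)
  qed
  have 2: "f * p - fscale (f z) (v ^ i * p) \<in> T (q + i)" if "f \<in> forms V i" "p \<in> P q" for f i p q
    using that(1)
  proof (induction i arbitrary: f)
    case 0
    then obtain c where c: "f = fscale c 1" by (auto simp: fscale.span_singleton)
    have "f * p - fscale (f z) (v ^ 0 * p) = 0" unfolding c by (simp add: fscale_def fun_eq_iff)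
    then show ?case using fscale.subspace_0[OF Tsub] by (simp only:)
  next
    case (Suc i)
    let ?F = "{f. f * p - fscale (f z) (v ^ Suc i * p) \<in> T (q + Suc i)}"
    have F: "fsubspace ?F"
    proof (intro fscale.subspaceI CollectI)
      have "0 * p - fscale (0 z) (v ^ Suc i * p) = 0" by simp
      then show "0 * p - fscale (0 z) (v ^ Suc i * p) \<in> T (q + Suc i)"
        using fscale.subspace_0[OF Tsub] by (simp only:)
      fix f1 f2 assume "f1 \<in> ?F" "f2 \<in> ?F"
      then have "(f1 * p - fscale (f1 z) (v ^ Suc i * p)) + (f2 * p - fscale (f2 z) (v ^ Suc i * p))
          \<in> T (q + Suc i)" by (intro fscale.subspace_add[OF Tsub]) blast+
      also have "(f1 * p - fscale (f1 z) (v ^ Suc i * p)) + (f2 * p - fscale (f2 z) (v ^ Suc i * p))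
          = (f1 + f2) * p - fscale ((f1 + f2) z) (v ^ Suc i * p)"
        by (simp add: fscale_def fun_eq_iff algebra_simps)
      finally show "(f1 + f2) * p - fscale ((f1 + f2) z) (v ^ Suc i * p) \<in> T (q + Suc i)" .
    next
      fix c f1 assume "f1 \<in> ?F"
      then have "fscale c (f1 * p - fscale (f1 z) (v ^ Suc i * p)) \<in> T (q + Suc i)"
        by (intro fscale.subspace_scale[OF Tsub]) blast
      also have "fscale c (f1 * p - fscale (f1 z) (v ^ Suc i * p))
          = fscale c f1 * p - fscale (fscale c f1 z) (v ^ Suc i * p)"
        by (simp add: fscale_def fun_eq_iff algebra_simps)
      finally show "fscale c f1 * p - fscale (fscale c f1 z) (v ^ Suc i * p) \<in> T (q + Suc i)" .
    qed
    have "V \<odot> forms V i \<subseteq> ?F"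
    proof (rule span_times_subset[OF F])
      fix u f1 assume u: "u \<in> V" and f1: "f1 \<in> forms V i"
      obtain h where h: "h \<in> H" "u = fscale (u z) v + h" using dec[OF u] by blast
      have "u * (f1 * p - fscale (f1 z) (v ^ i * p)) \<in> T (Suc (q + i))"
        by (rule graded_moduleD(2)[OF T u Suc.IH[OF f1]])
      moreover have "h * (v ^ i * p) \<in> T (Suc (q + i))"
        by (intro HT h(1) graded_module_power[OF P v(1)] that(2))
      ultimately have "u * (f1 * p - fscale (f1 z) (v ^ i * p)) + fscale (f1 z) (h * (v ^ i * p))
          \<in> T (Suc (q + i))"
        by (intro fscale.subspace_add[OF Tsub] fscale.subspace_scale[OF Tsub])
      also have "u * (f1 * p - fscale (f1 z) (v ^ i * p)) + fscale (f1 z) (h * (v ^ i * p))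
          = (u * f1) * p - fscale ((u * f1) z) (v ^ Suc i * p)"
      proof
        fix y
        have "u y = u z * v y + h y" using fun_cong[OF h(2), of y] by (simp add: fscale_def)
        then show "(u * (f1 * p - fscale (f1 z) (v ^ i * p)) + fscale (f1 z) (h * (v ^ i * p))) y
          = ((u * f1) * p - fscale ((u * f1) z) (v ^ Suc i * p)) y"
          by (simp add: fscale_def algebra_simps)
      qed
      finally show "u * f1 \<in> ?F" by (simp only: add_Suc_right mem_Collect_eq)
    qed
    from subsetD[OF this Suc.prems[unfolded forms.simps]] show ?case by (simp only: mem_Collect_eq)
  qed
  have PT: "P (q + j) \<subseteq> T (q + j)" if q: "q \<ge> q0" for q
  proof
    fix x assume "x \<in> P (q + j)"
    from subsetD[OF 1[OF q] this]
    obtain p t where pt: "p \<in> P q" "t \<in> T (q + j)" "x = v ^ j * p + t"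
      by (elim set_plus_elim imageE) blast
    have "g * p \<in> T (q + j)" using g(3)[OF pt(1)] BT by blast
    from fscale.subspace_diff[OF Tsub this 2[OF g(1) pt(1)]]
    have "fscale (g z) (v ^ j * p) \<in> T (q + j)" by (simp only: diff_diff_eq2 add_diff_cancel_left')
    from fscale.subspace_scale[OF Tsub this, of "inverse (g z)"]
    have "v ^ j * p \<in> T (q + j)" using g(2) by (simp add: fscale.scale_scale)
    then show "x \<in> T (q + j)" unfolding pt(3) by (intro fscale.subspace_add[OF Tsub] pt(2))
  qed
  have "P (Suc q) \<subseteq> T (Suc q)" if "q \<ge> q0 + j" for q
  proof -
    have "Suc q - j + j = Suc q" "q0 \<le> Suc q - j" using that by simp_all
    then show ?thesis using PT[of "Suc q - j"] by (simp only:)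
  qed
  then show ?thesis unfolding TS eventually_sequentially by blast
qed

section \<open>Chinese remainder theorem for graded modules\<close>

text \<open>\<open>N s\<close> annihilates A / M s, and each linear form splits as m + n with
  \<open>m\<close> in \<open>N s\<close> and \<open>n\<close> in \<open>N t\<close>. Multiplication
  by \<open>m\<close> puts the intersection reached so far into \<open>M s\<close> as well, and
  multiplication by \<open>n\<close> leads into \<open>M t\<close>. Each member of \<open>S\<close>
  costs one degree, whence the bound \<open>q \<ge> card S\<close>.\<close>

lemma chinese_remainder:
  assumes A: "graded_module V A" and M: "\<And>t. t \<in> T \<Longrightarrow> graded_module V (M t)"
    and MA: "\<And>t q. t \<in> T \<Longrightarrow> M t q \<subseteq> A q"
    and gen: "\<And>q. A (Suc q) \<subseteq> V \<odot> A q"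
    and N: "\<And>t. t \<in> T \<Longrightarrow> N t \<subseteq> V" "\<And>s t. s \<in> T \<Longrightarrow> t \<in> T \<Longrightarrow> s \<noteq> t \<Longrightarrow> V \<subseteq> N s + N t"
    and NA: "\<And>t n x q. t \<in> T \<Longrightarrow> n \<in> N t \<Longrightarrow> x \<in> A q \<Longrightarrow> n * x \<in> M t (Suc q)"
    and "finite S" "S \<subseteq> T" "t \<in> T" "t \<notin> S" "q \<ge> card S"
  shows "A q \<subseteq> (A q \<inter> (\<Inter>s\<in>S. M s q)) + M t q"
  using assms(8-)
proof (induction S arbitrary: q rule: finite_induct)
  case empty
  have "A q \<subseteq> A q + M t q" using empty by (intro plus_superset1 graded_moduleD(1)[OF M])
  then show ?case by simp
next
  case (insert s S)
  then obtain p where q: "q = Suc p" "card S \<le> p" by (cases q) auto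
  let ?I = "\<lambda>S q. A q \<inter> (\<Inter>s\<in>S. M s q)"
  have I: "fsubspace (?I S q)" if "S \<subseteq> T" for S q
    using that by (intro fscale.subspace_inter fscale.subspace_Int graded_moduleD(1)[OF A]
      graded_moduleD(1)[OF M]) blast
  have s: "s \<in> T" "t \<in> T" "s \<noteq> t" "S \<subseteq> T" "t \<notin> S" using insert.prems by auto
  have Z: "fsubspace (?I (insert s S) q + M t q)"
    using s by (intro fsubspace_plus I graded_moduleD(1)[OF M]) auto
  have MZ: "M t q \<subseteq> ?I (insert s S) q + M t q" using s by (intro plus_superset2 I) auto
  have "V \<odot> A p \<subseteq> ?I (insert s S) q + M t q"
  proof (rule span_times_subset[OF Z])
    fix v x assume "v \<in> V" and x: "x \<in> A p"
    then have "v \<in> N s + N t" using N(2) s by blast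
    then obtain m n where mn: "m \<in> N s" "n \<in> N t" "v = m + n" by (elim set_plus_elim)
    have mV: "m \<in> V" using mn(1) N(1) s by blast
    obtain y z where yz: "y \<in> ?I S p" "z \<in> M t p" "x = y + z"
      using subsetD[OF insert.IH[OF s(4,2,5) q(2)] x] by (rule set_plus_elim)
    have "v * x = m * y + (m * z + n * x)" unfolding mn(3) by (simp add: yz(3) algebra_simps)
    moreover have "m * y \<in> ?I (insert s S) q"
    proof -
      have "m * y \<in> A q" "m * y \<in> M s q"
        unfolding q using yz(1) by (intro graded_moduleD(2)[OF A mV] NA s(1) mn(1); blast)+
      moreover have "m * y \<in> M r q" if "r \<in> S" for r
        unfolding q using yz(1) that s(4) by (intro graded_moduleD(2)[OF M mV]) blast+
      ultimately show ?thesis by blast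
    qed
    moreover have "m * z + n * x \<in> M t q"
      unfolding q by (intro fscale.subspace_add[OF graded_moduleD(1)[OF M]] graded_moduleD(2)[OF M mV]
          yz(2) NA mn(2) x s(2))
    ultimately show "v * x \<in> ?I (insert s S) q + M t q" by (simp only: set_plus_intro)
  qed
  then show ?case using gen[of p] unfolding q by blast
qed

text \<open>By \<open>chinese_remainder\<close>, A is the sum of the intersection formed so far and
  the next \<open>M t\<close>, so their codimensions add up.\<close>

lemma fdim_Int_additive:
  fixes T :: "'t set"
  assumes A: "graded_module V A" and M: "\<And>t. t \<in> T \<Longrightarrow> graded_module V (M t)"
    and MA: "\<And>t q. t \<in> T \<Longrightarrow> M t q \<subseteq> A q" and fd: "\<And>q. fin_dim (A q)"
    and gen: "\<And>q. A (Suc q) \<subseteq> V \<odot> A q"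
    and N: "\<And>t. t \<in> T \<Longrightarrow> N t \<subseteq> V" "\<And>s t. s \<in> T \<Longrightarrow> t \<in> T \<Longrightarrow> s \<noteq> t \<Longrightarrow> V \<subseteq> N s + N t"
    and NA: "\<And>t n x q. t \<in> T \<Longrightarrow> n \<in> N t \<Longrightarrow> x \<in> A q \<Longrightarrow> n * x \<in> M t (Suc q)"
    and "finite S" "S \<subseteq> T" "q \<ge> card S"
  shows "fdim (A q) - fdim (A q \<inter> (\<Inter>s\<in>S. M s q)) = (\<Sum>s\<in>S. fdim (A q) - fdim (M s q))"
  using assms(9-)
proof (induction S rule: finite_induct)
  case (insert t S)
  let ?I = "A q \<inter> (\<Inter>s\<in>S. M s q)"
  have t: "t \<in> T" "S \<subseteq> T" "card S \<le> q" using insert by auto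
  have I: "fsubspace ?I" using t
    by (intro fscale.subspace_inter fscale.subspace_Int graded_moduleD(1)[OF A] graded_moduleD(1)[OF M]) blast
  have "A q \<subseteq> ?I + M t q"
    using A M MA gen N NA insert.hyps(1) t(2,1) insert.hyps(2) t(3) by (rule chinese_remainder)
  moreover have "?I + M t q \<subseteq> A q" using MA t by (intro plus_subset graded_moduleD(1)[OF A]) auto
  ultimately have sum: "?I + M t q = A q" by blast
  have fdI: "fin_dim ?I" "fin_dim (M t q)"
    using fin_dim_mono[OF _ fd[of q]] MA[OF t(1)] by blast+
  have Int: "?I \<inter> M t q = A q \<inter> (\<Inter>s\<in>insert t S. M s q)" by blast
  have "fdim (A q) + fdim (A q \<inter> (\<Inter>s\<in>insert t S. M s q)) = fdim ?I + fdim (M t q)"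
    using fdim_plus_Int[OF I graded_moduleD(1)[OF M[OF t(1)]] fdI] by (simp only: sum Int)
  moreover have "fdim ?I \<le> fdim (A q)" "fdim (M t q) \<le> fdim (A q)"
    using MA[OF t(1)] fscale.span_superset[of "A q"] by (intro fdim_mono fd; blast)+
  moreover have "fdim (A q) - fdim ?I = (\<Sum>s\<in>S. fdim (A q) - fdim (M s q))"
    by (rule insert.IH[OF t(2,3)])
  ultimately show ?case unfolding sum.insert[OF insert.hyps] by linarith
qed simp

section \<open>Modules generated in degree 0\<close>

primrec generated :: "('x \<Rightarrow> 'k::field) set \<Rightarrow> ('x \<Rightarrow> 'k) set \<Rightarrow> nat \<Rightarrow> ('x \<Rightarrow> 'k) set" where
  "generated X Y 0 = fspan Y"
| "generated X Y (Suc q) = X \<odot> generated X Y q"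

lemma graded_module_generated: "graded_module X (generated X Y)"
  unfolding graded_module_def
proof (intro conjI allI ballI)
  show "fsubspace (generated X Y q)" for q by (cases q) simp_all
qed (simp add: span_timesI)

lemmas fsubspace_generated [simp] = graded_moduleD(1)[OF graded_module_generated]

lemma generated_base: "y \<in> Y \<Longrightarrow> y \<in> generated X Y 0"
  by (simp add: fscale.span_base)

lemma generated_minimal:
  assumes "graded_module X M" "Y \<subseteq> M 0"
  shows "generated X Y q \<subseteq> M q"
proof (induction q)
  case 0
  show ?case unfolding generated.simps by (rule fscale.span_minimal[OF assms(2) graded_moduleD(1)[OF assms(1)]])
next
  case (Suc q)
  show ?case unfolding generated.simps
    by (rule span_times_subset[OF graded_moduleD(1)[OF assms(1)] graded_moduleD(2)[OF assms(1)]])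
      (use Suc in auto)
qed

lemma generated_mono: "Y \<subseteq> Y' \<Longrightarrow> generated X Y q \<subseteq> generated X Y' q"
  by (rule generated_minimal[OF graded_module_generated]) (auto intro: fscale.span_base)

lemma generated_subset: "Y \<subseteq> fspan Y' \<Longrightarrow> generated X Y q \<subseteq> generated X Y' q"
  by (rule generated_minimal[OF graded_module_generated]) simp

lemma fin_dim_span_times:
  assumes "fin_dim X" "fin_dim Y"
  shows "fin_dim (X \<odot> Y)"
proof -
  obtain B C where BC: "finite B" "X \<subseteq> fspan B" "finite C" "Y \<subseteq> fspan C"
    using assms unfolding fin_dim_def by blast
  have "X \<odot> Y \<subseteq> fspan B \<odot> fspan C" using BC by (intro span_times_mono)
  also have "\<dots> = fspan (B * C)"
    by (simp only: span_times_fspan_left span_times_fspan_right) (simp only: span_times_def)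
  finally show ?thesis
    using BC unfolding fin_dim_def by (intro exI[of _ "B * C"]) (auto intro: finite_set_times)
qed

lemma fin_dim_generated: "fin_dim X \<Longrightarrow> fin_dim Y \<Longrightarrow> fin_dim (generated X Y q)"
  by (induction q) (auto intro: fin_dim_span fin_dim_span_times)

text \<open>The elements that \<open>g\<close> carries into \<open>B\<close> form a graded module,
  so testing the generators is enough.\<close>

lemma forms_annihilate_generated:
  assumes B: "graded_module X B" and g: "g \<in> forms X j" and "\<And>y. y \<in> Y \<Longrightarrow> g * y \<in> B j"
    and "x \<in> generated X Y q"
  shows "g * x \<in> B (q + j)"
proof -
  let ?M = "\<lambda>q. {x. g * x \<in> B (q + j)}"
  have "graded_module X ?M"
    unfolding graded_module_def
  proof (intro conjI allI ballI)
    show "fsubspace (?M q)" for q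
      by (intro fscale.subspaceI; unfold mem_Collect_eq mult_zero_right distrib_left mult_fscale)
        (rule fscale.subspace_0[OF graded_moduleD(1)[OF B]]
          fscale.subspace_add[OF graded_moduleD(1)[OF B]]
          fscale.subspace_scale[OF graded_moduleD(1)[OF B]]; assumption?)+
    fix q v x assume v: "v \<in> X" and "x \<in> ?M q"
    then have "v * (g * x) \<in> B (Suc (q + j))" by (intro graded_moduleD(2)[OF B v]) blast
    then show "v * x \<in> ?M (Suc q)" by (simp only: mem_Collect_eq mult.left_commute add_Suc)
  qed
  moreover have "Y \<subseteq> ?M 0" unfolding add_0 by (intro subsetI CollectI assms(3))
  ultimately have "generated X Y q \<subseteq> ?M q" by (rule generated_minimal)
  with assms(4) show ?thesis by blast
qed

text \<open>In the applications \<open>f\<close> restricts or pulls back functions of (b, a), and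
  \<open>g\<close> does the same to the multipliers, which depend on \<open>a\<close> only; the two
  differ in where they extend by 0.\<close>

lemma generated_image:
  assumes add: "\<And>x y. f (x + y) = f x + f y" and scale: "\<And>c x. f (fscale c x) = fscale c (f x)"
    and mult: "\<And>x y. x \<in> X \<Longrightarrow> f (x * y) = g x * f y"
  shows "f ` generated X Y q = generated (g ` X) (f ` Y) q"
proof -
  note img = image_fspan[of f, OF add scale]
  show ?thesis
  proof (induction q)
    case 0
    show ?case by (simp add: img)
  next
    case (Suc q)
    have "f ` (X * generated X Y q) = (g ` X) * (f ` generated X Y q)"
    proof
      show "f ` (X * generated X Y q) \<subseteq> (g ` X) * (f ` generated X Y q)"
      proof clarify
        fix z assume "z \<in> X * generated X Y q"
        then obtain x y where xy: "x \<in> X" "y \<in> generated X Y q" "z = x * y" by (elim set_times_elim)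
        show "f z \<in> (g ` X) * (f ` generated X Y q)"
          unfolding xy(3) mult[OF xy(1)] by (intro set_times_intro imageI xy)
      qed
      show "(g ` X) * (f ` generated X Y q) \<subseteq> f ` (X * generated X Y q)"
      proof
        fix y assume "y \<in> (g ` X) * (f ` generated X Y q)"
        then obtain x z where xz: "x \<in> X" "z \<in> generated X Y q" "y = g x * f z"
          by (elim set_times_elim imageE) blast
        then have "y = f (x * z)" by (simp only: mult)
        moreover have "x * z \<in> X * generated X Y q" using xz by (intro set_times_intro)
        ultimately show "y \<in> f ` (X * generated X Y q)" by blast
      qed
    qed
    then show ?case unfolding generated.simps span_times_def by (simp only: img Suc)
  qed
qed

section \<open>Koszul cycles and boundaries as functions\<close>

text \<open>A tensor of \<open>V\<close> with Sym V is a function of (b, a), linear in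
  \<open>b\<close> and polynomial in \<open>a\<close>, in the argument order of
  \<open>delta1\<close> and \<open>delta2\<close>; \<open>coord D v\<close> is the action of
  \<open>v\<close> on the second factor.\<close>

definition coord :: "('v \<Rightarrow> 'k::field) set \<Rightarrow> 'v \<Rightarrow> ('v \<Rightarrow> 'k) \<times> ('v \<Rightarrow> 'k) \<Rightarrow> 'k" where
  "coord D v = (\<lambda>(b, a). eval_at D v a)"

text \<open>For \<omega> supported on the dual this is \<open>delta2\<close> of \<omega> tensored
  with 1. So \<open>minor D u v\<close> is the boundary of the wedge of u and v, a 2 by 2 minor in
  the values of \<open>u\<close> and \<open>v\<close> at \<open>a\<close> and
  \<open>b\<close>.\<close>

definition pairing :: "('d list \<Rightarrow> 'k) \<Rightarrow> 'd \<times> 'd \<Rightarrow> 'k" where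
  "pairing \<omega> = (\<lambda>(b, a). \<omega> [a, b])"

definition minor :: "('v \<Rightarrow> 'k::field) set \<Rightarrow> 'v \<Rightarrow> 'v \<Rightarrow> ('v \<Rightarrow> 'k) \<times> ('v \<Rightarrow> 'k) \<Rightarrow> 'k" where
  "minor D u v = pairing (wedge_list [eval_at D u, eval_at D v])"

definition minors :: "('v \<Rightarrow> 'k::field) set \<Rightarrow> 'v set \<Rightarrow> (('v \<Rightarrow> 'k) \<times> ('v \<Rightarrow> 'k) \<Rightarrow> 'k) set" where
  "minors D V = {minor D u v |u v. u \<in> V \<and> v \<in> V}"

lemma minor_apply: "minor D u v (b, a) = eval_at D u a * eval_at D v b - eval_at D u b * eval_at D v a"
  by (simp add: minor_def pairing_def wedge_list_2)

lemma coord_apply: "coord D v (b, a) = eval_at D v a"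
  by (simp add: coord_def)

lemma pairing_add: "pairing (x + y) = pairing x + pairing y"
  by (simp add: pairing_def fun_eq_iff)

lemma pairing_fscale: "pairing (fscale c x) = fscale c (pairing x)"
  by (simp add: pairing_def fscale_def fun_eq_iff)

lemma dualD:
  assumes "a \<in> dual s V"
  shows "u \<in> V \<Longrightarrow> v \<in> V \<Longrightarrow> a (u + v) = a u + a v" "v \<in> V \<Longrightarrow> a (s c v) = c * a v" "v \<notin> V \<Longrightarrow> a v = 0"
  using assms by (auto simp: dual_def)

lemma fsubspace_dual: "fsubspace (dual s V)"
  unfolding fscale.subspace_def dual_def by (auto simp: fscale_def algebra_simps)

lemma tensor_space_fspan:
  "tensor_space M (fspan G) = fspan {tensor f g |f g. f \<in> M \<and> g \<in> G}" (is "_ = fspan ?T")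
proof
  have add: "tensor f (g + h) = tensor f g + tensor f h" for f :: "'a \<Rightarrow> 'c" and g h :: "'b \<Rightarrow> 'c"
    by (auto simp: tensor_def fun_eq_iff algebra_simps)
  have scale: "tensor f (fscale c g) = fscale c (tensor f g)" for f :: "'a \<Rightarrow> 'c" and g :: "'b \<Rightarrow> 'c" and c
    by (auto simp: tensor_def fscale_def fun_eq_iff algebra_simps)
  have "tensor f g \<in> fspan ?T" if "f \<in> M" "g \<in> fspan G" for f g
    using that(2)
  proof (induction rule: fscale.span_induct_alt)
    case base
    have "tensor f (0 :: 'b \<Rightarrow> 'c) = 0" by (auto simp: tensor_def fun_eq_iff)
    then show ?case using fscale.span_zero by (simp only:)
  next
    case (step c x y)
    then have "tensor f x \<in> fspan ?T" using that(1) by (intro fscale.span_base) blast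
    then show ?case unfolding add scale by (intro fscale.span_add fscale.span_scale step(2))
  qed
  then show "tensor_space M (fspan G) \<subseteq> fspan ?T"
    unfolding tensor_space_def by (intro fscale.span_minimal) auto
  show "fspan ?T \<subseteq> tensor_space M (fspan G)"
    unfolding tensor_space_def by (intro fscale.span_mono) (auto intro: fscale.span_base)
qed

definition sym_monomial :: "('v \<Rightarrow> 'k::field) set \<Rightarrow> 'v list \<Rightarrow> ('v \<Rightarrow> 'k) \<Rightarrow> 'k" where
  "sym_monomial D vs = (\<lambda>a. if a \<in> D then (\<Prod>v\<leftarrow>vs. a v) else 0)"

lemma sym_power_eq:
  "sym_power s V q = fspan {sym_monomial (dual s V) vs |vs. set vs \<subseteq> V \<and> length vs = q}"
  by (simp add: sym_power_def sym_monomial_def)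

lemma sym_monomial_mem: "set vs \<subseteq> V \<Longrightarrow> sym_monomial (dual s V) vs \<in> sym_power s V (length vs)"
  unfolding sym_power_eq by (intro fscale.span_base) blast

definition coord_prod :: "('v \<Rightarrow> 'k::field) set \<Rightarrow> 'v list \<Rightarrow> ('v \<Rightarrow> 'k) \<times> ('v \<Rightarrow> 'k) \<Rightarrow> 'k" where
  "coord_prod D vs = (\<Prod>v\<leftarrow>vs. coord D v)"

lemma coord_prod_apply: "a \<in> D \<Longrightarrow> coord_prod D vs (b, a) = (\<Prod>v\<leftarrow>vs. a v)"
  by (induction vs) (simp_all add: coord_prod_def coord_apply eval_at_def)

lemma coord_prod_generated:
  "set vs \<subseteq> V \<Longrightarrow> y \<in> Y \<Longrightarrow> coord_prod D vs * y \<in> generated (coord D ` V) Y (length vs)"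
proof (induction vs)
  case Nil
  then show ?case unfolding coord_prod_def by (simp add: fscale.span_base)
next
  case (Cons v vs)
  have vs: "v \<in> V" "set vs \<subseteq> V" using Cons.prems(1) by auto
  have "coord D v * (coord_prod D vs * y) \<in> generated (coord D ` V) Y (length (v # vs))"
    unfolding list.size add_0_right add_Suc_right generated.simps
    by (intro span_timesI imageI vs(1) Cons.IH[OF vs(2) Cons.prems(2)])
  then show ?case by (simp only: coord_prod_def list.map prod_list.Cons mult.assoc)
qed

text \<open>Monomials replace the recursion here because \<open>sym_power\<close> is given by a
  spanning set of products.\<close>

lemma generated_coord_eq:
  "generated (coord D ` V) Y q = fspan {coord_prod D vs * y |vs y. set vs \<subseteq> V \<and> length vs = q \<and> y \<in> Y}"
  (is "_ = fspan (?M q)")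
proof
  have "graded_module (coord D ` V) (\<lambda>q. fspan (?M q))"
    unfolding graded_module_def
  proof (intro conjI allI ballI)
    fix q x m assume "x \<in> coord D ` V" and m: "m \<in> fspan (?M q)"
    then obtain v where v: "v \<in> V" "x = coord D v" by blast
    show "x * m \<in> fspan (?M (Suc q))"
    proof (rule mult_span_right[OF _ _ m])
      fix m assume "m \<in> ?M q"
      then obtain vs y where vs: "set vs \<subseteq> V" "length vs = q" "y \<in> Y" "m = coord_prod D vs * y" by blast
      have "x * m = coord_prod D (v # vs) * y"
        unfolding v(2) vs(4) by (simp only: coord_prod_def list.map prod_list.Cons mult.assoc)
      moreover have "set (v # vs) \<subseteq> V" "length (v # vs) = Suc q" using v vs by auto
      ultimately show "x * m \<in> fspan (?M (Suc q))" using vs(3) by (intro fscale.span_base) blast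
    qed simp
  qed simp
  moreover have "Y \<subseteq> fspan (?M 0)"
  proof
    fix y assume "y \<in> Y"
    moreover have "y = coord_prod D [] * y" "set [] \<subseteq> V" "length [] = 0" by (simp_all add: coord_prod_def)
    ultimately have "y \<in> ?M 0" by (intro CollectI exI[of _ "[]"] exI[of _ y] conjI)
    then show "y \<in> fspan (?M 0)" by (rule fscale.span_base)
  qed
  ultimately show "generated (coord D ` V) Y q \<subseteq> fspan (?M q)" by (rule generated_minimal)
  show "fspan (?M q) \<subseteq> generated (coord D ` V) Y q"
  proof (intro fscale.span_minimal fsubspace_generated subsetI)
    fix m assume "m \<in> ?M q"
    then obtain vs y where "set vs \<subseteq> V" "q = length vs" "y \<in> Y" "m = coord_prod D vs * y" by blast
    then show "m \<in> generated (coord D ` V) Y q" by (simp only: coord_prod_generated)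
  qed
qed

text \<open>\<open>euler_term D v us\<close> is the image of \<open>v \<otimes> us\<close> under the Koszul differential composed with
  the de Rham differential; Euler's formula compares it with a multiple of \<open>v \<otimes> us\<close>.\<close>

primrec euler_term :: "('v \<Rightarrow> 'k::field) set \<Rightarrow> 'v \<Rightarrow> 'v list \<Rightarrow> ('v \<Rightarrow> 'k) \<times> ('v \<Rightarrow> 'k) \<Rightarrow> 'k" where
  "euler_term D v [] = 0"
| "euler_term D v (u # us) = coord_prod D us * minor D u v + coord D u * euler_term D v us"

lemma euler_term_generated:
  assumes "v \<in> V" "set us \<subseteq> V" "us \<noteq> []"
  shows "euler_term D v us \<in> generated (coord D ` V) (minors D V) (length us - 1)"
  using assms(2,3)
proof (induction us)
  case (Cons u us)
  have "minor D u v \<in> minors D V" using Cons assms(1) by (auto simp: minors_def)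
  then have 1: "coord_prod D us * minor D u v \<in> generated (coord D ` V) (minors D V) (length us)"
    using Cons by (intro coord_prod_generated) auto
  show ?case
  proof (cases us)
    case Nil
    with 1 show ?thesis
      by (simp only: euler_term.simps list.size mult_zero_right add_0_right add_0 diff_Suc_1 add_Suc_right)
  next
    case (Cons w ws)
    then have "us \<noteq> []" "set us \<subseteq> V" using Cons.prems by auto
    then have "euler_term D v us \<in> generated (coord D ` V) (minors D V) (length us - 1)"
      by (intro Cons.IH)
    then have "coord D u * euler_term D v us \<in> generated (coord D ` V) (minors D V) (Suc (length us - 1))"
      unfolding generated.simps using Cons.prems by (intro span_timesI) auto
    moreover have "Suc (length us - 1) = length us" using Cons by simp
    ultimately have 2: "coord D u * euler_term D v us \<in> generated (coord D ` V) (minors D V) (length us)"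
      by (simp only:)
    have "length (u # us) - 1 = length us" by simp
    then show ?thesis
      unfolding euler_term.simps using fscale.subspace_add[OF fsubspace_generated 1 2] by (simp only:)
  qed
qed simp

text \<open>The last term is the coefficient of t in the product of \<open>v\<close> and all of
  \<open>us\<close> at the point a + t b, that is, the derivative of the product at \<open>a\<close>
  along \<open>b\<close>; the factor on the left is the degree of the product. In a cycle the
  derivative terms cancel.\<close>

lemma euler_formula:
  assumes "a \<in> D" "b \<in> D"
  shows "of_nat (Suc (length us)) * (b v * (\<Prod>u\<leftarrow>us. a u)) = euler_term D v us (b, a)
    + coeff ([:a v, b v:] * (\<Prod>u\<leftarrow>us. [:a u, b u:])) 1"
proof -
  have 0: "coeff (\<Prod>u\<leftarrow>us. [:a u, b u:]) 0 = (\<Prod>u\<leftarrow>us. a u)" for us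
    by (induction us) (simp_all add: coeff_mult_0)
  have lin: "coeff ([:x, y:] * p) 1 = x * coeff p 1 + y * coeff p 0" for x y :: 'b and p
    by (simp add: coeff_pCons)
  have "euler_term D v us (b, a) + a v * coeff (\<Prod>u\<leftarrow>us. [:a u, b u:]) 1
      = of_nat (length us) * (b v * (\<Prod>u\<leftarrow>us. a u))"
  proof (induction us)
    case (Cons u us)
    have "euler_term D v (u # us) (b, a) + a v * coeff (\<Prod>u\<leftarrow>u # us. [:a u, b u:]) 1
       = a u * (euler_term D v us (b, a) + a v * coeff (\<Prod>u\<leftarrow>us. [:a u, b u:]) 1)
         + (\<Prod>u\<leftarrow>us. a u) * (a u * b v)"
      using assms unfolding list.map prod_list.Cons lin 0
      by (simp add: coord_prod_apply minor_apply coord_apply eval_at_def algebra_simps)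
    also have "\<dots> = of_nat (length (u # us)) * (b v * (\<Prod>u\<leftarrow>u # us. a u))"
      unfolding Cons by (simp add: algebra_simps)
    finally show ?case .
  qed simp
  then show ?thesis unfolding lin 0 by (simp add: algebra_simps)
qed

lemma generated_minors_supported:
  assumes "g \<in> generated X (minors D V) q" "a \<notin> D \<or> b \<notin> D"
  shows "g (b, a) = 0"
proof -
  have "generated X (minors D V) q \<subseteq> {g. g (b, a) = 0}"
    using assms(2)
    by (intro generated_minimal) (auto simp: graded_module_def minors_def minor_apply eval_at_def
        fscale_def intro!: fscale.subspaceI)
  with assms(1) show ?thesis by blast
qed

text \<open>Exactness of the Koszul complex: q + 2 times a cycle equals its combination of Euler
  terms, and q + 2 is invertible in characteristic 0.\<close>

theorem koszul_cycles_eq: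
  fixes s :: "'k::field_char_0 \<Rightarrow> 'v::ab_group_add \<Rightarrow> 'v"
  shows "koszul_cycles s V q = generated (coord (dual s V) ` V) (minors (dual s V) V) q" (is "_ = ?G q")
proof
  let ?D = "dual s V"
  show "?G q \<subseteq> koszul_cycles s V q"
    unfolding generated_coord_eq
  proof (rule fscale.span_minimal)
    have d1: "delta1 (x + y) = delta1 x + delta1 y" "delta1 (fscale c x) = fscale c (delta1 x)"
      for c and x y :: "('v \<Rightarrow> 'k) \<times> ('v \<Rightarrow> 'k) \<Rightarrow> 'k"
      by (simp_all add: delta1_def fscale_def fun_eq_iff)
    show "fsubspace (koszul_cycles s V q)"
      unfolding fscale.subspace_def koszul_cycles_def tensor_space_def
      by (auto simp: d1 intro: fscale.span_zero fscale.span_add fscale.span_scale)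
         (simp add: delta1_def fun_eq_iff)
    show "{coord_prod ?D vs * y |vs y. set vs \<subseteq> V \<and> length vs = q \<and> y \<in> minors ?D V} \<subseteq> koszul_cycles s V q"
    proof clarify
      fix vs y assume vs: "set vs \<subseteq> V" "q = length vs" and "y \<in> minors ?D V"
      then obtain u v where uv: "u \<in> V" "v \<in> V" "y = minor ?D u v" by (auto simp: minors_def)
      have x: "coord_prod ?D vs * y = tensor (eval_at ?D v) (sym_monomial ?D (u # vs))
          - tensor (eval_at ?D u) (sym_monomial ?D (v # vs))"
        unfolding uv(3)
        by (auto simp: minor_apply tensor_def fun_eq_iff sym_monomial_def eval_at_def coord_prod_apply algebra_simps)
      have "sym_monomial ?D (w # vs) \<in> sym_power s V (length vs + 1)" if "w \<in> V" for w
        using sym_monomial_mem[of "w # vs" V s] that vs(1) by simp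
      then have "coord_prod ?D vs * y \<in> tensor_space (fun_copy s V) (sym_power s V (length vs + 1))"
        unfolding x tensor_space_def fun_copy_def using uv
        by (intro fscale.span_diff fscale.span_base) blast+
      moreover have "delta1 (coord_prod ?D vs * y) = 0"
        unfolding uv(3) by (simp add: delta1_def fun_eq_iff minor_apply)
      ultimately show "coord_prod ?D vs * y \<in> koszul_cycles s V (length vs)"
        by (simp only: koszul_cycles_def mem_Collect_eq simp_thms)
    qed
  qed
  show "koszul_cycles s V q \<subseteq> ?G q"
  proof
    fix h assume h: "h \<in> koszul_cycles s V q"
    \<comment> \<open>Single tensors are not cycles, so an induction over the span has to carry the
      derivative term along. The polynomial \<open>p a b\<close> is \<open>delta1 h\<close>
      restricted to the line a + t b, and its linear coefficient is the error in Euler's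
      formula.\<close>
    define Q where "Q h \<longleftrightarrow> (\<forall>a b. a \<notin> ?D \<or> b \<notin> ?D \<longrightarrow> h (b, a) = 0) \<and> (\<exists>g\<in>?G q. \<exists>p. \<forall>a\<in>?D. \<forall>b\<in>?D.
      of_nat (q + 2) * h (b, a) = g (b, a) + coeff (p a b) 1 \<and>
      (\<forall>t. poly (p a b) t = h (a + fscale t b, a + fscale t b)))" for h :: "('v \<Rightarrow> 'k) \<times> ('v \<Rightarrow> 'k) \<Rightarrow> 'k"
    have gen: "Q (tensor (eval_at ?D v) (sym_monomial ?D us))"
      if "v \<in> V" "set us \<subseteq> V" "length us = q + 1" for v us
      unfolding Q_def
    proof (intro conjI bexI exI[of _ "\<lambda>a b. [:a v, b v:] * (\<Prod>u\<leftarrow>us. [:a u, b u:])"] ballI allI impI)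
      show "euler_term ?D v us \<in> ?G q"
        using euler_term_generated[OF that(1,2), of ?D] that(3) by (cases us) auto
      fix a b assume ab: "a \<in> ?D" "b \<in> ?D"
      then show "of_nat (q + 2) * tensor (eval_at ?D v) (sym_monomial ?D us) (b, a)
        = euler_term ?D v us (b, a) + coeff ([:a v, b v:] * (\<Prod>u\<leftarrow>us. [:a u, b u:])) 1"
        using euler_formula[OF ab, of us v] that(3)
        by (simp add: tensor_def eval_at_def sym_monomial_def)
      fix t
      have "a + fscale t b \<in> ?D" using ab
        by (intro fscale.subspace_add[OF fsubspace_dual] fscale.subspace_scale[OF fsubspace_dual])
      moreover have "poly (\<Prod>u\<leftarrow>us. [:a u, b u:]) t = (\<Prod>u\<leftarrow>us. a u + t * b u)"
        by (induction us) (simp_all add: algebra_simps)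
      moreover have m: "map (a + fscale t b) us = map (\<lambda>u. a u + t * b u) us"
        by (simp add: fscale_def)
      ultimately show "poly ([:a v, b v:] * (\<Prod>u\<leftarrow>us. [:a u, b u:])) t
          = tensor (eval_at ?D v) (sym_monomial ?D us) (a + fscale t b, a + fscale t b)"
        by (simp add: tensor_def eval_at_def sym_monomial_def m) (simp add: fscale_def algebra_simps)
    next
      fix a b assume "a \<notin> ?D \<or> b \<notin> ?D"
      then show "tensor (eval_at ?D v) (sym_monomial ?D us) (b, a) = 0"
        by (auto simp: tensor_def eval_at_def sym_monomial_def)
    qed
    have "h \<in> fspan {tensor f g |f g. f \<in> fun_copy s V \<and>
        g \<in> {sym_monomial ?D vs |vs. set vs \<subseteq> V \<and> length vs = q + 1}}"
      using h unfolding koszul_cycles_def sym_power_eq tensor_space_fspan by blast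
    then have "Q h"
    proof (induction rule: fscale.span_induct_alt)
      case base
      show ?case unfolding Q_def
        using fscale.subspace_0[OF fsubspace_generated]
        by (intro conjI allI impI bexI[of _ 0] exI[of _ "\<lambda>_ _. 0"]) simp_all
    next
      case (step c x y)
      then have "Q x" using gen by (auto simp: fun_copy_def)
      then obtain g p where g: "g \<in> ?G q" "\<And>a b. a \<notin> ?D \<or> b \<notin> ?D \<Longrightarrow> x (b, a) = 0"
        "\<And>a b. a \<in> ?D \<Longrightarrow> b \<in> ?D \<Longrightarrow> of_nat (q + 2) * x (b, a) = g (b, a) + coeff (p a b) 1"
        "\<And>a b t. a \<in> ?D \<Longrightarrow> b \<in> ?D \<Longrightarrow> poly (p a b) t = x (a + fscale t b, a + fscale t b)"
        unfolding Q_def by blast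
      from step(2) obtain g' p' where g': "g' \<in> ?G q" "\<And>a b. a \<notin> ?D \<or> b \<notin> ?D \<Longrightarrow> y (b, a) = 0"
        "\<And>a b. a \<in> ?D \<Longrightarrow> b \<in> ?D \<Longrightarrow> of_nat (q + 2) * y (b, a) = g' (b, a) + coeff (p' a b) 1"
        "\<And>a b t. a \<in> ?D \<Longrightarrow> b \<in> ?D \<Longrightarrow> poly (p' a b) t = y (a + fscale t b, a + fscale t b)"
        unfolding Q_def by blast
      show ?case unfolding Q_def
      proof (intro conjI bexI[of _ "fscale c g + g'"] exI[of _ "\<lambda>a b. smult c (p a b) + p' a b"] allI impI ballI)
        show "fscale c g + g' \<in> ?G q" using g(1) g'(1)
          by (intro fscale.subspace_add[OF fsubspace_generated] fscale.subspace_scale[OF fsubspace_generated])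
        fix a b assume ab: "a \<in> ?D" "b \<in> ?D"
        have "of_nat (q + 2) * (fscale c x + y) (b, a) = c * (of_nat (q + 2) * x (b, a)) + of_nat (q + 2) * y (b, a)"
          by (simp add: fscale_def algebra_simps)
        then show "of_nat (q + 2) * (fscale c x + y) (b, a)
          = (fscale c g + g') (b, a) + coeff (smult c (p a b) + p' a b) 1"
          unfolding g(3)[OF ab] g'(3)[OF ab] by (simp add: fscale_def algebra_simps)
        show "poly (smult c (p a b) + p' a b) t = (fscale c x + y) (a + fscale t b, a + fscale t b)" for t
          using g(4)[OF ab] g'(4)[OF ab] by (simp add: fscale_def)
      qed (use g(2) g'(2) in \<open>simp add: fscale_def\<close>)
    qed
    then obtain g p where g: "g \<in> ?G q" "\<And>a b. a \<notin> ?D \<or> b \<notin> ?D \<Longrightarrow> h (b, a) = 0"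
      "\<And>a b. a \<in> ?D \<Longrightarrow> b \<in> ?D \<Longrightarrow> of_nat (q + 2) * h (b, a) = g (b, a) + coeff (p a b) 1"
      "\<And>a b t. a \<in> ?D \<Longrightarrow> b \<in> ?D \<Longrightarrow> poly (p a b) t = h (a + fscale t b, a + fscale t b)"
      unfolding Q_def by blast
    have "delta1 h = 0" using h by (simp add: koszul_cycles_def)
    from fun_cong[OF this] have diag: "h (a, a) = 0" for a by (simp add: delta1_def)
    \<comment> \<open>For a cycle the polynomial vanishes at every t, and the field is
      infinite.\<close>
    have p0: "p a b = 0" if "a \<in> ?D" "b \<in> ?D" for a b
      using g(4)[OF that] diag by (intro poly_all_0_iff_0[THEN iffD1]) simp
    have "h = fscale (inverse (of_nat (q + 2))) g"
    proof
      fix x :: "('v \<Rightarrow> 'k) \<times> ('v \<Rightarrow> 'k)"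
      obtain b a where x: "x = (b, a)" by (cases x)
      have nz: "of_nat (q + 2) \<noteq> (0 :: 'k)" by (simp only: of_nat_eq_0_iff)
      show "h x = fscale (inverse (of_nat (q + 2))) g x"
      proof (cases "a \<in> ?D \<and> b \<in> ?D")
        case True
        then have "of_nat (q + 2) * h (b, a) = g (b, a)" using g(3) p0 by simp
        then show ?thesis using nz unfolding x fscale_def by (metis left_inverse mult.assoc mult_1_left)
      next
        case False
        then show ?thesis using g(2) generated_minors_supported[OF g(1)] unfolding x fscale_def by auto
      qed
    qed
    then show "h \<in> ?G q" using g(1) fscale.subspace_scale[OF fsubspace_generated] by (simp only:)
  qed
qed

lemma ext_power_2_cases:
  assumes "\<omega> \<in> ext_power F 2" "fsubspace S" "\<And>u v. u \<in> F \<Longrightarrow> v \<in> F \<Longrightarrow> wedge_list [u, v] \<in> S"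
  shows "\<omega> \<in> S"
proof -
  have "{wedge_list as | as. set as \<subseteq> F \<and> length as = 2} \<subseteq> S"
    using assms(3) by (auto simp: numeral_2_eq_2 length_Suc_conv)
  then have "ext_power F 2 \<subseteq> S" unfolding ext_power_def using assms(2) by (intro fscale.span_minimal)
  with assms(1) show ?thesis by blast
qed

lemma ext_power_2_supported:
  assumes "\<omega> \<in> ext_power (fun_copy s V) 2" "a \<notin> dual s V \<or> b \<notin> dual s V"
  shows "\<omega> [a, b] = 0"
proof -
  have "\<omega> \<in> {\<omega>. \<omega> [a, b] = 0}"
    using assms(1)
  proof (rule ext_power_2_cases)
    show "fsubspace {\<omega>. \<omega> [a, b] = 0}" by (intro fscale.subspaceI) (auto simp: fscale_def)
  qed (use assms(2) in \<open>auto simp: wedge_list_2 fun_copy_def eval_at_def\<close>)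
  then show ?thesis by blast
qed

theorem koszul_boundaries_eq:
  fixes s :: "'k::field \<Rightarrow> 'v::ab_group_add \<Rightarrow> 'v"
  assumes "K \<subseteq> ext_power (fun_copy s V) 2"
  shows "koszul_boundaries s V K q = generated (coord (dual s V) ` V) (pairing ` K) q"
proof -
  let ?D = "dual s V"
  let ?T = "{tensor \<omega> f |\<omega> f. \<omega> \<in> K \<and> f \<in> {sym_monomial ?D vs |vs. set vs \<subseteq> V \<and> length vs = q}}"
  have lin: "delta2 (x + y) = delta2 x + delta2 y" "delta2 (fscale c x) = fscale c (delta2 x)"
    for c and x y :: "('v \<Rightarrow> 'k) list \<times> ('v \<Rightarrow> 'k) \<Rightarrow> 'k"
    by (simp_all add: delta2_def fscale_def fun_eq_iff)
  \<comment> \<open>In degree 0 the two kinds of monomials differ off the dual, where the empty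
    \<open>coord_prod\<close> is 1 and the empty \<open>sym_monomial\<close> is 0; elements of
    \<open>K\<close> vanish there.\<close>
  have supp: "\<omega> [a, b] = 0" if "\<omega> \<in> K" "a \<notin> ?D" for \<omega> a b
    using ext_power_2_supported[of \<omega> s V a b] assms that by blast
  have mon: "delta2 (tensor \<omega> (sym_monomial ?D vs)) = coord_prod ?D vs * pairing \<omega>" if "\<omega> \<in> K" for \<omega> vs
    using supp[OF that]
    by (auto simp: delta2_def tensor_def pairing_def sym_monomial_def fun_eq_iff coord_prod_apply)
  have "koszul_boundaries s V K q = fspan (delta2 ` ?T)"
    unfolding koszul_boundaries_def sym_power_eq tensor_space_fspan by (rule image_fspan[OF lin])
  also have "delta2 ` ?T = {coord_prod ?D vs * y |vs y. set vs \<subseteq> V \<and> length vs = q \<and> y \<in> pairing ` K}"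
    (is "_ = ?M")
  proof
    show "delta2 ` ?T \<subseteq> ?M" using mon by blast
    show "?M \<subseteq> delta2 ` ?T"
    proof clarify
      fix vs \<omega> assume "set vs \<subseteq> V" "q = length vs" and \<omega>: "\<omega> \<in> K"
      then have "tensor \<omega> (sym_monomial ?D vs) \<in> ?T" by blast
      from imageI[OF this, of delta2] show "coord_prod ?D vs * pairing \<omega> \<in> delta2 `
          {tensor \<omega> f |\<omega> f. \<omega> \<in> K \<and> f \<in> {sym_monomial ?D us |us. set us \<subseteq> V \<and> length us = length vs}}"
        using \<open>q = length vs\<close> unfolding mon[OF \<omega>] by simp
    qed
  qed
  finally show ?thesis unfolding generated_coord_eq .
qed

section \<open>Resonance and separability in terms of minors\<close>

text \<open>Linear on all functions rather than on a carrier as in \<open>dual\<close>, so that it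
  can be composed with any map into functions.\<close>

definition functional :: "(('x \<Rightarrow> 'k::field) \<Rightarrow> 'k) \<Rightarrow> bool" where
  "functional \<phi> \<longleftrightarrow> (\<forall>x y. \<phi> (x + y) = \<phi> x + \<phi> y) \<and> (\<forall>c x. \<phi> (fscale c x) = c * \<phi> x)"

lemma functionalD:
  assumes "functional \<phi>"
  shows "\<phi> (x + y) = \<phi> x + \<phi> y" "\<phi> (fscale c x) = c * \<phi> x"
  using assms by (auto simp: functional_def)

text \<open>Extend a basis of \<open>S\<close> together with \<open>y\<close> to a basis of all
  functions and take the coordinate of \<open>y\<close>.\<close>

lemma separating_functional:
  fixes y :: "'x \<Rightarrow> 'k::field"
  assumes "fsubspace S" "y \<notin> S"
  shows "\<exists>\<phi>. functional \<phi> \<and> (\<forall>x\<in>S. \<phi> x = 0) \<and> \<phi> y = 1"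
proof -
  obtain B where B: "B \<subseteq> S" "fscale.independent B" "S \<subseteq> fspan B"
    using fscale.basis_exists by metis
  have SB: "fspan B = S" using B assms(1) by (simp add: fscale.span_subspace)
  have ind: "fscale.independent (insert y B)"
    using assms(2) SB B(2) by (intro fscale.independent_insertI) auto
  define E where "E = fscale.extend_basis (insert y B)"
  have E: "fscale.independent E" "fspan E = UNIV" "insert y B \<subseteq> E"
    unfolding E_def using ind
    by (rule fscale.independent_extend_basis, rule fscale.span_extend_basis, rule fscale.extend_basis_superset)
  show ?thesis
    unfolding functional_def
  proof (intro exI[of _ "\<lambda>x. fscale.representation E x y"] conjI allI ballI)
    show "fscale.representation E (x + z) y = fscale.representation E x y + fscale.representation E z y" for x z
      using E by (subst fscale.representation_add) auto
    show "fscale.representation E (fscale c x) y = c * fscale.representation E x y" for c x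
      using E by (subst fscale.representation_scale) auto
    show "fscale.representation E y y = 1"
      using E by (subst fscale.representation_basis) auto
    fix x assume "x \<in> S"
    then have "fscale.representation E x = fscale.representation B x"
      using E SB by (intro fscale.representation_extend) auto
    moreover have "y \<notin> B" using SB assms(2) fscale.span_base by blast
    then have "fscale.representation B x y = 0" using fscale.representation_ne_zero by metis
    ultimately show "fscale.representation E x y = 0" by simp
  qed
qed

locale koszul_pair =
  fixes s :: "'k::{alg_closed_field, field_char_0} \<Rightarrow> 'v::ab_group_add \<Rightarrow> 'v"
    and V :: "'v set" and K :: "(('v \<Rightarrow> 'k) list \<Rightarrow> 'k) set"
  assumes vector_space: "vector_space s" and subspace: "module.subspace s V"
    and finitely_spanned: "\<exists>B. finite B \<and> module.span s B = V"
    and K_subspace: "fsubspace K" and K_subset: "K \<subseteq> ext_power (fun_copy s V) 2"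
begin

sublocale vs: vector_space s by (rule vector_space)

abbreviation D where "D \<equiv> dual s V"

definition ann :: "('v \<Rightarrow> 'k) set \<Rightarrow> 'v set" where
  "ann U = {v \<in> V. \<forall>a\<in>U. a v = 0}"

lemma V_closed:
  "0 \<in> V" "u \<in> V \<Longrightarrow> v \<in> V \<Longrightarrow> u + v \<in> V" "u \<in> V \<Longrightarrow> v \<in> V \<Longrightarrow> u - v \<in> V" "v \<in> V \<Longrightarrow> s c v \<in> V"
  using subspace by (auto intro: vs.subspace_0 vs.subspace_add vs.subspace_diff vs.subspace_scale)

lemma eval_at_add: "u \<in> V \<Longrightarrow> v \<in> V \<Longrightarrow> eval_at D (u + v) a = eval_at D u a + eval_at D v a"
  by (simp add: eval_at_def dualD(1))

lemma eval_at_scale: "v \<in> V \<Longrightarrow> eval_at D (s c v) a = c * eval_at D v a"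
  by (simp add: eval_at_def dualD(2))

lemma coord_add: "u \<in> V \<Longrightarrow> v \<in> V \<Longrightarrow> coord D (u + v) = coord D u + coord D v"
  by (auto simp: fun_eq_iff coord_apply eval_at_add)

lemma coord_scale: "v \<in> V \<Longrightarrow> coord D (s c v) = fscale c (coord D v)"
  by (auto simp: fun_eq_iff coord_apply eval_at_scale fscale_def)

lemma minor_swap: "minor D v u = fscale (- 1) (minor D u v)"
  by (auto simp: fun_eq_iff minor_apply fscale_def algebra_simps)

lemma minor_add_left: "u \<in> V \<Longrightarrow> v \<in> V \<Longrightarrow> minor D (u + v) w = minor D u w + minor D v w"
  by (auto simp: fun_eq_iff minor_apply eval_at_add algebra_simps)

lemma minor_scale_left: "v \<in> V \<Longrightarrow> minor D (s c v) w = fscale c (minor D v w)"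
  by (auto simp: fun_eq_iff minor_apply eval_at_scale fscale_def algebra_simps)

lemma minor_add_right: "u \<in> V \<Longrightarrow> v \<in> V \<Longrightarrow> minor D w (u + v) = minor D w u + minor D w v"
  by (auto simp: fun_eq_iff minor_apply eval_at_add algebra_simps)

lemma minor_scale_right: "v \<in> V \<Longrightarrow> minor D w (s c v) = fscale c (minor D w v)"
  by (auto simp: fun_eq_iff minor_apply eval_at_scale fscale_def algebra_simps)

text \<open>The Koszul relation of \<open>n \<and> u \<and> v\<close>.\<close>

lemma coord_mult_minor: "coord D n * minor D u v = coord D u * minor D n v - coord D v * minor D n u"
  by (auto simp: fun_eq_iff minor_apply coord_apply algebra_simps)

lemma linear_image:
  assumes add: "\<And>u v. u \<in> V \<Longrightarrow> v \<in> V \<Longrightarrow> f (u + v) = f u + f v"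
    and scale: "\<And>c v. v \<in> V \<Longrightarrow> f (s c v) = fscale c (f v)"
  shows "fin_dim (f ` V)" "module.subspace s W \<Longrightarrow> W \<subseteq> V \<Longrightarrow> fsubspace (f ` W)"
proof -
  obtain B where B: "finite B" "vs.span B = V" using finitely_spanned by blast
  have BV: "B \<subseteq> V" using B(2) vs.span_superset by blast
  have f0: "f 0 = 0" using add[OF V_closed(1,1)] by simp
  have "v \<in> V \<and> f v \<in> fspan (f ` B)" if "v \<in> vs.span B" for v
    using that
  proof (induction rule: vs.span_induct_alt)
    case base
    show ?case unfolding f0 using V_closed(1) fscale.span_zero by blast
  next
    case (step c x y)
    have x: "x \<in> V" and y: "y \<in> V" using step BV by auto
    have "f (s c x + y) = fscale c (f x) + f y"
      by (simp only: add[OF V_closed(4)[OF x] y] scale[OF x])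
    moreover have "f x \<in> fspan (f ` B)" using step(1) by (intro fscale.span_base imageI)
    ultimately show ?case
      using step(2) V_closed(2)[OF V_closed(4)[OF x] y] by (simp only: fscale.span_add fscale.span_scale simp_thms)
  qed
  then show "fin_dim (f ` V)" unfolding fin_dim_def using B by (intro exI[of _ "f ` B"]) auto
  assume W: "vs.subspace W" "W \<subseteq> V"
  show "fsubspace (f ` W)"
    unfolding fscale.subspace_def
  proof (intro conjI ballI allI)
    show "0 \<in> f ` W" using f0 vs.subspace_0[OF W(1)] by (metis imageI)
    fix x y assume "x \<in> f ` W" "y \<in> f ` W"
    then obtain u v where uv: "u \<in> W" "v \<in> W" "x = f u" "y = f v" by blast
    have "x + y = f (u + v)" unfolding uv using add[OF subsetD[OF W(2) uv(1)] subsetD[OF W(2) uv(2)]] ..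
    moreover have "u + v \<in> W" using uv vs.subspace_add[OF W(1)] by blast
    ultimately show "x + y \<in> f ` W" by blast
  next
    fix c x assume "x \<in> f ` W"
    then obtain u where u: "u \<in> W" "x = f u" by blast
    have "fscale c x = f (s c u)" unfolding u using scale[OF subsetD[OF W(2) u(1)]] ..
    moreover have "s c u \<in> W" using u vs.subspace_scale[OF W(1)] by blast
    ultimately show "fscale c x \<in> f ` W" by blast
  qed
qed

lemma dual_zero: "a \<in> D \<Longrightarrow> a 0 = 0"
  using dualD(2)[of a s V 0 0] V_closed(1) by simp

lemma ann_subspace:
  assumes "U \<subseteq> D"
  shows "vs.subspace (ann U)"
  unfolding vs.subspace_def
proof (intro conjI ballI allI)
  show "0 \<in> ann U" using assms dual_zero V_closed(1) by (auto simp: ann_def)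
  fix u v assume "u \<in> ann U" "v \<in> ann U"
  then have uv: "u \<in> V" "v \<in> V" "\<And>a. a \<in> U \<Longrightarrow> a u = 0" "\<And>a. a \<in> U \<Longrightarrow> a v = 0"
    unfolding ann_def by blast+
  have "a (u + v) = 0" if "a \<in> U" for a
    using dualD(1)[OF subsetD[OF assms that] uv(1,2)] uv(3,4)[OF that] by simp
  then show "u + v \<in> ann U" using V_closed(2)[OF uv(1,2)] unfolding ann_def by blast
next
  fix c u assume "u \<in> ann U"
  then have u: "u \<in> V" "\<And>a. a \<in> U \<Longrightarrow> a u = 0" unfolding ann_def by blast+
  have "a (s c u) = 0" if "a \<in> U" for a
    using dualD(2)[OF subsetD[OF assms that] u(1)] u(2)[OF that] by simp
  then show "s c u \<in> ann U" using V_closed(4)[OF u(1)] unfolding ann_def by blast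
qed

lemma ann_subset: "ann U \<subseteq> V"
  by (auto simp: ann_def)

lemma fin_dim_coord: "fin_dim (coord D ` V)"
  by (rule linear_image(1)[OF coord_add coord_scale])

lemma fsubspace_coord: "vs.subspace W \<Longrightarrow> W \<subseteq> V \<Longrightarrow> fsubspace (coord D ` W)"
  by (rule linear_image(2)[OF coord_add coord_scale])

lemma fin_dim_minors: "fin_dim (minors D V)"
proof -
  define f where "f v = (\<lambda>(b :: 'v \<Rightarrow> 'k, a :: 'v \<Rightarrow> 'k). eval_at D v b)" for v
  have "fin_dim (f ` V)"
    by (rule linear_image(1)) (auto simp: f_def fun_eq_iff eval_at_add eval_at_scale fscale_def)
  then have "fin_dim (coord D ` V \<odot> f ` V)" by (rule fin_dim_span_times[OF fin_dim_coord])
  moreover have "minors D V \<subseteq> coord D ` V \<odot> f ` V"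
  proof
    fix x assume "x \<in> minors D V"
    then obtain u v where uv: "u \<in> V" "v \<in> V" "x = minor D u v" by (auto simp: minors_def)
    have "x = coord D u * f v - coord D v * f u"
      unfolding uv(3) by (auto simp: fun_eq_iff minor_apply coord_apply f_def)
    moreover have "coord D u * f v - coord D v * f u \<in> coord D ` V \<odot> f ` V"
      using uv by (intro fscale.subspace_diff span_times_subspace span_timesI imageI)
    ultimately show "x \<in> coord D ` V \<odot> f ` V" by (simp only:)
  qed
  ultimately show ?thesis by (rule fin_dim_mono[rotated])
qed

lemma pairing_K_subset: "pairing ` K \<subseteq> fspan (minors D V)"
proof clarify
  fix \<omega> assume "\<omega> \<in> K"
  then have "\<omega> \<in> ext_power (fun_copy s V) 2" using K_subset by blast
  then have "\<omega> \<in> {\<omega>. pairing \<omega> \<in> fspan (minors D V)}"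
  proof (rule ext_power_2_cases)
    have p0: "pairing (0 :: ('v \<Rightarrow> 'k) list \<Rightarrow> 'k) = 0" by (auto simp: pairing_def fun_eq_iff)
    show "fsubspace {\<omega>. pairing \<omega> \<in> fspan (minors D V)}"
      by (intro fscale.subspaceI; unfold mem_Collect_eq pairing_add pairing_fscale)
        (simp_all only: p0 fscale.span_zero fscale.span_add fscale.span_scale)
  next
    fix u v assume "u \<in> fun_copy s V" "v \<in> fun_copy s V"
    then obtain u' v' where "u' \<in> V" "v' \<in> V" "u = eval_at D u'" "v = eval_at D v'"
      by (auto simp: fun_copy_def)
    then show "wedge_list [u, v] \<in> {\<omega>. pairing \<omega> \<in> fspan (minors D V)}"
      by (auto simp: minors_def minor_def intro!: fscale.span_base)
  qed
  then show "pairing \<omega> \<in> fspan (minors D V)" by blast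
qed

text \<open>\<open>pairing\<close> carries the exterior square of \<open>V\<close> into the span of
  the minors, so a functional on functions of (b, a) induces one on the exterior square.\<close>

lemma perpI:
  assumes "\<eta> \<in> ext_power D 2" and "functional \<phi>"
    and eta: "\<And>u v. u \<in> V \<Longrightarrow> v \<in> V \<Longrightarrow> \<phi> (minor D u v) = \<eta> [u, v]"
    and K0: "\<And>\<omega>. \<omega> \<in> K \<Longrightarrow> \<phi> (pairing \<omega>) = 0"
  shows "\<eta> \<in> perp s V K"
  unfolding perp_def
proof (intro CollectI conjI bexI ballI)
  let ?E = "ext_power (fun_copy s V) 2"
  let ?\<phi> = "\<lambda>\<omega>. if \<omega> \<in> ?E then \<phi> (pairing \<omega>) else 0"
  have E: "fsubspace ?E" unfolding ext_power_def by simp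
  show "?\<phi> \<in> dual fscale ?E"
    unfolding dual_def
    using fscale.subspace_add[OF E] fscale.subspace_scale[OF E]
    by (simp add: pairing_add pairing_fscale functionalD[OF assms(2)])
  show "?\<phi> \<omega> = 0" if "\<omega> \<in> K" for \<omega> using that K0 by simp
  fix u v assume uv: "u \<in> V" "v \<in> V"
  have "set [eval_at D u, eval_at D v] \<subseteq> fun_copy s V" "length [eval_at D u, eval_at D v] = 2"
    using uv by (auto simp: fun_copy_def)
  then have "wedge_list [eval_at D u, eval_at D v] \<in> ?E"
    unfolding ext_power_def by (intro fscale.span_base) blast
  then show "?\<phi> (wedge_list [eval_at D u, eval_at D v]) = \<eta> [u, v]"
    using eta[OF uv] by (simp add: minor_def)
qed (rule assms(1))

text \<open>The functional that belongs to the wedge of a and b is evaluation at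
  \<open>[a, b]\<close>, since the two agree on decomposable elements.\<close>

lemma perp_wedgeD:
  assumes "wedge_list [a, b] \<in> perp s V K" "a \<in> D" "b \<in> D" "\<omega> \<in> K"
  shows "\<omega> [a, b] = 0"
proof -
  let ?E = "ext_power (fun_copy s V) 2"
  obtain \<phi> where \<phi>: "\<phi> \<in> dual fscale ?E" "\<And>\<omega>. \<omega> \<in> K \<Longrightarrow> \<phi> \<omega> = 0"
    "\<And>u v. u \<in> V \<Longrightarrow> v \<in> V \<Longrightarrow> \<phi> (wedge_list [eval_at D u, eval_at D v]) = wedge_list [a, b] [u, v]"
    using assms(1) unfolding perp_def by blast
  have E: "fsubspace ?E" unfolding ext_power_def by simp
  have "\<omega> \<in> ?E" using assms(4) K_subset by blast
  then have "\<omega> \<in> {\<omega> \<in> ?E. \<phi> \<omega> = \<omega> [a, b]}"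
  proof (rule ext_power_2_cases)
    have "\<phi> 0 = 0" using dualD(2)[OF \<phi>(1) fscale.subspace_0[OF E], of 0] by simp
    then show "fsubspace {\<omega> \<in> ?E. \<phi> \<omega> = \<omega> [a, b]}"
      using E dualD(1,2)[OF \<phi>(1)] unfolding fscale.subspace_def by (auto simp: fscale_def)
  next
    fix u v assume uv: "u \<in> fun_copy s V" "v \<in> fun_copy s V"
    then obtain u' v' where *: "u' \<in> V" "v' \<in> V" "u = eval_at D u'" "v = eval_at D v'"
      by (auto simp: fun_copy_def)
    have "set [u, v] \<subseteq> fun_copy s V" "length [u, v] = 2" using uv by auto
    then have "wedge_list [u, v] \<in> ?E" unfolding ext_power_def by (intro fscale.span_base) blast
    then show "wedge_list [u, v] \<in> {\<omega> \<in> ?E. \<phi> \<omega> = \<omega> [a, b]}"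
      using \<phi>(3)[OF *(1,2)] assms(2,3) unfolding *(3,4)
      by (simp add: wedge_list_2 eval_at_def algebra_simps)
  qed
  then show ?thesis using \<phi>(2)[OF assms(4)] by simp
qed

lemma functional_dual:
  assumes "functional \<phi>"
    and f: "\<And>u v. u \<in> V \<Longrightarrow> v \<in> V \<Longrightarrow> f (u + v) = f u + f v" "\<And>c v. v \<in> V \<Longrightarrow> f (s c v) = fscale c (f v)"
  shows "(\<lambda>u. if u \<in> V then \<phi> (f u) else 0) \<in> D"
  unfolding dual_def by (auto simp: V_closed f functionalD[OF assms(1)])

lemma wedge_list_mem_ext_power: "a \<in> U \<Longrightarrow> b \<in> U \<Longrightarrow> wedge_list [a, b] \<in> ext_power U 2"
proof -
  assume "a \<in> U" "b \<in> U"
  then have "set [a, b] \<subseteq> U" "length [a, b] = 2" by auto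
  then show ?thesis unfolding ext_power_def by (intro fscale.span_base) blast
qed

text \<open>A functional that detects the failure of the inclusion has the form \<open>a \<and> b\<close>.\<close>

lemma minors_off_resonance:
  assumes a: "a \<in> D" "a \<notin> resonance s V K" and v: "v \<in> V" "a v = 1"
  shows "minors D V \<subseteq> fspan (pairing ` K \<union> minors D (ann {a}))" (is "_ \<subseteq> ?S")
proof
  fix z assume "z \<in> minors D V"
  then obtain x y where xy: "x \<in> V" "y \<in> V" "z = minor D x y" by (auto simp: minors_def)
  show "z \<in> ?S"
  proof (rule ccontr)
    assume zS: "z \<notin> ?S"
    obtain \<phi> where \<phi>: "functional \<phi>" and S: "\<And>x. x \<in> ?S \<Longrightarrow> \<phi> x = 0" and z: "\<phi> z = 1"
      using separating_functional[OF fscale.subspace_span zS] by blast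
    define b where "b u = (if u \<in> V then \<phi> (minor D v u) else 0)" for u
    have b: "b \<in> D"
      unfolding b_def by (rule functional_dual[OF \<phi> minor_add_right minor_scale_right])
    have *: "\<phi> (minor D x y) = wedge_list [a, b] [x, y]" if xy: "x \<in> V" "y \<in> V" for x y
    proof -
      \<comment> \<open>Subtracting multiples of \<open>v\<close> moves both arguments into the
        kernel of \<open>a\<close>, whose minors \<open>\<phi>\<close> kills. The remaining terms
        contain \<open>v\<close>; with \<open>b\<close> the contraction of the form with
        \<open>v\<close>, they are the value of the wedge of a and b.\<close>
      let ?x = "x - s (a x) v" and ?y = "y - s (a y) v"
      have xy': "?x \<in> V" "?y \<in> V" using xy v by (auto intro: V_closed)
      have x: "x = ?x + s (a x) v" and y: "y = ?y + s (a y) v" by simp_all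
      have dx: "a (w - s (a w) v) = 0" if "w \<in> V" for w
      proof -
        have "a (w - s (a w) v) + a (s (a w) v) = a (w - s (a w) v + s (a w) v)"
          using dualD(1)[OF a(1), of "w - s (a w) v" "s (a w) v"] that v by (simp add: V_closed)
        then show ?thesis using dualD(2)[OF a(1) v(1), of "a w"] v(2) by simp
      qed
      have "minor D ?x ?y \<in> ?S"
        using xy xy' dx by (intro fscale.span_base UnI2) (auto simp: minors_def ann_def)
      then have "\<phi> (minor D ?x ?y) = 0" by (rule S)
      moreover have "minor D x y = minor D ?x ?y + fscale (a x) (minor D v y) + fscale (- a y) (minor D v x)"
        (is "_ = ?r")
      proof
        fix p :: "('v \<Rightarrow> 'k) \<times> ('v \<Rightarrow> 'k)"
        obtain d e where p: "p = (d, e)" by (cases p)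
        have X: "eval_at D x c = eval_at D ?x c + a x * eval_at D v c" for c
          by (subst x) (simp only: eval_at_add[OF xy'(1) V_closed(4)[OF v(1)]] eval_at_scale[OF v(1)])
        have Y: "eval_at D y c = eval_at D ?y c + a y * eval_at D v c" for c
          by (subst y) (simp only: eval_at_add[OF xy'(2) V_closed(4)[OF v(1)]] eval_at_scale[OF v(1)])
        show "minor D x y p = ?r p"
          unfolding p plus_fun_apply fscale_def minor_apply X Y by (simp add: algebra_simps)
      qed
      ultimately have "\<phi> (minor D x y) = a x * \<phi> (minor D v y) - a y * \<phi> (minor D v x)"
        by (simp only: functionalD[OF \<phi>]) simp
      then show ?thesis using xy by (simp add: wedge_list_2 b_def)
    qed
    have "wedge_list [a, b] \<in> perp s V K"
      using wedge_list_mem_ext_power[OF a(1) b] \<phi> *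
    proof (rule perpI)
      fix \<omega> assume "\<omega> \<in> K"
      then show "\<phi> (pairing \<omega>) = 0" by (intro S fscale.span_base) blast
    qed
    moreover have "wedge_list [a, b] [x, y] \<noteq> 0" using *[OF xy(1,2)] z xy(3) by simp
    then have "wedge_list [a, b] \<noteq> 0" by auto
    ultimately have "a \<in> resonance s V K" unfolding resonance_def using a(1) b by blast
    then show False using a(2) by simp
  qed
qed

text \<open>Elimination over a finite set \<open>B\<close> that separates \<open>U\<close>. The
  induction hypothesis covers the functionals vanishing at \<open>v\<close>; if some functional in
  \<open>U\<close> does not vanish there, it is corrected to be 1 at \<open>v\<close> and 0 at the
  vectors already chosen, and joins them together with \<open>v\<close>.\<close>

lemma dual_basis:
  assumes "fsubspace U" "U \<subseteq> D" "finite B" "B \<subseteq> V" "\<And>a. a \<in> U \<Longrightarrow> \<forall>v\<in>B. a v = 0 \<Longrightarrow> a = 0"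
  shows "\<exists>(m::nat) \<alpha> c. (\<forall>i<m. \<alpha> i \<in> U \<and> c i \<in> V) \<and> (\<forall>i<m. \<forall>j<m. \<alpha> i (c j) = (if i = j then 1 else 0)) \<and>
    (\<forall>a\<in>U. a = (\<Sum>i<m. fscale (a (c i)) (\<alpha> i)))"
  using assms(3,1,2,4,5)
proof (induction B arbitrary: U rule: finite_induct)
  case empty
  then have *: "a = 0" if "a \<in> U" for a using that by blast
  show ?case by (intro exI[of _ "0::nat"]) (auto dest!: * simp: fun_eq_iff sum_fun_apply)
next
  case (insert v B)
  let ?U = "{a \<in> U. a v = 0}"
  have U': "fsubspace ?U" using insert.prems(1) unfolding fscale.subspace_def by (auto simp: fscale_def)
  have ex: "\<exists>(m::nat) \<alpha> c. (\<forall>i<m. \<alpha> i \<in> ?U \<and> c i \<in> V) \<and> (\<forall>i<m. \<forall>j<m. \<alpha> i (c j) = (if i = j then 1 else 0)) \<and>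
    (\<forall>a\<in>?U. a = (\<Sum>i<m. fscale (a (c i)) (\<alpha> i)))"
    using insert.prems by (intro insert.IH[OF U']) auto
  show ?case
  proof (cases "\<exists>a\<in>U. a v \<noteq> 0")
    case False
    then have "?U = U" by blast
    with ex show ?thesis by (simp only:)
  next
    from ex obtain m :: nat and \<alpha> c where *: "\<forall>i<m. \<alpha> i \<in> ?U \<and> c i \<in> V"
      "\<forall>i<m. \<forall>j<m. \<alpha> i (c j) = (if i = j then 1 else 0)"
      "\<forall>a\<in>?U. a = (\<Sum>i<m. fscale (a (c i)) (\<alpha> i))"
      by (elim exE conjE) (rule that)
    have IH: "\<And>i. i < m \<Longrightarrow> \<alpha> i \<in> U" "\<And>i. i < m \<Longrightarrow> \<alpha> i v = 0" "\<And>i. i < m \<Longrightarrow> c i \<in> V"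
      "\<And>i j. i < m \<Longrightarrow> j < m \<Longrightarrow> \<alpha> i (c j) = (if i = j then 1 else 0)"
      "\<And>a. a \<in> U \<Longrightarrow> a v = 0 \<Longrightarrow> a = (\<Sum>i<m. fscale (a (c i)) (\<alpha> i))"
      using * by blast+
    case True
    then obtain a0 where a0: "a0 \<in> U" "a0 v \<noteq> 0" by blast
    define a1 where "a1 = fscale (inverse (a0 v)) a0"
    have a1: "a1 \<in> U" "a1 v = 1"
      unfolding a1_def using a0 by (auto simp: fscale_def intro: fscale.subspace_scale[OF insert.prems(1), unfolded fscale_def])
    define a2 where "a2 = a1 - (\<Sum>i<m. fscale (a1 (c i)) (\<alpha> i))"
    have a2: "a2 \<in> U" unfolding a2_def using a1 IH(1)
      by (intro fscale.subspace_diff[OF insert.prems(1)] fscale.subspace_sum[OF insert.prems(1)]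
          fscale.subspace_scale[OF insert.prems(1)]) auto
    have a2v: "a2 v = 1" unfolding a2_def using a1 IH(2) by (simp add: sum_fun_apply fscale_def)
    have a2c: "a2 (c j) = 0" if "j < m" for j
    proof -
      have "(\<Sum>i<m. a1 (c i) * \<alpha> i (c j)) = (\<Sum>i<m. if i = j then a1 (c i) else 0)"
        using IH(4) that by (intro sum.cong) auto
      also have "\<dots> = a1 (c j)" using that by simp
      finally show ?thesis unfolding a2_def by (simp add: sum_fun_apply fscale_def)
    qed
    have rep: "a = (\<Sum>i<Suc m. fscale (a ((c(m := v)) i)) ((\<alpha>(m := a2)) i))" if a: "a \<in> U" for a
    proof -
      let ?b = "a - fscale (a v) a2"
      have b: "?b \<in> U" "?b v = 0"
        using a a2 a2v
        by (auto intro: fscale.subspace_diff[OF insert.prems(1)] fscale.subspace_scale[OF insert.prems(1)])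
          (simp add: fscale_def)
      have "?b = (\<Sum>i<m. fscale (?b (c i)) (\<alpha> i))" using IH(5)[OF b] .
      also have "\<dots> = (\<Sum>i<m. fscale (a (c i)) (\<alpha> i))"
        using a2c by (intro sum.cong) (simp_all add: fscale_def)
      finally have "a = (\<Sum>i<m. fscale (a (c i)) (\<alpha> i)) + fscale (a v) a2"
        by (simp only: diff_eq_eq)
      then show ?thesis by simp
    qed
    show ?thesis
    proof (intro exI[of _ "Suc m"] exI[of _ "\<alpha>(m := a2)"] exI[of _ "c(m := v)"] conjI allI impI ballI)
      fix i assume "i < Suc m"
      then show "(\<alpha>(m := a2)) i \<in> U" "(c(m := v)) i \<in> V" using IH a2 insert.prems(3) by (auto simp: less_Suc_eq)
      fix j assume "j < Suc m"
      with \<open>i < Suc m\<close> show "(\<alpha>(m := a2)) i ((c(m := v)) j) = (if i = j then 1 else 0)"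
        using IH a2v a2c by (auto simp: less_Suc_eq)
    qed (rule rep)
  qed
qed

end

section \<open>Cycles, boundaries and the submodules attached to subspaces of the dual\<close>

context koszul_pair
begin

definition cycles :: "nat \<Rightarrow> (('v \<Rightarrow> 'k) \<times> ('v \<Rightarrow> 'k) \<Rightarrow> 'k) set" where
  "cycles q = generated (coord D ` V) (minors D V) q"

definition boundaries :: "nat \<Rightarrow> (('v \<Rightarrow> 'k) \<times> ('v \<Rightarrow> 'k) \<Rightarrow> 'k) set" where
  "boundaries q = generated (coord D ` V) (pairing ` K) q"

text \<open>For a component \<open>U\<close> of the resonance variety the quotient of the cycles by \<open>relative U\<close> is
  the Koszul module of the space dual to \<open>U\<close>.\<close>

definition relative :: "('v \<Rightarrow> 'k) set \<Rightarrow> nat \<Rightarrow> (('v \<Rightarrow> 'k) \<times> ('v \<Rightarrow> 'k) \<Rightarrow> 'k) set" where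
  "relative U q = generated (coord D ` V) (pairing ` K \<union> minors D (ann U)) q"

lemma graded_modules:
  "graded_module (coord D ` V) cycles" "graded_module (coord D ` V) boundaries"
  "graded_module (coord D ` V) (relative U)"
proof -
  have "cycles = generated (coord D ` V) (minors D V)"
    "boundaries = generated (coord D ` V) (pairing ` K)"
    "relative U = generated (coord D ` V) (pairing ` K \<union> minors D (ann U))"
    by (rule ext, simp only: cycles_def boundaries_def relative_def)+
  then show "graded_module (coord D ` V) cycles" "graded_module (coord D ` V) boundaries"
    "graded_module (coord D ` V) (relative U)"
    by (simp_all only: graded_module_generated)
qed

lemmas fsubspace_cycles = graded_moduleD(1)[OF graded_modules(1)]
  and fsubspace_boundaries = graded_moduleD(1)[OF graded_modules(2)]
  and fsubspace_relative = graded_moduleD(1)[OF graded_modules(3)]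

lemma koszul_dim_eq: "koszul_dim s V K q = fdim (cycles q) - fdim (boundaries q)"
  unfolding koszul_dim_def koszul_cycles_eq koszul_boundaries_eq[OF K_subset] cycles_def boundaries_def ..

lemma minors_mono: "W \<subseteq> W' \<Longrightarrow> minors D W \<subseteq> minors D W'"
  by (auto simp: minors_def)

lemma boundaries_subset_relative: "boundaries q \<subseteq> relative U q"
  unfolding boundaries_def relative_def by (rule generated_mono) simp

lemma relative_subset_cycles: "relative U q \<subseteq> cycles q"
  unfolding cycles_def relative_def
  using minors_mono[OF ann_subset] pairing_K_subset fscale.span_superset
  by (intro generated_subset) blast

lemma fin_dim_cycles: "fin_dim (cycles q)"
  unfolding cycles_def by (rule fin_dim_generated[OF fin_dim_coord fin_dim_minors])

lemma fin_dim_boundaries: "fin_dim (boundaries q)"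
  using boundaries_subset_relative relative_subset_cycles fin_dim_cycles by (meson fin_dim_mono)

lemma nonzero_dual:
  assumes "a \<in> D" "a \<noteq> 0"
  shows "\<exists>v\<in>V. a v = 1"
proof -
  obtain u where u: "a u \<noteq> 0" using assms(2) by (auto simp: fun_eq_iff)
  then have "u \<in> V" using dualD(3)[OF assms(1)] by blast
  then have "a (s (inverse (a u)) u) = 1" using u dualD(2)[OF assms(1)] by simp
  with \<open>u \<in> V\<close> show ?thesis using V_closed(4) by blast
qed

text \<open>By the Koszul relation, \<open>n\<close> times the minor of u and v is a combination of
  minors with \<open>n\<close> as an argument. Such an \<open>n\<close> therefore acts as zero on
  the quotient of the cycles by \<open>relative U\<close>, as the Chinese remainder argument
  requires.\<close>

lemma coord_mult_cycles:
  assumes n: "n \<in> V" and "\<And>v. v \<in> V \<Longrightarrow> minor D n v \<in> fspan (pairing ` K \<union> minors D (ann U))"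
    and "h \<in> cycles q"
  shows "coord D n * h \<in> relative U (Suc q)"
proof -
  have n1: "coord D n \<in> forms (coord D ` V) 1" using n by (intro forms_one imageI)
  have "coord D n * y \<in> relative U 1" if y: "y \<in> minors D V" for y
  proof -
    obtain u v where uv: "u \<in> V" "v \<in> V" "y = minor D u v" using y by (auto simp: minors_def)
    have 0: "minor D n w \<in> relative U 0" if "w \<in> V" for w
      unfolding relative_def using assms(2)[OF that] by simp
    have "coord D u * minor D n v \<in> relative U (Suc 0)" "coord D v * minor D n u \<in> relative U (Suc 0)"
      by (rule graded_moduleD(2)[OF graded_modules(3) imageI[OF uv(1)] 0[OF uv(2)]],
          rule graded_moduleD(2)[OF graded_modules(3) imageI[OF uv(2)] 0[OF uv(1)]])
    then have "coord D u * minor D n v - coord D v * minor D n u \<in> relative U (Suc 0)"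
      by (intro fscale.subspace_diff[OF fsubspace_relative])
    then show ?thesis unfolding uv(3) coord_mult_minor[of n u v] One_nat_def .
  qed
  from forms_annihilate_generated[OF graded_modules(3) n1 this assms(3)[unfolded cycles_def]]
  show ?thesis by (simp only: add_Suc_right add_0_right One_nat_def)
qed

text \<open>The part of \<open>y\<close> that comes from \<open>K\<close> turns into a boundary of
  degree 1, which the relations in Nakayama's lemma disregard.\<close>

lemma mult_pairing_Un:
  assumes "x \<in> coord D ` V" "\<And>y. y \<in> Y \<Longrightarrow> x * y \<in> M" "fsubspace M" "y \<in> fspan (pairing ` K \<union> Y)"
  shows "x * y \<in> M + boundaries 1"
proof (rule mult_span_right[OF _ _ assms(4)])
  show "fsubspace (M + boundaries 1)" by (intro fsubspace_plus assms(3) fsubspace_boundaries)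
  fix y assume "y \<in> pairing ` K \<union> Y"
  then show "x * y \<in> M + boundaries 1"
  proof
    assume "y \<in> pairing ` K"
    then have "y \<in> boundaries 0" unfolding boundaries_def by (rule generated_base)
    then have "x * y \<in> boundaries 1"
      unfolding One_nat_def by (rule graded_moduleD(2)[OF graded_modules(2) assms(1)])
    then show ?thesis by (rule subsetD[OF plus_superset2[OF assms(3)]])
  next
    assume "y \<in> Y"
    then have "x * y \<in> M" by (rule assms(2))
    then show ?thesis by (rule subsetD[OF plus_superset1[OF fsubspace_boundaries]])
  qed
qed

end

section \<open>Subspaces of the dual equipped with a dual basis\<close>

locale koszul_component = koszul_pair s V K
  for s :: "'k::{alg_closed_field, field_char_0} \<Rightarrow> 'v::ab_group_add \<Rightarrow> 'v" and V K +
  fixes U :: "('v \<Rightarrow> 'k) set" and m :: nat and \<alpha> :: "nat \<Rightarrow> 'v \<Rightarrow> 'k" and c :: "nat \<Rightarrow> 'v"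
  assumes U: "fsubspace U" "U \<subseteq> D"
    and dual_basis: "\<forall>i<m. \<alpha> i \<in> U \<and> c i \<in> V" "\<forall>i<m. \<forall>j<m. \<alpha> i (c j) = (if i = j then 1 else 0)"
      "\<forall>a\<in>U. a = (\<Sum>i<m. fscale (a (c i)) (\<alpha> i))"
begin

text \<open>The projection of \<open>V\<close> onto the span of the \<open>c i\<close> along
  \<open>ann U\<close>. Its transpose is \<open>proj\<close>, a projection of the dual of
  \<open>V\<close> onto \<open>U\<close>.\<close>

definition lift :: "'v \<Rightarrow> 'v" where
  "lift v = (\<Sum>i<m. s (\<alpha> i v) (c i))"

definition proj :: "('v \<Rightarrow> 'k) \<Rightarrow> 'v \<Rightarrow> 'k" where
  "proj a = (\<Sum>i<m. fscale (a (c i)) (\<alpha> i))"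

lemma sum_in_V: "(\<Sum>i<n. s (k i) (c i)) \<in> V" if "n \<le> m"
  using that dual_basis(1) by (intro vs.subspace_sum[OF subspace] V_closed) auto

lemma lift_in_V: "lift v \<in> V"
  unfolding lift_def by (rule sum_in_V) simp

lemma linear_sum:
  assumes add: "\<And>u v. u \<in> V \<Longrightarrow> v \<in> V \<Longrightarrow> f (u + v) = f u + f v"
    and scale: "\<And>c v. v \<in> V \<Longrightarrow> f (s c v) = c * f v"
  shows "f (\<Sum>i<m. s (k i) (c i)) = (\<Sum>i<m. k i * (f (c i) :: 'k))"
proof -
  have "f (\<Sum>i<n. s (k i) (c i)) = (\<Sum>i<n. k i * f (c i))" if "n \<le> m" for n
    using that
  proof (induction n)
    case 0
    have "f (s 0 0) = 0 * f 0" using V_closed(1) by (rule scale)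
    then show ?case by simp
  next
    case (Suc n)
    then have "c n \<in> V" using dual_basis(1) by simp
    then show ?case using Suc sum_in_V[of n k] by (simp add: add scale V_closed)
  qed
  then show ?thesis by blast
qed

lemma dual_lift: "a \<in> D \<Longrightarrow> a (lift v) = (\<Sum>i<m. \<alpha> i v * a (c i))"
  unfolding lift_def by (rule linear_sum) (auto dest: dualD)

lemma proj_in_U: "proj a \<in> U"
  unfolding proj_def using dual_basis(1)
  by (intro fscale.subspace_sum[OF U(1)] fscale.subspace_scale[OF U(1)]) auto

lemma proj_apply: "a \<in> D \<Longrightarrow> proj a v = a (lift v)"
  by (simp add: dual_lift proj_def sum_fun_apply fscale_def mult.commute)

lemma proj_id: "a \<in> U \<Longrightarrow> proj a = a"
  using dual_basis(3) unfolding proj_def by (metis (no_types, lifting))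

lemma lift_ann: "v \<in> V \<Longrightarrow> v - lift v \<in> ann U"
proof -
  assume v: "v \<in> V"
  have "a (v - lift v) = 0" if "a \<in> U" for a
  proof -
    have a: "a \<in> D" using that U(2) by blast
    have "a (v - lift v + lift v) = a (v - lift v) + a (lift v)"
      using v lift_in_V by (intro dualD(1)[OF a] V_closed)
    then show ?thesis using proj_apply[OF a, of v] proj_id[OF that] by simp
  qed
  then show ?thesis unfolding ann_def using v lift_in_V V_closed(3) by blast
qed

text \<open>\<open>a\<close> vanishes at each v - lift v, hence agrees with its own projection to
  \<open>U\<close>.\<close>

lemma double_annihilator:
  assumes a: "a \<in> D" and "\<And>v. v \<in> ann U \<Longrightarrow> a v = 0"
  shows "a \<in> U"
proof -
  have "a v = proj a v" for v
  proof (cases "v \<in> V")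
    case True
    have "a (v - lift v + lift v) = a (v - lift v) + a (lift v)"
      using True lift_in_V by (intro dualD(1)[OF a] V_closed)
    then show ?thesis using proj_apply[OF a, of v] assms(2)[OF lift_ann[OF True]] by simp
  next
    case False
    moreover have "proj a \<in> D" using proj_in_U U(2) by blast
    ultimately show ?thesis using dualD(3)[OF a] dualD(3)[of "proj a" s V] by simp
  qed
  then have "a = proj a" by (rule ext)
  with proj_in_U show ?thesis by metis
qed

text \<open>Dually to separability. A functional detecting the failure is a form in \<open>K\<^sup>\<bottom>\<close>; as it
  vanishes on pairs from the annihilator of \<open>U\<close>, it lies in the ideal generated by \<open>U\<close>.\<close>

lemma separable_minors:
  assumes sep: "separable_subspace s V K U" and n: "n \<in> ann U" and v: "v \<in> V"
  shows "minor D n v \<in> fspan (pairing ` K \<union> minors D (ann U))" (is "_ \<in> ?S")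
proof (rule ccontr)
  assume nS: "minor D n v \<notin> ?S"
  obtain \<phi> where \<phi>: "functional \<phi>" and S: "\<And>x. x \<in> ?S \<Longrightarrow> \<phi> x = 0" and one: "\<phi> (minor D n v) = 1"
    using separating_functional[OF fscale.subspace_span nS] by blast
  define E where "E x y = \<phi> (minor D x y)" for x y
  have El: "E (x + y) z = E x z + E y z" "E (s d x) z = d * E x z" if "x \<in> V" "y \<in> V" for x y z d
    using that by (simp_all add: E_def minor_add_left minor_scale_left functionalD[OF \<phi>])
  have Er: "E z (x + y) = E z x + E z y" "E z (s d x) = d * E z x" if "x \<in> V" "y \<in> V" for x y z d
    using that by (simp_all add: E_def minor_add_right minor_scale_right functionalD[OF \<phi>])
  have Esw: "E y x = - E x y" for x y
    unfolding E_def minor_swap[of y x] functionalD[OF \<phi>] by simp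
  have E0: "E x y = 0" if "x \<in> ann U" "y \<in> ann U" for x y
    unfolding E_def using that by (intro S fscale.span_base) (auto simp: minors_def)
  \<comment> \<open>The left side vanishes by \<open>E0\<close> and \<open>lift_ann\<close>. So
    \<open>E\<close> is expressed by values with an argument in the span of the \<open>c i\<close>,
    which puts it into the ideal generated by \<open>U\<close>.\<close>
  have Eann: "E (x - lift x) (y - lift y) = E x y - E (lift x) y - E x (lift y) + E (lift x) (lift y)"
    if "x \<in> V" "y \<in> V" for x y
  proof -
    have 1: "E x z = E (x - lift x) z + E (lift x) z" for z
      using El(1)[of "x - lift x" "lift x" z] that(1) lift_in_V by (simp add: V_closed)
    have 2: "E z y = E z (y - lift y) + E z (lift y)" for z
      using Er(1)[of "y - lift y" "lift y" z] that(2) lift_in_V by (simp add: V_closed)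
    show ?thesis using 1[of y] 1[of "lift y"] 2[of "x - lift x"] by (simp add: algebra_simps)
  qed
  define e where "e i = (\<lambda>u. if u \<in> V then \<phi> (minor D (c i) u) else 0)" for i
  \<comment> \<open>With \<open>e i\<close> the contraction of \<open>E\<close> with
    \<open>c i\<close>, the sum of the wedges of \<open>\<alpha> i\<close> and \<open>e i\<close>
    counts the values of \<open>E\<close> on the span of the \<open>c i\<close> twice; the term with
    1/2 removes one copy.\<close>
  define \<beta> where "\<beta> i = e i - fscale (1 / 2) (\<Sum>j<m. fscale (E (c i) (c j)) (\<alpha> j))" for i
  have eD: "e i \<in> D" for i
    unfolding e_def by (rule functional_dual[OF \<phi> minor_add_right minor_scale_right])
  have \<alpha>D: "\<alpha> i \<in> D" if "i < m" for i using that dual_basis(1) U(2) by auto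
  have \<beta>D: "\<beta> i \<in> D" if "i < m" for i
    unfolding \<beta>_def using \<alpha>D eD
    by (intro fscale.subspace_diff[OF fsubspace_dual] fscale.subspace_scale[OF fsubspace_dual]
        fscale.subspace_sum[OF fsubspace_dual]) auto
  define \<eta> where "\<eta> = (\<Sum>i<m. wedge_list [\<alpha> i, \<beta> i])"
  have half: "(\<Sum>i<m. \<alpha> i x * \<beta> i y) = E (lift x) y - E (lift x) (lift y) / 2" if "y \<in> V" for x y
  proof -
    have "\<beta> i y = E (c i) y - (\<Sum>j<m. \<alpha> j y * E (c i) (c j)) / 2" for i
      using that by (simp add: \<beta>_def e_def E_def fscale_def sum_fun_apply mult.commute)
    moreover have "(\<Sum>j<m. \<alpha> j y * E (c i) (c j)) = E (c i) (lift y)" for i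
      unfolding lift_def by (rule linear_sum[symmetric]) (simp_all add: Er V_closed(1))
    ultimately have "(\<Sum>i<m. \<alpha> i x * \<beta> i y)
        = (\<Sum>i<m. \<alpha> i x * E (c i) y) - (\<Sum>i<m. \<alpha> i x * E (c i) (lift y)) / 2"
      by (simp add: right_diff_distrib sum_subtractf sum_divide_distrib)
    moreover have "(\<Sum>i<m. \<alpha> i x * E (c i) z) = E (lift x) z" for z
      unfolding lift_def by (rule linear_sum[symmetric]) (simp_all add: El V_closed(1))
    ultimately show ?thesis by simp
  qed
  have \<eta>: "\<eta> [x, y] = E x y" if xy: "x \<in> V" "y \<in> V" for x y
  proof -
    have "\<eta> [x, y] = (\<Sum>i<m. \<alpha> i x * \<beta> i y) - (\<Sum>i<m. \<alpha> i y * \<beta> i x)"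
      by (simp add: \<eta>_def sum_fun_apply wedge_list_2 sum_subtractf)
    also have "\<dots> = E (lift x) y - E (lift x) (lift y) / 2 - (E (lift y) x - E (lift y) (lift x) / 2)"
      using half xy by simp
    also have "\<dots> = E (lift x) y + E x (lift y) - E (lift x) (lift y)"
      using Esw[of "lift y" x] Esw[of "lift y" "lift x"] by simp
    also have "\<dots> = E x y"
      using Eann[OF xy] E0[OF lift_ann[OF xy(1)] lift_ann[OF xy(2)]] by (simp add: algebra_simps)
    finally show ?thesis .
  qed
  have "\<eta> \<in> perp s V K"
  proof (rule perpI[OF _ \<phi>])
    show "\<eta> \<in> ext_power D 2"
      unfolding \<eta>_def
    proof (rule fscale.subspace_sum)
      show "fsubspace (ext_power D 2)" unfolding ext_power_def by simp
    qed (use \<alpha>D \<beta>D in \<open>auto intro: wedge_list_mem_ext_power\<close>)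
    show "\<phi> (minor D u v) = \<eta> [u, v]" if "u \<in> V" "v \<in> V" for u v
      using \<eta>[OF that] by (simp add: E_def)
    show "\<phi> (pairing \<omega>) = 0" if "\<omega> \<in> K" for \<omega>
      using that by (intro S fscale.span_base) blast
  qed
  moreover have "\<eta> \<in> ext_ideal (ext_algebra D) hull (one_form ` U)"
    unfolding hull_def
  proof (rule InterI, elim CollectE conjE)
    fix I assume I: "ext_ideal (ext_algebra D) I" "one_form ` U \<subseteq> I"
    have "wedge_list [\<alpha> i, \<beta> i] \<in> I" if "i < m" for i
    proof -
      have "wedge_list [\<beta> i] = one_form (\<beta> i)" by (simp add: wedge_list_def wedge_ext_one)
      moreover have "set [\<beta> i] \<subseteq> D" "length [\<beta> i] = 1" using \<beta>D[OF that] by auto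
      then have "wedge_list [\<beta> i] \<in> ext_power D 1"
        unfolding ext_power_def by (intro fscale.span_base) blast
      then have "wedge_list [\<beta> i] \<in> ext_algebra D"
        unfolding ext_algebra_def by (intro fscale.span_base) blast
      ultimately have "one_form (\<beta> i) \<in> ext_algebra D" by simp
      moreover have "one_form (\<alpha> i) \<in> I" using I(2) that dual_basis(1) by auto
      ultimately show ?thesis using I(1) unfolding ext_ideal_def wedge_list_2_eq by blast
    qed
    moreover have "fsubspace I" using I(1) by (simp add: ext_ideal_def)
    ultimately show "\<eta> \<in> I" unfolding \<eta>_def by (intro fscale.subspace_sum) auto
  qed
  \<comment> \<open>A form in the exterior square of \<open>U\<close> vanishes when one argument
    lies in \<open>ann U\<close>, whereas \<phi> was normalised to 1 on the minor of
    \<open>n\<close> and \<open>v\<close>.\<close>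
  ultimately have "\<eta> \<in> ext_power U 2" using sep unfolding separable_subspace_def by blast
  then have "\<eta> \<in> {\<eta>. \<eta> [n, v] = 0}"
  proof (rule ext_power_2_cases)
    show "fsubspace {\<eta>. \<eta> [n, v] = 0}" by (intro fscale.subspaceI) (auto simp: fscale_def)
    show "wedge_list [a, b] \<in> {\<eta>. \<eta> [n, v] = 0}" if "a \<in> U" "b \<in> U" for a b
    proof -
      have "a n = 0" "b n = 0" using that n unfolding ann_def by blast+
      then show ?thesis by (simp add: wedge_list_2)
    qed
  qed
  then have "E n v = 0" using \<eta>[of n v] n v ann_subset by auto
  then show False using one by (simp add: E_def)
qed

section \<open>Restriction of cycles to a component\<close>

definition res :: "(('v \<Rightarrow> 'k) \<times> ('v \<Rightarrow> 'k) \<Rightarrow> 'k) \<Rightarrow> ('v \<Rightarrow> 'k) \<times> ('v \<Rightarrow> 'k) \<Rightarrow> 'k" where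
  "res h = (\<lambda>(b, a). if a \<in> U \<and> b \<in> U then h (b, a) else 0)"

lemma res_linear: "res (x + y) = res x + res y" "res (fscale d x) = fscale d (res x)"
  by (auto simp: res_def fun_eq_iff fscale_def)

text \<open>On the quotient of the cycles by \<open>relative U\<close>, a vector v acts like
  \<open>lift v\<close>. Hence every cycle is congruent to its pullback along \<open>proj\<close>,
  and the pullback depends only on the values on U \<times> U.\<close>

lemma vanishing_on_component:
  assumes sep: "separable_subspace s V K U" and h: "h \<in> cycles q" "res h = 0"
  shows "h \<in> relative U q"
proof -
  define pull where "pull h = (\<lambda>(b, a). if a \<in> D \<and> b \<in> D then h (proj b, proj a) else 0)"
    for h :: "('v \<Rightarrow> 'k) \<times> ('v \<Rightarrow> 'k) \<Rightarrow> 'k"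
  have pull: "pull (x + y) = pull x + pull y" "pull (fscale d x) = fscale d (pull x)" "pull 0 = 0" for x y d
    by (auto simp: pull_def fun_eq_iff fscale_def)
  have projD: "proj a \<in> D" for a using proj_in_U U(2) by blast
  let ?S = "\<lambda>q. {h \<in> cycles q. h - pull h \<in> relative U q}"
  have "graded_module (coord D ` V) ?S"
    unfolding graded_module_def
  proof (intro conjI allI ballI)
    fix q
    show "fsubspace (?S q)"
    proof (intro fscale.subspaceI CollectI conjI; (elim CollectE conjE)?)
      show "0 \<in> cycles q" by (rule fscale.subspace_0[OF fsubspace_cycles])
      show "0 - pull 0 \<in> relative U q"
        unfolding pull diff_self by (rule fscale.subspace_0[OF fsubspace_relative])
      fix x y assume *: "x \<in> cycles q" "y \<in> cycles q" "x - pull x \<in> relative U q" "y - pull y \<in> relative U q"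
      show "x + y \<in> cycles q" using * by (intro fscale.subspace_add[OF fsubspace_cycles])
      have "(x - pull x) + (y - pull y) \<in> relative U q" using * by (intro fscale.subspace_add[OF fsubspace_relative])
      then show "x + y - pull (x + y) \<in> relative U q" unfolding pull by (simp only: algebra_simps)
    next
      fix d x assume *: "x \<in> cycles q" "x - pull x \<in> relative U q"
      show "fscale d x \<in> cycles q" using * by (intro fscale.subspace_scale[OF fsubspace_cycles])
      have "fscale d (x - pull x) \<in> relative U q" using * by (intro fscale.subspace_scale[OF fsubspace_relative])
      then show "fscale d x - pull (fscale d x) \<in> relative U q"
        unfolding pull by (simp only: fscale.scale_right_diff_distrib)
    qed
    fix x h assume "x \<in> coord D ` V" and "h \<in> ?S q"
    then obtain v where v: "v \<in> V" "x = coord D v" and h: "h \<in> cycles q" "h - pull h \<in> relative U q" by blast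
    have "x * h \<in> cycles (Suc q)"
      unfolding v(2) by (intro graded_moduleD(2)[OF graded_modules(1)] imageI v h)
    moreover have "x * h - pull (x * h) \<in> relative U (Suc q)"
    proof -
      have n: "v - lift v \<in> ann U" by (rule lift_ann[OF v(1)])
      have "coord D (v - lift v) * h \<in> relative U (Suc q)"
        using n ann_subset by (intro coord_mult_cycles h separable_minors[OF sep n]) auto
      moreover have "coord D (lift v) * (h - pull h) \<in> relative U (Suc q)"
        by (intro graded_moduleD(2)[OF graded_modules(3)] imageI lift_in_V h)
      ultimately have "coord D (v - lift v) * h + coord D (lift v) * (h - pull h) \<in> relative U (Suc q)"
        by (rule fscale.subspace_add[OF fsubspace_relative])
      moreover have "coord D v = coord D (v - lift v) + coord D (lift v)"
        using coord_add[of "v - lift v" "lift v"] v lift_in_V by (simp add: V_closed)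
      moreover have "pull (x * h) = coord D (lift v) * pull h"
        unfolding v(2) using projD
        by (auto simp: pull_def fun_eq_iff coord_apply eval_at_def proj_apply)
      ultimately show ?thesis unfolding v(2) by (simp only: algebra_simps)
    qed
    ultimately show "x * h \<in> ?S (Suc q)" by blast
  qed
  moreover have "minors D V \<subseteq> ?S 0"
  proof
    fix x assume x: "x \<in> minors D V"
    then obtain u v where uv: "u \<in> V" "v \<in> V" "x = minor D u v" by (auto simp: minors_def)
    have xc: "x \<in> cycles 0" unfolding cycles_def by (rule generated_base[OF x])
    have n: "u - lift u \<in> ann U" "v - lift v \<in> ann U" by (rule lift_ann[OF uv(1)] lift_ann[OF uv(2)])+
    have "minor D (u - lift u) v \<in> relative U 0" "minor D (v - lift v) (lift u) \<in> relative U 0"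
      unfolding relative_def using separable_minors[OF sep n(1) uv(2)] separable_minors[OF sep n(2) lift_in_V]
      by simp_all
    then have "minor D (u - lift u) v - minor D (v - lift v) (lift u) \<in> relative U 0"
      by (rule fscale.subspace_diff[OF fsubspace_relative])
    also have "minor D (u - lift u) v - minor D (v - lift v) (lift u) = x - pull x"
    proof -
      have 1: "minor D u v = minor D (u - lift u) v + minor D (lift u) v"
        using minor_add_left[of "u - lift u" "lift u" v] uv lift_in_V by (simp add: V_closed)
      have 2: "minor D v (lift u) = minor D (v - lift v) (lift u) + minor D (lift v) (lift u)"
        using minor_add_left[of "v - lift v" "lift v" "lift u"] uv lift_in_V by (simp add: V_closed)
      have 3: "pull x = minor D (lift u) (lift v)"
        unfolding uv(3) using projD
        by (auto simp: pull_def fun_eq_iff minor_apply eval_at_def proj_apply)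
      have 4: "minor D (lift u) v = - minor D v (lift u)" "minor D (lift v) (lift u) = - minor D (lift u) (lift v)"
        by (auto simp: fun_eq_iff minor_apply)
      show ?thesis unfolding 3 unfolding uv(3) 1 4(1) 2 4(2) by (simp add: algebra_simps)
    qed
    finally show "x \<in> ?S 0" using xc by blast
  qed
  ultimately have "generated (coord D ` V) (minors D V) q \<subseteq> ?S q" by (rule generated_minimal)
  from subsetD[OF this h(1)[unfolded cycles_def]] have "h - pull h \<in> relative U q" by blast
  moreover have "h (proj b, proj a) = 0" for a b
    using fun_cong[OF h(2), of "(proj b, proj a)"] proj_in_U by (simp add: res_def)
  then have "pull h = 0" by (auto simp: pull_def fun_eq_iff)
  ultimately show ?thesis by (simp only: diff_zero)
qed

lemma res_generated: "res ` generated (coord D ` V) Y q = generated (coord U ` V) (res ` Y) q"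
proof -
  let ?g = "\<lambda>x :: ('v \<Rightarrow> 'k) \<times> ('v \<Rightarrow> 'k) \<Rightarrow> 'k. (\<lambda>(b, a). if a \<in> U then x (b, a) else 0)"
  have mult: "res (x * y) = ?g x * res y" for x y
    by (auto simp: res_def fun_eq_iff)
  have "?g (coord D v) = coord U v" for v
    using U(2) by (auto simp: fun_eq_iff coord_apply eval_at_def)
  then have g: "?g ` coord D ` V = coord U ` V" by (simp add: image_image)
  show ?thesis unfolding g[symmetric] by (rule generated_image[OF res_linear mult])
qed

lemma res_boundaries: "res ` boundaries q = generated (coord U ` V) (res ` pairing ` K) q"
  unfolding boundaries_def by (rule res_generated)

lemma res_cycles: "res ` cycles q = generated (coord U ` V) (minors U V) q"
proof -
  have "res (minor D u v) = minor U u v" for u v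
    using U(2) by (auto simp: fun_eq_iff minor_apply eval_at_def res_def)
  then have "res ` minors D V = minors U V" unfolding minors_def by (auto simp: image_iff) metis
  then show ?thesis unfolding cycles_def res_generated by simp
qed

text \<open>Restriction identifies cycles modulo \<open>relative U\<close> with restricted cycles
  modulo restricted boundaries: minors of \<open>ann U\<close> restrict to 0, and
  \<open>vanishing_on_component\<close> shows that nothing outside \<open>relative U\<close> is
  lost.\<close>

lemma fdim_relative:
  assumes sep: "separable_subspace s V K U"
  shows "fdim (cycles q) + fdim (res ` boundaries q) = fdim (res ` cycles q) + fdim (relative U q)"
proof (rule relative_fdim_eq[of res, OF res_linear])
  have rb: "res ` boundaries q \<subseteq> res ` cycles q"
    using boundaries_subset_relative relative_subset_cycles by blast
  show "fsubspace (relative U q)" by (rule fsubspace_relative)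
  show "fsubspace (cycles q)" by (rule fsubspace_cycles)
  show "relative U q \<subseteq> cycles q" by (rule relative_subset_cycles)
  show "fin_dim (cycles q)" by (rule fin_dim_cycles)
  show sb: "fsubspace (res ` boundaries q)" unfolding res_boundaries by simp
  show "fin_dim (res ` boundaries q)"
    using fin_dim_boundaries by (rule fin_dim_linear_image[OF res_linear])
  have "res h = 0" if "h \<in> minors D (ann U)" for h
  proof -
    obtain u v where "u \<in> ann U" "v \<in> ann U" "h = minor D u v" using \<open>h \<in> minors D (ann U)\<close>
      by (auto simp: minors_def)
    then show ?thesis by (auto simp: res_def fun_eq_iff minor_apply eval_at_def ann_def)
  qed
  then have "res h \<in> fspan (res ` pairing ` K)" if "h \<in> minors D (ann U)" for h
    using that fscale.span_zero[of "res ` pairing ` K"] by (simp only:)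
  then have "res ` (pairing ` K \<union> minors D (ann U)) \<subseteq> fspan (res ` pairing ` K)"
    unfolding image_Un by (intro Un_least image_subsetI) (rule fscale.span_base[OF imageI])
  then show "res ` relative U q \<subseteq> res ` boundaries q"
    unfolding relative_def res_generated res_boundaries by (rule generated_subset)
  show "res ` cycles q + res ` boundaries q = res ` cycles q"
  proof
    have sc: "fsubspace (res ` cycles q)" unfolding res_cycles by simp
    show "res ` cycles q + res ` boundaries q \<subseteq> res ` cycles q"
      using sc rb by (intro plus_subset) auto
    show "res ` cycles q \<subseteq> res ` cycles q + res ` boundaries q" by (rule plus_superset1[OF sb])
  qed
  fix x assume x: "x \<in> cycles q" "res x \<in> res ` boundaries q"
  then obtain b where b: "b \<in> boundaries q" "res x = res b" by blast
  have brel: "b \<in> relative U q" using b(1) boundaries_subset_relative by blast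
  have "x - b \<in> cycles q"
    using x(1) brel relative_subset_cycles
    by (intro fscale.subspace_diff[OF fsubspace_cycles]) blast+
  moreover have "res (x - b) = 0"
    using res_linear(1)[of "x - b" b] b(2) by simp
  ultimately have "x - b \<in> relative U q" by (rule vanishing_on_component[OF sep])
  from fscale.subspace_add[OF fsubspace_relative this brel]
  show "x \<in> relative U q" by (simp only: diff_add_cancel)
qed

end

section \<open>The Koszul module of a component\<close>

lemma dual_sum:
  assumes "\<phi> \<in> dual fscale W" "fsubspace W" "\<And>i. i < n \<Longrightarrow> x i \<in> W"
  shows "\<phi> (\<Sum>i<n::nat. fscale (k i) (x i)) = (\<Sum>i<n. k i * \<phi> (x i))"
  using assms(3)
proof (induction n)
  case 0
  have "\<phi> (fscale 0 0) = 0 * \<phi> 0" using fscale.subspace_0[OF assms(2)] by (rule dualD(2)[OF assms(1)])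
  then show ?case unfolding lessThan_0 sum.empty fscale.scale_zero_left mult_zero_left .
next
  case (Suc n)
  have W: "(\<Sum>i<n. fscale (k i) (x i)) \<in> W" "x n \<in> W"
    using Suc.prems by (auto intro!: fscale.subspace_sum[OF assms(2)] fscale.subspace_scale[OF assms(2)])
  have "\<phi> (\<Sum>i<n. fscale (k i) (x i)) = (\<Sum>i<n. k i * \<phi> (x i))"
    using Suc.prems by (intro Suc.IH) simp
  then show ?case
    unfolding sum.lessThan_Suc dualD(1)[OF assms(1) W(1) fscale.subspace_scale[OF assms(2) W(2)]]
      dualD(2)[OF assms(1) W(2)] by (simp only:)
qed

context koszul_component
begin

abbreviation U_dual where "U_dual \<equiv> dual fscale U"

abbreviation U_bidual where "U_bidual \<equiv> dual fscale U_dual"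

abbreviation K_U where "K_U \<equiv> ext_map V U_bidual (eval_at U) ` K"

lemma eval_at_U_add: "u \<in> V \<Longrightarrow> v \<in> V \<Longrightarrow> eval_at U (u + v) = eval_at U u + eval_at U v"
  using U(2) by (auto simp: eval_at_def fun_eq_iff dual_def subset_iff)

lemma eval_at_U_scale: "v \<in> V \<Longrightarrow> eval_at U (s d v) = fscale d (eval_at U v)"
  using U(2) by (auto simp: eval_at_def fun_eq_iff dual_def subset_iff fscale_def)

lemma eval_at_mem_dual:
  assumes "fsubspace W"
  shows "eval_at W v \<in> dual fscale W"
  using fscale.subspace_add[OF assms] fscale.subspace_scale[OF assms]
  by (auto simp: dual_def eval_at_def fscale_def)

text \<open>Surjectivity of the map dual to the inclusion of \<open>U\<close>: a functional \<phi>
  is evaluation at the vector with coefficients \<open>\<phi> (\<alpha> i)\<close> at the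
  \<open>c i\<close>.\<close>

lemma U_dual_eq: "U_dual = eval_at U ` V"
proof
  show "eval_at U ` V \<subseteq> U_dual" using eval_at_mem_dual[OF U(1)] by blast
  show "U_dual \<subseteq> eval_at U ` V"
  proof
    fix \<phi> assume \<phi>: "\<phi> \<in> U_dual"
    let ?v = "\<Sum>i<m. s (\<phi> (\<alpha> i)) (c i)"
    have "\<phi> a = eval_at U ?v a" for a
    proof (cases "a \<in> U")
      case True
      then have "a \<in> D" using U(2) by blast
      then have "a ?v = (\<Sum>i<m. \<phi> (\<alpha> i) * a (c i))" by (intro linear_sum) (auto dest: dualD)
      also have "\<dots> = \<phi> (\<Sum>i<m. fscale (a (c i)) (\<alpha> i))"
        using dual_basis(1) by (subst dual_sum[OF \<phi> U(1)]) (auto simp: mult.commute)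
      also have "\<dots> = \<phi> a" using dual_basis(3) True by metis
      finally show ?thesis using True by (simp add: eval_at_def)
    next
      case False
      then show ?thesis using dualD(3)[OF \<phi>] by (simp add: eval_at_def)
    qed
    then have "\<phi> = eval_at U ?v" by (rule ext)
    then show "\<phi> \<in> eval_at U ` V" by (rule image_eqI) (rule sum_in_V[OF order_refl])
  qed
qed

text \<open>Reflexivity of \<open>U\<close>: the preimage of \<psi> is read off from its values at
  the evaluations at the \<open>c i\<close>.\<close>

lemma U_bidual_eq: "U_bidual = eval_at U_dual ` U"
proof
  show "eval_at U_dual ` U \<subseteq> U_bidual" using eval_at_mem_dual[OF fsubspace_dual] by blast
  show "U_bidual \<subseteq> eval_at U_dual ` U"
  proof
    fix \<psi> assume \<psi>: "\<psi> \<in> U_bidual"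
    let ?a = "\<Sum>i<m. fscale (\<psi> (eval_at U (c i))) (\<alpha> i)"
    have "\<psi> \<phi> = eval_at U_dual ?a \<phi>" for \<phi>
    proof (cases "\<phi> \<in> U_dual")
      case True
      have "\<phi> = (\<Sum>i<m. fscale (\<phi> (\<alpha> i)) (eval_at U (c i)))" (is "_ = ?r")
      proof
        fix a
        show "\<phi> a = ?r a"
        proof (cases "a \<in> U")
          case aU: True
          have "\<phi> a = \<phi> (\<Sum>i<m. fscale (a (c i)) (\<alpha> i))" using dual_basis(3) aU by metis
          also have "\<dots> = (\<Sum>i<m. a (c i) * \<phi> (\<alpha> i))"
            using dual_basis(1) by (intro dual_sum[OF True U(1)]) auto
          also have "\<dots> = ?r a" using aU by (simp add: sum_fun_apply fscale_def eval_at_def mult.commute)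
          finally show ?thesis .
        next
          case False
          then show ?thesis using dualD(3)[OF True] by (simp add: sum_fun_apply fscale_def eval_at_def)
        qed
      qed
      then have "\<psi> \<phi> = \<psi> ?r" by (rule arg_cong)
      also have "\<dots> = (\<Sum>i<m. \<phi> (\<alpha> i) * \<psi> (eval_at U (c i)))"
        by (intro dual_sum[OF \<psi> fsubspace_dual] eval_at_mem_dual U(1))
      also have "\<dots> = \<phi> ?a"
        using dual_basis(1) by (subst dual_sum[OF True U(1)]) (auto simp: mult.commute)
      finally show ?thesis using True by (simp add: eval_at_def)
    next
      case False
      then show ?thesis using dualD(3)[OF \<psi>] by (simp add: eval_at_def)
    qed
    then have "\<psi> = eval_at U_dual ?a" by (rule ext)
    moreover have "?a \<in> U" using dual_basis(1)
      by (intro fscale.subspace_sum[OF U(1)] fscale.subspace_scale[OF U(1)]) auto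
    ultimately show "\<psi> \<in> eval_at U_dual ` U" by blast
  qed
qed

lemma ext_map_linear:
  "ext_map V W f (x + y) = ext_map V W f x + ext_map V W f y"
  "ext_map V W f (fscale d x) = fscale d (ext_map V W f x)"
  by (auto simp: ext_map_def fun_eq_iff fscale_def)

lemma koszul_pair_component: "koszul_pair fscale U_dual K_U"
proof
  show "fsubspace U_dual" by (rule fsubspace_dual)
  have "fin_dim U_dual"
    unfolding U_dual_eq by (rule linear_image(1)[OF eval_at_U_add eval_at_U_scale])
  then obtain S where S: "finite S" "S \<subseteq> U_dual" "U_dual \<subseteq> fspan S" by (rule fin_dim_basis)
  have "fspan S \<subseteq> U_dual" by (rule fscale.span_minimal[OF S(2) fsubspace_dual])
  with S show "\<exists>S. finite S \<and> fspan S = U_dual" by blast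
  have "fspan K = K" using K_subspace by simp
  with image_fspan[of "ext_map V U_bidual (eval_at U)" K, OF ext_map_linear]
  have "K_U = fspan K_U" by (simp only:)
  then show "fsubspace K_U" by (metis fscale.subspace_span)
  show "K_U \<subseteq> ext_power (fun_copy fscale U_dual) 2"
  proof clarify
    fix \<omega> assume "\<omega> \<in> K"
    then have "\<omega> \<in> ext_power (fun_copy s V) 2" using K_subset by blast
    let ?E = "ext_power (fun_copy fscale U_dual) 2"
    have E: "fsubspace ?E" unfolding ext_power_def by simp
    have e0: "ext_map V U_bidual (eval_at U) 0 = 0" by (auto simp: ext_map_def fun_eq_iff)
    from \<open>\<omega> \<in> ext_power (fun_copy s V) 2\<close>
    have "\<omega> \<in> {\<omega>. ext_map V U_bidual (eval_at U) \<omega> \<in> ?E}"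
    proof (rule ext_power_2_cases)
      show "fsubspace {\<omega>. ext_map V U_bidual (eval_at U) \<omega> \<in> ?E}"
        using E unfolding fscale.subspace_def by (simp only: mem_Collect_eq ext_map_linear e0) blast
      fix u v assume "u \<in> fun_copy s V" "v \<in> fun_copy s V"
      then obtain u' v' where uv: "u' \<in> V" "v' \<in> V" "u = eval_at D u'" "v = eval_at D v'"
        by (auto simp: fun_copy_def)
      have "ext_map V U_bidual (eval_at U) (wedge_list [u, v])
          = wedge_list [eval_at U_bidual (eval_at U u'), eval_at U_bidual (eval_at U v')]"
        unfolding uv(3,4)
        by (rule ext_map_wedge[OF vector_space subspace _ _ _ uv(1,2)])
          (use eval_at_U_add eval_at_U_scale U_dual_eq in auto)
      moreover have "\<dots> \<in> ?E"
        using uv(1,2) by (intro wedge_list_mem_ext_power) (auto simp: fun_copy_def U_dual_eq)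
      ultimately show "wedge_list [u, v] \<in> {\<omega>. ext_map V U_bidual (eval_at U) \<omega> \<in> ?E}" by simp
    qed
    then show "ext_map V U_bidual (eval_at U) \<omega> \<in> ?E" by blast
  qed
qed

text \<open>The space dual to \<open>U\<close> has \<open>U\<close> as its dual, and under this identification its Koszul complex
  is the restriction to \<open>U\<close> of the Koszul complex of \<open>V\<close>.\<close>

lemma koszul_dim_component:
  assumes sep: "separable_subspace s V K U"
  shows "koszul_dim fscale U_dual K_U q = fdim (cycles q) - fdim (relative U q)"
proof -
  interpret t: koszul_pair fscale U_dual K_U by (rule koszul_pair_component)
  let ?j = "eval_at U_dual"
  \<comment> \<open>Pullback along the isomorphism \<open>?j\<close> of \<open>U\<close> with its
    bidual, extended by 0 so that images under \<open>r\<close> and under \<open>res\<close> can be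
    compared.\<close>
  define r where "r h = (\<lambda>(b, a). if a \<in> U \<and> b \<in> U then h (?j b, ?j a) else 0)"
    for h :: "((('v \<Rightarrow> 'k) \<Rightarrow> 'k) \<Rightarrow> 'k) \<times> ((('v \<Rightarrow> 'k) \<Rightarrow> 'k) \<Rightarrow> 'k) \<Rightarrow> 'k"
  let ?g = "\<lambda>h :: ((('v \<Rightarrow> 'k) \<Rightarrow> 'k) \<Rightarrow> 'k) \<times> ((('v \<Rightarrow> 'k) \<Rightarrow> 'k) \<Rightarrow> 'k) \<Rightarrow> 'k.
    (\<lambda>(b, a). if a \<in> U then h (?j b, ?j a) else 0)"
  have r: "r (x + y) = r x + r y" "r (fscale d x) = fscale d (r x)" for x y d
    by (auto simp: r_def fun_eq_iff fscale_def)
  have mult: "r (x * y) = ?g x * r y" for x y by (auto simp: r_def fun_eq_iff)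
  have j: "?j a \<in> U_bidual" if "a \<in> U" for a using that U_bidual_eq by blast
  have jv: "eval_at U_bidual (eval_at U v) (?j a) = eval_at U v a" if "a \<in> U" "v \<in> V" for a v
  proof -
    have "eval_at U v \<in> U_dual" unfolding U_dual_eq using that(2) by (rule imageI)
    then show ?thesis using j[OF that(1)] by (simp add: eval_at_def[of U_bidual] eval_at_def[of U_dual])
  qed
  have ev0: "eval_at U v a = 0" if "a \<notin> U" for a v using that by (simp add: eval_at_def)
  have "?g (coord U_bidual (eval_at U v)) = coord U v" if "v \<in> V" for v
    using jv[OF _ that] ev0 by (auto simp: fun_eq_iff coord_apply)
  then have g: "?g ` coord U_bidual ` U_dual = coord U ` V"
    unfolding U_dual_eq image_image by (intro image_cong refl)
  have rm: "r (minor U_bidual (eval_at U u) (eval_at U v)) = minor U u v" if "u \<in> V" "v \<in> V" for u v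
    using jv[OF _ that(1)] jv[OF _ that(2)] ev0 by (auto simp: fun_eq_iff minor_apply r_def)
  have mi: "r ` minors U_bidual U_dual = minors U V"
  proof
    show "r ` minors U_bidual U_dual \<subseteq> minors U V"
    proof clarify
      fix h assume "h \<in> minors U_bidual U_dual"
      then obtain u v where "u \<in> V" "v \<in> V" "h = minor U_bidual (eval_at U u) (eval_at U v)"
        unfolding minors_def U_dual_eq by blast
      then show "r h \<in> minors U V" using rm unfolding minors_def by blast
    qed
    show "minors U V \<subseteq> r ` minors U_bidual U_dual"
    proof
      fix h assume "h \<in> minors U V"
      then obtain u v where uv: "u \<in> V" "v \<in> V" "h = minor U u v" unfolding minors_def by blast
      then have "h = r (minor U_bidual (eval_at U u) (eval_at U v))" using rm by simp
      moreover have "minor U_bidual (eval_at U u) (eval_at U v) \<in> minors U_bidual U_dual"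
        using uv unfolding minors_def U_dual_eq by blast
      ultimately show "h \<in> r ` minors U_bidual U_dual" by blast
    qed
  qed
  have rC: "r ` t.cycles q = res ` cycles q"
    unfolding t.cycles_def res_cycles g[symmetric] mi[symmetric] by (rule generated_image[OF r mult])
  have "r (pairing (ext_map V U_bidual (eval_at U) \<omega>)) = res (pairing \<omega>)" for \<omega>
  proof -
    \<comment> \<open>The transpose of \<open>eval_at U\<close> is the inclusion of
      \<open>U\<close>, so \<open>ext_map\<close> amounts to restricting to
      \<open>U\<close>.\<close>
    have "(\<lambda>v. if v \<in> V then ?j a (eval_at U v) else 0) = a" if "a \<in> U" for a
      using that U(2) U_dual_eq dualD(3)[of a s V] by (auto simp: eval_at_def fun_eq_iff)
    then show ?thesis using j by (auto simp: r_def res_def pairing_def ext_map_def fun_eq_iff)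
  qed
  then have "r ` pairing ` K_U = res ` pairing ` K" by (simp only: image_image)
  then have rB: "r ` t.boundaries q = res ` boundaries q"
    unfolding t.boundaries_def res_boundaries g[symmetric] by (simp only: generated_image[of r, OF r mult])
  have BC: "t.boundaries q \<subseteq> t.cycles q"
    using t.boundaries_subset_relative t.relative_subset_cycles by blast
  have "fdim (t.cycles q) + fdim (r ` t.boundaries q) = fdim (r ` t.cycles q) + fdim (t.boundaries q)"
  proof (rule relative_fdim_eq[of r, OF r])
    show "fsubspace (t.boundaries q)" "fsubspace (t.cycles q)"
      by (rule t.fsubspace_boundaries t.fsubspace_cycles)+
    show "t.boundaries q \<subseteq> t.cycles q" by (rule BC)
    show "fin_dim (t.cycles q)" by (rule t.fin_dim_cycles)
    show sb: "fsubspace (r ` t.boundaries q)" unfolding rB res_boundaries by simp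
    show "fin_dim (r ` t.boundaries q)"
      using t.fin_dim_boundaries by (rule fin_dim_linear_image[OF r])
    show "r ` t.boundaries q \<subseteq> r ` t.boundaries q" ..
    have sc: "fsubspace (r ` t.cycles q)" unfolding rC res_cycles by simp
    show "r ` t.cycles q + r ` t.boundaries q = r ` t.cycles q"
      by (intro subset_antisym plus_subset[OF sc] plus_superset1[OF sb] image_mono BC order_refl)
    fix x assume x: "x \<in> t.cycles q" "r x \<in> r ` t.boundaries q"
    then obtain b where b: "b \<in> t.boundaries q" "r x = r b" by blast
    have "b \<in> t.cycles q" using b(1) BC by blast
    \<comment> \<open>Cycles of the component are supported on pairs from the bidual, which
      \<open>?j\<close> exhausts, so \<open>r\<close> is injective on them.\<close>
    note supp = generated_minors_supported[OF x(1)[unfolded t.cycles_def]]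
      generated_minors_supported[OF this[unfolded t.cycles_def]]
    have "x p = b p" for p
    proof -
      obtain b' a' where p: "p = (b', a')" by (cases p)
      show ?thesis
      proof (cases "a' \<in> U_bidual \<and> b' \<in> U_bidual")
        case True
        then obtain a d where "a \<in> U" "d \<in> U" "a' = ?j a" "b' = ?j d" using U_bidual_eq by blast
        then show ?thesis using fun_cong[OF b(2), of "(d, a)"] unfolding p by (simp add: r_def)
      next
        case False
        then show ?thesis using supp[of a' b'] unfolding p by simp
      qed
    qed
    then have "x = b" by (rule ext)
    then show "x \<in> t.boundaries q" using b(1) by simp
  qed
  moreover have "fdim (t.boundaries q) \<le> fdim (t.cycles q)"
    using BC fscale.span_superset by (intro fdim_mono t.fin_dim_cycles) blast
  moreover have "fdim (relative U q) \<le> fdim (cycles q)"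
    using relative_subset_cycles fscale.span_superset by (intro fdim_mono fin_dim_cycles) blast
  ultimately show ?thesis
    using fdim_relative[OF sep, of q] unfolding t.koszul_dim_eq rC rB by linarith
qed

text \<open>Nakayama's lemma at the point \<open>(a, a)\<close>, with the minors of
  \<open>ann U\<close> as generators; the multipliers from \<open>ann U\<close> vanish there because
  \<open>a \<in> U\<close>. One form serves all degrees since \<open>relative U\<close> is generated
  in degree 0.\<close>

lemma annihilate_relative:
  assumes sep: "separable_subspace s V K U" and a: "a \<in> U" "a \<noteq> 0"
  shows "\<exists>j. \<exists>g\<in>forms (coord D ` V) j. g (a, a) \<noteq> 0 \<and>
    (\<forall>q. \<forall>x\<in>relative U q. g * x \<in> boundaries (q + j))"
proof -
  have aD: "a \<in> D" using a(1) U(2) by blast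
  obtain v where v: "v \<in> V" "a v = 1" using nonzero_dual[OF aD a(2)] by blast
  let ?N = "coord D ` ann U" and ?Y = "minors D (ann U)"
  have "\<exists>j. \<exists>g\<in>forms (coord D ` V) j. g (a, a) \<noteq> 0 \<and> (\<forall>y\<in>?Y. g * y \<in> boundaries j)"
  proof (rule nakayama_fin_dim)
    show "fin_dim ?Y" using minors_mono[OF ann_subset] fin_dim_minors by (rule fin_dim_mono)
    show "graded_module (coord D ` V) boundaries" by (rule graded_modules(2))
    show "coord D v \<in> coord D ` V" "coord D v (a, a) = 1"
      using v aD by (simp_all add: coord_apply eval_at_def)
    show "?N \<subseteq> coord D ` V" using ann_subset by blast
    show "n (a, a) = 0" if "n \<in> ?N" for n using that a by (auto simp: ann_def coord_apply eval_at_def)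
    fix y assume "y \<in> ?Y"
    then obtain n n' where n: "n \<in> ann U" "n' \<in> ann U" "y = minor D n n'" by (auto simp: minors_def)
    have Z: "fsubspace (?N \<odot> ?Y + boundaries 1)"
      by (intro fsubspace_plus fsubspace_boundaries) simp
    \<comment> \<open>Separability rewrites the minor of \<open>v\<close> and \<open>n'\<close>
      through \<open>K\<close> and minors of \<open>ann U\<close>, and the factor \<open>n\<close>
      stays in front.\<close>
    have *: "coord D n * minor D v n' \<in> ?N \<odot> ?Y + boundaries 1" if n: "n \<in> ann U" "n' \<in> ann U" for n n'
    proof (rule mult_pairing_Un[where Y = "?Y"])
      show "coord D n \<in> coord D ` V" using n(1) ann_subset by blast
      show "coord D n * y \<in> ?N \<odot> ?Y" if "y \<in> ?Y" for y using n(1) that by (intro span_timesI imageI)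
      have "fscale (- 1) (minor D n' v) \<in> fspan (pairing ` K \<union> ?Y)"
        by (intro fscale.span_scale separable_minors[OF sep n(2) v(1)])
      then show "minor D v n' \<in> fspan (pairing ` K \<union> ?Y)" unfolding minor_swap[of v n'] .
    qed simp
    show "coord D v * y \<in> ?N \<odot> ?Y + boundaries 1"
      unfolding n(3) coord_mult_minor[of v n n']
      by (rule fscale.subspace_diff[OF Z *[OF n(1,2)] *[OF n(2,1)]])
  qed
  then obtain j g where g: "g \<in> forms (coord D ` V) j" "g (a, a) \<noteq> 0" "\<And>y. y \<in> ?Y \<Longrightarrow> g * y \<in> boundaries j"
    by blast
  have "g * y \<in> boundaries j" if "y \<in> pairing ` K \<union> ?Y" for y
    using that
  proof
    assume "y \<in> pairing ` K"
    then have "y \<in> boundaries 0" unfolding boundaries_def by (rule generated_base)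
    then have "g * y \<in> boundaries (0 + j)" by (rule forms_mult_graded_module[OF graded_modules(2) g(1)])
    then show ?thesis by simp
  qed (rule g(3))
  then have "g * x \<in> boundaries (q + j)" if "x \<in> relative U q" for q x
    using that unfolding relative_def by (rule forms_annihilate_generated[OF graded_modules(2) g(1)])
  with g(1,2) show ?thesis by blast
qed

end

section \<open>Support of the Koszul module\<close>

text \<open>A form that is nonzero at one point of a line vanishes at only finitely many others;
  this allows leaving a common point of two components along a line inside one of them. That
  \<open>p\<close> is chosen before \<open>b\<close> also shows independence of the first
  argument.\<close>

lemma forms_polynomial_on_lines:
  fixes s :: "'k::field \<Rightarrow> 'v::ab_group_add \<Rightarrow> 'v"
  assumes "f \<in> forms (coord (dual s V) ` V) j" "a \<in> dual s V" "e \<in> dual s V"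
  shows "\<exists>p. \<forall>t b. f (b, a + fscale t e) = poly p t"
  using assms(1)
proof (induction j arbitrary: f)
  case 0
  then obtain c where "f = fscale c 1" by (auto simp: fscale.span_singleton)
  then show ?case by (intro exI[of _ "[:c:]"]) (simp add: fscale_def)
next
  case (Suc j)
  let ?D = "dual s V"
  let ?F = "{f :: ('v \<Rightarrow> 'k) \<times> ('v \<Rightarrow> 'k) \<Rightarrow> 'k. \<exists>p. \<forall>t b. f (b, a + fscale t e) = poly p t}"
  have "fsubspace ?F"
  proof (intro fscale.subspaceI CollectI)
    show "\<exists>p. \<forall>t b. (0 :: ('v \<Rightarrow> 'k) \<times> ('v \<Rightarrow> 'k) \<Rightarrow> 'k) (b, a + fscale t e) = poly p t"
      by (intro exI[of _ 0]) simp
    fix f g :: "('v \<Rightarrow> 'k) \<times> ('v \<Rightarrow> 'k) \<Rightarrow> 'k" assume "f \<in> ?F" "g \<in> ?F"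
    then obtain p p' where "\<And>t b. f (b, a + fscale t e) = poly p t" "\<And>t b. g (b, a + fscale t e) = poly p' t"
      by blast
    then show "\<exists>p. \<forall>t b. (f + g) (b, a + fscale t e) = poly p t"
      by (intro exI[of _ "p + p'"]) simp
  next
    fix c and f :: "('v \<Rightarrow> 'k) \<times> ('v \<Rightarrow> 'k) \<Rightarrow> 'k" assume "f \<in> ?F"
    then obtain p where "\<And>t b. f (b, a + fscale t e) = poly p t" by blast
    then show "\<exists>p. \<forall>t b. fscale c f (b, a + fscale t e) = poly p t"
      by (intro exI[of _ "smult c p"]) (simp add: fscale_def)
  qed
  then have "coord ?D ` V \<odot> forms (coord ?D ` V) j \<subseteq> ?F"
  proof (rule span_times_subset)
    fix x g assume "x \<in> coord ?D ` V" "g \<in> forms (coord ?D ` V) j"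
    then obtain v p where v: "x = coord ?D v" and p: "\<And>t b. g (b, a + fscale t e) = poly p t"
      using Suc.IH by blast
    have "a + fscale t e \<in> ?D" for t
      using assms(2,3) by (intro fscale.subspace_add[OF fsubspace_dual] fscale.subspace_scale[OF fsubspace_dual])
    then have "x (b, a + fscale t e) = poly [:a v, e v:] t" for t b
      unfolding v by (simp add: coord_apply eval_at_def) (simp add: fscale_def)
    then have "(x * g) (b, a + fscale t e) = poly ([:a v, e v:] * p) t" for t b
      using p by (simp only: times_fun_apply poly_mult)
    then show "x * g \<in> ?F" by blast
  qed
  then show ?case using Suc.prems unfolding forms.simps by blast
qed

text \<open>Zorn's lemma for the irreducible sets between \<open>{a}\<close> and \<open>R\<close>.
  The union of a chain is irreducible: if a member \<open>Y\<close> is not inside \<open>B\<close>,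
  every member containing \<open>Y\<close> lies in \<open>A\<close>.\<close>

lemma irreducible_component_exists:
  assumes "a \<in> R"
  shows "\<exists>Z\<in>irreducible_components s V R. a \<in> Z"
proof -
  let ?A = "{Y. a \<in> Y \<and> Y \<subseteq> R \<and> zariski_irreducible s V Y}"
  have "{a} \<in> ?A" using assms by (auto simp: zariski_irreducible_def)
  then have "?A \<noteq> {}" by blast
  moreover have "\<Union>C \<in> ?A" if C: "C \<noteq> {}" "subset.chain ?A C" for C
  proof -
    have CA: "C \<subseteq> ?A" and tot: "\<And>X Y. X \<in> C \<Longrightarrow> Y \<in> C \<Longrightarrow> X \<subseteq> Y \<or> Y \<subseteq> X"
      using C(2) by (auto simp: subset_chain_def)
    have "zariski_irreducible s V (\<Union>C)"
      unfolding zariski_irreducible_def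
    proof (intro conjI allI impI)
      show "\<Union>C \<noteq> {}" using C(1) CA by blast
      fix A B assume AB: "zariski_closed s V A \<and> zariski_closed s V B \<and> \<Union>C \<subseteq> A \<union> B"
      show "\<Union>C \<subseteq> A \<or> \<Union>C \<subseteq> B"
      proof (rule disjCI)
        assume "\<not> \<Union>C \<subseteq> B"
        then obtain Y where Y: "Y \<in> C" "\<not> Y \<subseteq> B" by blast
        show "\<Union>C \<subseteq> A"
        proof (rule Union_least)
          fix X assume X: "X \<in> C"
          define Z where "Z = (if X \<subseteq> Y then Y else X)"
          have Z: "Z \<in> C" "X \<subseteq> Z" "Y \<subseteq> Z" using tot[OF X Y(1)] X Y(1) by (auto simp: Z_def)
          then have "zariski_irreducible s V Z" "Z \<subseteq> A \<union> B" using CA AB by blast+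
          then have "Z \<subseteq> A \<or> Z \<subseteq> B" using AB unfolding zariski_irreducible_def by blast
          then show "X \<subseteq> A" using Z Y(2) by blast
        qed
      qed
    qed
    then show ?thesis using C(1) CA by blast
  qed
  ultimately have "\<exists>M\<in>?A. \<forall>X\<in>?A. M \<subseteq> X \<longrightarrow> X = M" by (rule subset_Zorn_nonempty)
  then obtain M where "M \<in> ?A" "\<forall>X\<in>?A. M \<subseteq> X \<longrightarrow> X = M" by blast
  then have "M \<in> irreducible_components s V R" "a \<in> M"
    unfolding irreducible_components_def by blast+
  then show ?thesis by blast
qed

context koszul_pair
begin

lemma resonance_subset: "resonance s V K \<subseteq> D"
  unfolding resonance_def using fscale.subspace_0[OF fsubspace_dual] by blast

lemma koszul_component_exists:
  assumes "fsubspace U" "U \<subseteq> D"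
  shows "\<exists>m \<alpha> c. koszul_component s V K U m \<alpha> c"
proof -
  obtain S where S: "finite S" "vs.span S = V" using finitely_spanned by blast
  have SV: "S \<subseteq> V" using S(2) vs.span_superset by blast
  have zero: "a = 0" if "a \<in> U" "\<forall>v\<in>S. a v = 0" for a
  proof
    fix v
    have aD: "a \<in> D" using that(1) assms(2) by blast
    have "v \<in> V \<and> a v = 0" if "v \<in> vs.span S" for v
      using that
    proof (induction rule: vs.span_induct_alt)
      case base
      show ?case using dual_zero[OF aD] V_closed(1) by simp
    next
      case (step c x y)
      then have "x \<in> V" "a x = 0" using SV \<open>\<forall>v\<in>S. a v = 0\<close> by auto
      then show ?case using step by (simp add: V_closed dualD(1,2)[OF aD])
    qed
    then show "a v = 0 v" using S(2) dualD(3)[OF aD, of v] by (cases "v \<in> V") auto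
  qed
  have "\<exists>(m::nat) \<alpha> c. (\<forall>i<m. \<alpha> i \<in> U \<and> c i \<in> V) \<and> (\<forall>i<m. \<forall>j<m. \<alpha> i (c j) = (if i = j then 1 else 0)) \<and>
    (\<forall>a\<in>U. a = (\<Sum>i<m. fscale (a (c i)) (\<alpha> i)))"
    using assms S(1) SV zero by (rule dual_basis)
  then obtain m :: nat and \<alpha> c
    where "\<forall>i<m. \<alpha> i \<in> U \<and> c i \<in> V" "\<forall>i<m. \<forall>j<m. \<alpha> i (c j) = (if i = j then 1 else 0)"
      "\<forall>a\<in>U. a = (\<Sum>i<m. fscale (a (c i)) (\<alpha> i))"
    by (elim exE conjE) (rule that)
  then have "koszul_component s V K U m \<alpha> c"
    using assms by unfold_locales
  then show ?thesis by blast
qed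

text \<open>Nakayama's lemma at \<open>(a, a)\<close>, now with all minors as generators: by
  \<open>minors_off_resonance\<close> only minors of the kernel of \<open>a\<close> matter modulo
  \<open>K\<close>, and the Koszul relation pulls an element of this kernel out of them. So the
  whole Koszul module vanishes near \<open>a\<close>.\<close>

lemma annihilate_off_resonance:
  assumes a: "a \<in> D" "a \<notin> resonance s V K"
  shows "\<exists>j. \<exists>g\<in>forms (coord D ` V) j. g (a, a) \<noteq> 0 \<and>
    (\<forall>q. \<forall>x\<in>cycles q. g * x \<in> boundaries (q + j))"
proof -
  have "a \<noteq> 0" using a(2) by (auto simp: resonance_def)
  then obtain v where v: "v \<in> V" "a v = 1" using nonzero_dual[OF a(1)] by blast
  let ?N = "coord D ` ann {a}" and ?Y = "minors D V"
  have "\<exists>j. \<exists>g\<in>forms (coord D ` V) j. g (a, a) \<noteq> 0 \<and> (\<forall>y\<in>?Y. g * y \<in> boundaries j)"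
  proof (rule nakayama_fin_dim)
    show "fin_dim ?Y" by (rule fin_dim_minors)
    show "graded_module (coord D ` V) boundaries" by (rule graded_modules(2))
    show "coord D v \<in> coord D ` V" "coord D v (a, a) = 1"
      using v a by (simp_all add: coord_apply eval_at_def)
    show "?N \<subseteq> coord D ` V" using ann_subset by blast
    show "n (a, a) = 0" if "n \<in> ?N" for n using that a by (auto simp: ann_def coord_apply eval_at_def)
    fix y assume y: "y \<in> ?Y"
    show "coord D v * y \<in> ?N \<odot> ?Y + boundaries 1"
    proof (rule mult_pairing_Un)
      show "coord D v \<in> coord D ` V" using v(1) by simp
      show "y \<in> fspan (pairing ` K \<union> minors D (ann {a}))" using minors_off_resonance[OF a v] y by blast
      fix y assume "y \<in> minors D (ann {a})"
      then obtain n n' where n: "n \<in> ann {a}" "n' \<in> ann {a}" "y = minor D n n'" by (auto simp: minors_def)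
      have "minor D v n \<in> ?Y" "minor D v n' \<in> ?Y"
        using n(1,2) v(1) ann_subset unfolding minors_def by blast+
      then show "coord D v * y \<in> ?N \<odot> ?Y"
        unfolding n(3) coord_mult_minor[of v n n'] using n(1,2)
        by (intro fscale.subspace_diff[OF span_times_subspace] span_timesI imageI)
    qed simp
  qed
  then obtain j g where g: "g \<in> forms (coord D ` V) j" "g (a, a) \<noteq> 0" "\<And>y. y \<in> ?Y \<Longrightarrow> g * y \<in> boundaries j"
    by blast
  from g(3) have "g * x \<in> boundaries (q + j)" if "x \<in> cycles q" for q x
    using that unfolding cycles_def by (rule forms_annihilate_generated[OF graded_modules(2) g(1)])
  with g(1,2) show ?thesis by blast
qed

text \<open>If \<open>c \<and> b\<close> is in \<open>K\<^sup>\<bottom>\<close>, then all boundaries vanish at the point \<open>(b, c)\<close>.\<close>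

lemma annihilator_vanishes_on_resonance:
  assumes f: "f \<in> forms (coord D ` V) j" "\<And>y. y \<in> minors D V \<Longrightarrow> f * y \<in> boundaries j"
    and c: "c \<in> resonance s V K" "c \<noteq> 0"
  shows "f (c, c) = 0"
proof -
  have cD: "c \<in> D" using c(1) resonance_subset by blast
  from c obtain b where b: "b \<in> D" "wedge_list [c, b] \<in> perp s V K" "wedge_list [c, b] \<noteq> 0"
    unfolding resonance_def by blast
  then obtain xs where xs: "wedge_list [c, b] xs \<noteq> 0" by (auto simp: fun_eq_iff)
  then have "length xs = 2" using wedge_list_2_eq_0 by metis
  then obtain u v where "xs = [u, v]" by (auto simp: numeral_2_eq_2 length_Suc_conv)
  with xs have nz: "c u * b v - c v * b u \<noteq> 0" by (simp add: wedge_list_2)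
  then have uv: "u \<in> V" "v \<in> V" using dualD(3)[OF cD] dualD(3)[OF b(1)] by (metis diff_self mult_zero_left mult_zero_right)+
  have "boundaries j \<subseteq> {h. h (b, c) = 0}"
    unfolding boundaries_def
  proof (rule generated_minimal)
    show "graded_module (coord D ` V) (\<lambda>_. {h. h (b, c) = 0})"
      unfolding graded_module_def by (auto simp: fscale_def intro!: fscale.subspaceI)
    show "pairing ` K \<subseteq> {h. h (b, c) = 0}"
      using perp_wedgeD[OF b(2) cD b(1)] by (auto simp: pairing_def)
  qed
  moreover have "minor D u v \<in> minors D V" using uv by (auto simp: minors_def)
  then have "f * minor D u v \<in> boundaries j" by (rule f(2))
  ultimately have "(f * minor D u v) (b, c) = 0" by blast
  moreover have "minor D u v (b, c) \<noteq> 0"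
    using nz cD b(1) by (simp add: minor_apply eval_at_def mult.commute)
  ultimately have "f (b, c) = 0" by simp
  \<comment> \<open>A line with direction 0 shows that \<open>f\<close> does not depend on its first
    argument.\<close>
  moreover obtain p where "\<And>t b. f (b, c + fscale t 0) = poly p t"
    using forms_polynomial_on_lines[OF f(1) cD fscale.subspace_0[OF fsubspace_dual]] by blast
  from this[of b 0] this[of c 0] have "f (b, c) = f (c, c)" by simp
  ultimately show ?thesis by simp
qed

text \<open>Near a common nonzero point \<open>a\<close> of two components the Koszul module is annihilated by both
  annihilators, so its support there is smaller than either component.\<close>

lemma components_disjoint:
  assumes U: "koszul_component s V K U m \<alpha> c" "separable_subspace s V K U" "U \<subseteq> resonance s V K"
    and U': "koszul_component s V K U' m' \<alpha>' c'" "separable_subspace s V K U'"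
    and "\<not> U \<subseteq> U'"
  shows "U \<inter> U' \<subseteq> {0}"
proof (rule subsetI, rule ccontr)
  fix a assume "a \<in> U \<inter> U'" and "a \<notin> {0}"
  then have a: "a \<in> U" "a \<in> U'" "a \<noteq> 0" by auto
  interpret u: koszul_component s V K U m \<alpha> c by (rule U(1))
  interpret u': koszul_component s V K U' m' \<alpha>' c' by (rule U'(1))
  \<comment> \<open>The line a + t e stays inside \<open>U\<close> but leaves \<open>U'\<close>; the
    vector \<open>n\<close> detects this, as it vanishes on \<open>U'\<close> and not at
    \<open>e\<close>.\<close>
  obtain e where e: "e \<in> U" "e \<notin> U'" using assms(6) by blast
  have aD: "a \<in> D" and eD: "e \<in> D" using a(1) e(1) u.U(2) by auto
  obtain n where n: "n \<in> ann U'" "e n \<noteq> 0" using u'.double_annihilator[OF eD] e(2) by blast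
  have nV: "n \<in> V" using n(1) ann_subset by blast
  obtain j' g' where g': "g' \<in> forms (coord D ` V) j'" "g' (a, a) \<noteq> 0"
    "\<And>q x. x \<in> relative U' q \<Longrightarrow> g' * x \<in> boundaries (q + j')"
    using u'.annihilate_relative[OF U'(2) a(2,3)] by blast
  obtain p' where p': "\<And>t b. g' (b, a + fscale t e) = poly p' t"
    using forms_polynomial_on_lines[OF g'(1) aD eD] by blast
  have "poly p' 0 \<noteq> 0" using g'(2) p'[of a 0] by simp
  then have "p' \<noteq> 0" by auto
  then have "finite ({t. poly p' t = 0} \<union> {0})" by (simp add: poly_roots_finite)
  then obtain t where t: "poly p' t \<noteq> 0" "t \<noteq> 0" using ex_new_if_finite[OF infinite_UNIV_char_0] by blast
  let ?c = "a + fscale t e"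
  have cU: "?c \<in> U" using a(1) e(1) by (intro fscale.subspace_add[OF u.U(1)] fscale.subspace_scale[OF u.U(1)])
  have "a n = 0" using n(1) a(2) by (auto simp: ann_def)
  then have cn: "?c n \<noteq> 0" using n(2) t(2) by (simp add: fscale_def)
  then have "?c \<noteq> 0" by (metis zero_fun_apply)
  have "coord D n \<in> forms (coord D ` V) 1" using nV by (intro forms_one imageI)
  \<comment> \<open>This form annihilates the whole Koszul module: \<open>n\<close> carries cycles
    into \<open>relative U'\<close>, and \<open>g'\<close> carries these into the boundaries. It
    must then vanish on the resonance variety, in particular at \<open>?c\<close>, where both
    factors are nonzero.\<close>
  then have f: "g' * coord D n \<in> forms (coord D ` V) (1 + j')" by (rule forms_mult[OF _ g'(1)])
  have "(g' * coord D n) (?c, ?c) = 0"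
  proof (rule annihilator_vanishes_on_resonance[OF f _ _ \<open>?c \<noteq> 0\<close>])
    show "?c \<in> resonance s V K" using cU U(3) by blast
    fix y assume "y \<in> minors D V"
    then have "y \<in> cycles 0" unfolding cycles_def by (rule generated_base)
    then have "coord D n * y \<in> relative U' (Suc 0)"
      by (intro coord_mult_cycles nV u'.separable_minors[OF U'(2) n(1)])
    from g'(3)[OF this] show "g' * coord D n * y \<in> boundaries (1 + j')"
      by (simp only: mult.assoc One_nat_def)
  qed
  moreover have "?c \<in> D" using cU u.U(2) by blast
  ultimately show False using t(1) cn p'[of ?c t] by (simp add: coord_apply eval_at_def)
qed

text \<open>Dual to the trivial intersection: a functional on linear forms that kills both
  annihilators is evaluation at a point lying in \<open>U\<close> and in \<open>U'\<close>.\<close>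

lemma coord_sum_annihilators:
  assumes U: "koszul_component s V K U m \<alpha> c" and U': "koszul_component s V K U' m' \<alpha>' c'"
    and "U \<inter> U' \<subseteq> {0}"
  shows "coord D ` V \<subseteq> coord D ` ann U + coord D ` ann U'"
proof clarify
  interpret u: koszul_component s V K U m \<alpha> c by (rule U)
  interpret u': koszul_component s V K U' m' \<alpha>' c' by (rule U')
  fix v assume v: "v \<in> V"
  have sub: "fsubspace (coord D ` ann U)" "fsubspace (coord D ` ann U')"
    by (intro fsubspace_coord ann_subspace ann_subset u.U u'.U)+
  show "coord D v \<in> coord D ` ann U + coord D ` ann U'" (is "_ \<in> ?S")
  proof (rule ccontr)
    assume "coord D v \<notin> ?S"
    then obtain \<phi> where \<phi>: "functional \<phi>" "\<And>x. x \<in> ?S \<Longrightarrow> \<phi> x = 0" "\<phi> (coord D v) = 1"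
      using separating_functional[OF fsubspace_plus[OF sub]] by blast
    let ?a = "\<lambda>u. if u \<in> V then \<phi> (coord D u) else 0"
    have a: "?a \<in> D" by (rule functional_dual[OF \<phi>(1) coord_add coord_scale])
    have "?a n = 0" if "n \<in> ann U" for n
      using that \<phi>(2) plus_superset1[OF sub(2), of "coord D ` ann U"] by auto
    then have "?a \<in> U" by (rule u.double_annihilator[OF a])
    moreover have "?a n = 0" if "n \<in> ann U'" for n
      using that \<phi>(2) plus_superset2[OF sub(1), of "coord D ` ann U'"] by auto
    then have "?a \<in> U'" by (rule u'.double_annihilator[OF a])
    ultimately have "?a = 0" using assms(3) by blast
    from fun_cong[OF this, of v] show False using \<phi>(3) v by simp
  qed
qed

text \<open>Of the irreducible components only this is used: they are finitely many separable
  subspaces, none inside another, that cover the resonance variety.\<close>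

theorem koszul_dim_eventually:
  fixes T :: "'t set"
  assumes "finite T" and U: "\<And>t. t \<in> T \<Longrightarrow> fsubspace (U t)" "\<And>t. t \<in> T \<Longrightarrow> separable_subspace s V K (U t)"
    and cover: "resonance s V K = (\<Union>t\<in>T. U t)"
    and incomparable: "\<And>t t'. t \<in> T \<Longrightarrow> t' \<in> T \<Longrightarrow> t \<noteq> t' \<Longrightarrow> \<not> U t \<subseteq> U t'"
  shows "\<forall>\<^sub>F q in sequentially. koszul_dim s V K q = (\<Sum>t\<in>T. fdim (cycles q) - fdim (relative (U t) q))"
proof -
  let ?X = "coord D ` V"
  have UR: "U t \<subseteq> resonance s V K" if "t \<in> T" for t using cover that by blast
  have "\<exists>m \<alpha> c. koszul_component s V K (U t) m \<alpha> c" if "t \<in> T" for t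
    using U(1)[OF that] UR[OF that] resonance_subset by (intro koszul_component_exists) auto
  then obtain m \<alpha> c where comp: "\<And>t. t \<in> T \<Longrightarrow> koszul_component s V K (U t) (m t) (\<alpha> t) (c t)" by metis
  \<comment> \<open>The quotient of \<open>P\<close> by the boundaries measures the difference
    between the two sides of the dimension formula.\<close>
  define P where "P q = cycles q \<inter> (\<Inter>t\<in>T. relative (U t) q)" for q
  have X: "fsubspace ?X" using subspace by (rule fsubspace_coord) simp
  obtain X0 where X0: "finite X0" "X0 \<subseteq> ?X" "?X \<subseteq> fspan X0" using fin_dim_coord by (rule fin_dim_basis)
  have spanX0: "fspan X0 = ?X" using X0 X by (intro subset_antisym fscale.span_minimal)
  have P: "graded_module ?X P"
    unfolding graded_module_def P_def
    by (intro conjI allI ballI fscale.subspace_inter fscale.subspace_Int fsubspace_cycles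
        fsubspace_relative)
      (auto intro: graded_moduleD(2)[OF graded_modules(1)] graded_moduleD(2)[OF graded_modules(3)])
  have BP: "boundaries q \<subseteq> P q" for q
    unfolding P_def using boundaries_subset_relative relative_subset_cycles by blast
  have PA: "P q \<subseteq> cycles q" for q by (auto simp: P_def)
  note X0mod = graded_module_mono[OF graded_modules(1) X0(2)] graded_module_mono[OF graded_modules(2) X0(2)]
    graded_module_mono[OF P X0(2)]
  have genA: "cycles (Suc q) \<subseteq> ?X \<odot> cycles q" for q by (simp add: cycles_def)
  have "cycles (Suc q) \<subseteq> X0 \<odot> cycles q + boundaries (Suc q)" for q
    using genA[of q] plus_superset1[OF fsubspace_boundaries, of "X0 \<odot> cycles q" "Suc q"]
    unfolding spanX0[symmetric] span_times_fspan_left by blast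
  from noetherian[OF X0(1) X0mod BP PA fin_dim_cycles this]
  obtain q0 where q0: "\<And>q. q \<ge> q0 \<Longrightarrow> P (Suc q) \<subseteq> X0 \<odot> P q + boundaries (Suc q)" by blast
  have "eventually (\<lambda>q. P q = boundaries q) sequentially"
  proof (rule fibres_vanish[OF X0(1) X0mod(3,2) BP])
    show "fin_dim (P q)" for q by (rule fin_dim_mono[OF PA fin_dim_cycles])
    fix H v assume H: "fsubspace H" "fspan (insert v H) = fspan X0"
    show "eventually (\<lambda>q. P (Suc q) \<subseteq> H \<odot> P q + boundaries (Suc q)) sequentially"
    proof (cases "v \<in> H")
      \<comment> \<open>Here \<open>H\<close> consists of all linear forms and determines no nonzero
        point; the inclusion is just the finite generation of \<open>P\<close>.\<close>
      case True
      have "fspan H = H" using H(1) by simp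
      with True have "fspan X0 = H" using H(2) by (simp only: insert_absorb)
      then have "H \<odot> P q = X0 \<odot> P q" for q using span_times_fspan_left[of X0 "P q"] by simp
      then show ?thesis using q0 unfolding eventually_sequentially by metis
    next
      case False
      from separating_functional[OF H(1) this]
      obtain \<phi> where \<phi>: "functional \<phi>" "\<And>x. x \<in> H \<Longrightarrow> \<phi> x = 0" "\<phi> v = 1" by blast
      \<comment> \<open>The nonzero point at which exactly the linear forms in \<open>H\<close>
        vanish.\<close>
      define a where "a u = (if u \<in> V then \<phi> (coord D u) else 0)" for u
      have a: "a \<in> D" unfolding a_def by (rule functional_dual[OF \<phi>(1) coord_add coord_scale])
      have aX: "x (a, a) = \<phi> x" if "x \<in> ?X" for x
        using that a by (auto simp: coord_apply eval_at_def) (simp add: a_def)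
      have HX: "insert v H \<subseteq> ?X" using H(2) spanX0 fscale.span_superset[of "insert v H"] by simp
      have "a \<noteq> 0"
      proof
        assume "a = 0"
        have "v \<in> ?X" using HX by blast
        then obtain u where "u \<in> V" "v = coord D u" by blast
        then show False using \<phi>(3) fun_cong[OF \<open>a = 0\<close>, of u] by (simp add: a_def)
      qed
      have "\<exists>j. \<exists>g\<in>forms ?X j. g (a, a) \<noteq> 0 \<and> (\<forall>q. \<forall>x\<in>P q. g * x \<in> boundaries (q + j))"
      proof (cases "a \<in> resonance s V K")
        case True
        then obtain t where t: "t \<in> T" "a \<in> U t" using cover by blast
        interpret u: koszul_component s V K "U t" "m t" "\<alpha> t" "c t" by (rule comp[OF t(1)])
        have "P q \<subseteq> relative (U t) q" for q using t(1) by (auto simp: P_def)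
        with u.annihilate_relative[OF U(2)[OF t(1)] t(2) \<open>a \<noteq> 0\<close>] show ?thesis by blast
      next
        case False
        from annihilate_off_resonance[OF a this] PA show ?thesis by blast
      qed
      then obtain j g where g: "g \<in> forms ?X j" "g (a, a) \<noteq> 0" "\<And>q x. x \<in> P q \<Longrightarrow> g * x \<in> boundaries (q + j)"
        by blast
      show ?thesis
      proof (rule fibre_zero[OF P graded_modules(2) BP _ _ _ H(1) _ _ X g])
        show "P (Suc q) \<subseteq> ?X \<odot> P q + boundaries (Suc q)" if "q \<ge> q0" for q
          using q0[OF that] unfolding spanX0[symmetric] span_times_fspan_left .
        show "v \<in> ?X" "H \<subseteq> ?X" using HX by auto
        then show "v (a, a) = 1" using aX \<phi>(3) by simp
        fix x assume x: "x \<in> ?X" "x (a, a) = 0"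
        then have "x \<in> fspan (insert v H)" using H(2) spanX0 by simp
        then obtain d where d: "x - fscale d v \<in> H"
          using fscale.span_breakdown_eq[of x v H] H(1) by (auto simp: fscale.span_eq_iff[THEN iffD2])
        have "\<phi> x = \<phi> ((x - fscale d v) + fscale d v)" by simp
        also have "\<dots> = d" unfolding functionalD[OF \<phi>(1)] \<phi>(2)[OF d] \<phi>(3) by simp
        finally have "d = 0" using aX[OF x(1)] x(2) by simp
        then show "x \<in> H" using d by simp
      qed
    qed
  qed
  moreover have "fdim (cycles q) - fdim (P q) = (\<Sum>t\<in>T. fdim (cycles q) - fdim (relative (U t) q))"
    if "q \<ge> card T" for q
    unfolding P_def
  proof (rule fdim_Int_additive[OF graded_modules(1) graded_modules(3) relative_subset_cycles fin_dim_cycles genA,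
        where N = "\<lambda>t. coord D ` ann (U t)"])
    show "coord D ` ann (U t) \<subseteq> ?X" for t using ann_subset by blast
    show "?X \<subseteq> coord D ` ann (U t) + coord D ` ann (U t')" if t: "t \<in> T" "t' \<in> T" "t \<noteq> t'" for t t'
      using components_disjoint[OF comp U(2) UR comp U(2) incomparable] t
      by (intro coord_sum_annihilators[OF comp comp]) auto
    show "n * x \<in> relative (U t) (Suc q)" if t: "t \<in> T" "n \<in> coord D ` ann (U t)" "x \<in> cycles q" for t n x q
    proof -
      interpret u: koszul_component s V K "U t" "m t" "\<alpha> t" "c t" by (rule comp[OF t(1)])
      obtain w where w: "w \<in> ann (U t)" "n = coord D w" using t(2) by blast
      have "w \<in> V" using w(1) ann_subset by blast
      then show ?thesis
        unfolding w(2) by (intro coord_mult_cycles t(3) u.separable_minors[OF U(2)[OF t(1)] w(1)])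
    qed
  qed (use assms(1) that in auto)
  then have "eventually (\<lambda>q. fdim (cycles q) - fdim (P q)
      = (\<Sum>t\<in>T. fdim (cycles q) - fdim (relative (U t) q))) sequentially"
    unfolding eventually_sequentially by blast
  ultimately show ?thesis
    by eventually_elim (simp add: koszul_dim_eq)
qed

end

theorem theorem1p2:
  fixes scale :: "'k::{alg_closed_field, field_char_0} \<Rightarrow> 'v::ab_group_add \<Rightarrow> 'v"
    and V :: "'v set"
    and K :: "(('v \<Rightarrow> 'k) list \<Rightarrow> 'k) set"
    and Vd :: "nat \<Rightarrow> ('v \<Rightarrow> 'k) set"
    and k :: nat
  assumes "vector_space scale"
    and "module.subspace scale V"
    and "\<exists>B. finite B \<and> module.span scale B = V"
    and "fsubspace K" and "K \<subseteq> ext_power (fun_copy scale V) 2"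
    and "separable_koszul_module scale V K"
    and "bij_betw Vd {1..k} (irreducible_components scale V (resonance scale V K))"
  shows "\<forall>\<^sub>F q in sequentially.
    koszul_dim scale V K q =
      (\<Sum>t=1..k. koszul_dim fscale (dual fscale (Vd t))
         (ext_map V (dual fscale (dual fscale (Vd t))) (eval_at (Vd t)) ` K) q)"
proof -
  interpret koszul_pair scale V K
    using assms(1-5) by (rule koszul_pair.intro)
  let ?R = "resonance scale V K"
  have mem: "Vd t \<in> irreducible_components scale V ?R" if "t \<in> {1..k}" for t
    using assms(7) that by (auto simp: bij_betw_def)
  have sub: "fsubspace (Vd t)" and sep: "separable_subspace scale V K (Vd t)" if "t \<in> {1..k}" for t
    using assms(6) mem[OF that] by (auto simp: separable_koszul_module_def)
  have R: "Vd t \<subseteq> ?R" if "t \<in> {1..k}" for t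
    using mem[OF that] by (auto simp: irreducible_components_def)
  have "\<exists>t\<in>{1..k}. a \<in> Vd t" if "a \<in> ?R" for a
    using irreducible_component_exists[OF that, of scale V] assms(7) by (auto simp: bij_betw_def)
  then have cover: "?R = (\<Union>t\<in>{1..k}. Vd t)" using R by blast
  \<comment> \<open>Maximality turns an inclusion of components into an equality, which the
    injectivity of \<open>Vd\<close> excludes for different indices.\<close>
  have inc: "\<not> Vd t \<subseteq> Vd t'" if t: "t \<in> {1..k}" "t' \<in> {1..k}" "t \<noteq> t'" for t t'
  proof
    assume "Vd t \<subseteq> Vd t'"
    have "zariski_irreducible scale V (Vd t')" using mem[OF t(2)] by (simp add: irreducible_components_def)
    moreover have "\<forall>Y. Vd t \<subseteq> Y \<and> Y \<subseteq> ?R \<and> zariski_irreducible scale V Y \<longrightarrow> Y = Vd t"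
      using mem[OF t(1)] by (simp add: irreducible_components_def)
    ultimately have "Vd t' = Vd t" using \<open>Vd t \<subseteq> Vd t'\<close> R[OF t(2)] by blast
    then show False using inj_onD[OF bij_betw_imp_inj_on[OF assms(7)] _ t(2,1)] t(3) by simp
  qed
  have dim: "koszul_dim fscale (dual fscale (Vd t))
      (ext_map V (dual fscale (dual fscale (Vd t))) (eval_at (Vd t)) ` K) q
      = fdim (cycles q) - fdim (relative (Vd t) q)" if t: "t \<in> {1..k}" for t q
  proof -
    have "Vd t \<subseteq> dual scale V" using R[OF t] resonance_subset by blast
    then obtain m \<alpha> c where "koszul_component scale V K (Vd t) m \<alpha> c"
      using koszul_component_exists[OF sub[OF t]] by blast
    then show ?thesis by (rule koszul_component.koszul_dim_component[OF _ sep[OF t]])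
  qed
  have "\<forall>\<^sub>F q in sequentially. koszul_dim scale V K q
      = (\<Sum>t=1..k. fdim (cycles q) - fdim (relative (Vd t) q))"
    using finite_atLeastAtMost sub sep cover inc by (rule koszul_dim_eventually)
  then show ?thesis by (rule eventually_mono) (simp add: dim)
qed

end
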